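(* For every $\epsilon>0$ and every integer $q\ge2$ there exist $\kappa>0$ and an integer $k$ such that for infinitely many $n$ there exists a Not-Equal-CSP instance $\mathcal I$ of arity $k$ over $n$ variables with domain $\mathbb Z_q$ satisfying (1) $\mathrm{OPT}(\mathcal I)\le\epsilon$, and (2) there is a solution to the $n^\kappa$-round Sherali–Adams relaxation of $\mathcal I$ of value $1-1/q-\epsilon$.
   Context: Let $\mathbb Z_q=\{0,\dots,q-1\}$. A Not-Equal-CSP instance of arity $k$ over variables $x_1,\dots,x_n\in\mathbb Z_q$ is a finite list of predicates $P_1,\dots,P_m$, each indexed by a set $S=\{i_1,\dots,i_k\}\subseteq[n]$ and a vector $A=(a_1,\dots,a_k)\in\mathbb Z_q^k$ and defined by $P_{S,A}(x)=1$ iff $x_{i_j}\ne a_j$ for all $j$. $\mathrm{OPT}(\mathcal I)$ is the maximum over $x\in\mathbb Z_q^n$ of the fraction of satisfied predicates. For $r\ge k$, a solution to the $r$-round Sherali–Adams relaxation is a collection of probability distributions $\mathcal D(S)$ on $\mathbb Z_q^S$, one for each $S\subseteq[n]$ with $|S|\le r$, consistent in the sense that for $S'\subseteq S$ the marginal of $\mathcal D(S)$ on $\mathbb Z_q^{S'}$ is $\mathcal D(S')$. Its value is $\frac1m\sum_i\Pr_{\alpha\sim\mathcal D(S_i)}[\alpha\text{ satisfies }P_i]$, where $S_i$ is the index set of $P_i$. *)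

theory Defs
  imports "HOL-Probability.Probability"
begin

text \<open>
  Variables are \<open>1, \<dots>, n\<close> and the domain is \<open>{..<q}\<close>; an element of \<open>\<int>\<^sub>q\<^sup>S\<close> is an extensional
  function in \<open>S \<rightarrow>\<^sub>E {..<q}\<close>.  A predicate is a pair \<open>(S, a)\<close>: the vector
  \<open>A = (a\<^sub>1, \<dots>, a\<^sub>k)\<close> is stored as the function \<open>a\<close> on \<open>S = {i\<^sub>1, \<dots>, i\<^sub>k}\<close> with \<open>a i\<^sub>j = a\<^sub>j\<close>.
\<close>

type_synonym assignment = "nat \<Rightarrow> nat"
type_synonym ne_pred = "nat set \<times> assignment"

definition assignments :: "nat \<Rightarrow> nat set \<Rightarrow> assignment set" where
  "assignments q S = S \<rightarrow>\<^sub>E {..<q}"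

definition ne_sat :: "ne_pred \<Rightarrow> assignment \<Rightarrow> bool" where
  "ne_sat P x \<longleftrightarrow> (\<forall>i\<in>fst P. x i \<noteq> snd P i)"

text \<open>
  The list is required to be nonempty so that fractions of satisfied predicates make sense;
  repeated predicates are allowed.
\<close>

definition ne_csp :: "nat \<Rightarrow> nat \<Rightarrow> nat \<Rightarrow> ne_pred list \<Rightarrow> bool" where
  "ne_csp q k n I \<longleftrightarrow> I \<noteq> [] \<and>
     (\<forall>(S, a)\<in>set I. S \<subseteq> {1..n} \<and> card S = k \<and> a \<in> assignments q S)"

definition frac_sat :: "ne_pred list \<Rightarrow> assignment \<Rightarrow> real" where
  "frac_sat I x = real (length (filter (\<lambda>P. ne_sat P x) I)) / real (length I)"

definition ne_opt :: "nat \<Rightarrow> nat \<Rightarrow> ne_pred list \<Rightarrow> real" where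
  "ne_opt q n I = Max (frac_sat I ` assignments q {1..n})"

definition sa_solution :: "nat \<Rightarrow> nat \<Rightarrow> nat \<Rightarrow> (nat set \<Rightarrow> assignment pmf) \<Rightarrow> bool" where
  "sa_solution q n r D \<longleftrightarrow>
     (\<forall>S. S \<subseteq> {1..n} \<and> card S \<le> r \<longrightarrow>
        set_pmf (D S) \<subseteq> assignments q S \<and>
        (\<forall>S'\<subseteq>S. map_pmf (\<lambda>\<alpha>. restrict \<alpha> S') (D S) = D S'))"

definition sa_value :: "ne_pred list \<Rightarrow> (nat set \<Rightarrow> assignment pmf) \<Rightarrow> real" where
  "sa_value I D =
     (\<Sum>P\<leftarrow>I. measure_pmf.prob (D (fst P)) {\<alpha>. ne_sat P \<alpha>}) / real (length I)"

end

theory Submission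
  imports Defs
begin

text \<open>
  The instance is a sparse random \<open>k\<close>-partite hypergraph with random forbidden values; a union bound
  over assignments gives the bound on the optimum.  A local solution comes from a Gaussian vector with one
  coordinate per variable and value: the value of a variable is the index of its largest coordinate,
  shifted by one global uniform element of \<open>\<int>\<^sub>q\<close>.  The covariance of two coordinates is \<open>\<rho>\<^sup>d\<close> if a
  short non-backtracking walk of length \<open>d\<close> in the incidence graph, twisted by the forbidden values, joins
  them, and \<open>0\<close> otherwise.  Local distributions are then automatically consistent, and with \<open>\<rho>\<close> close to \<open>1\<close>
  all variables of an edge agree, with probability close to \<open>1\<close>, up to the shift by the forbidden values, so that the
  predicate fails only with probability about \<open>1 / q\<close>.

  What has to be shown is that this covariance, after adding a small multiple of the identity, is positive
  definite on every set of \<open>n\<^sup>\<kappa>\<close> variables.  On a forest the kernel \<open>\<rho>\<^sup>d\<close> is \<open>1 - \<rho>\<^sup>2\<close> times the inverse of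
  \<open>(1 - \<rho>\<^sup>2) I + \<rho>\<^sup>2 D - \<rho> A\<close>.  In a random hypergraph, small sets span graphs of logarithmic girth that
  become forests by repeatedly deleting vertices of degree at most one and paths of logarithmically many vertices
  of degree two; the former deletions split off a square from the quadratic form of this matrix, the
  latter do so up to an error that is a negative power of \<open>n\<close>.
\<close>

section \<open>Quadratic forms on finite index sets\<close>

text \<open>One parameter \<open>h\<close> sets all scales: the kernel is cut off at length
  \<open>2 * h\<close>, the deleted paths have \<open>2 * h\<close> vertices, walks of at most
  \<open>2 * h + 3\<close> vertices are unique, and there are \<open>k * B ^ (16 * h)\<close>
  variables with \<open>B\<close> constant. The errors are powers of \<open>\<rho> ^ h\<close>, that
  is, negative powers of the number of variables, multiplied by powers of the size of a local set;
  \<open>\<kappa>\<close> is chosen so small that the former win. Therefore \<open>\<rho>\<close>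
  and the added diagonal \<open>\<zeta>\<close> need not depend on \<open>h\<close>; they only have
  to make the correlation \<open>\<rho>\<^sup>2 / (1 + \<zeta>)\<close> between matched coordinates
  of two variables of an edge close to 1. The obstacle is that sets of this size may still contain
  long cycles, so the kernel has no exact inverse in closed form. Only two things are shown: the
  candidate inverse is bounded below, and its product with the kernel is entrywise close to a
  multiple of the identity. Together they bound the kernel from below. Edges on short cycles keep
  their predicates but are left out of the graph, and their share of the value is given up.\<close>

lemma add_mod_inject:
  fixes t t' :: nat
  assumes "(w + t) mod q = (w + t') mod q" "t < q" "t' < q"
  shows "t = t'"
proof -
  have *: "t = t'" if "t' \<le> t" "(w + t) mod q = (w + t') mod q" "t < q" for t t'
  proof -
    have "q dvd (w + t) - (w + t')" using that mod_eq_dvd_iff_nat[of "w + t'" "w + t" q] by simp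
    then have "q dvd t - t'" by simp
    then have "t - t' = 0" using that(3) by (meson dvd_imp_le leD less_imp_diff_less neq0_conv)
    then show ?thesis using that(1) by simp
  qed
  show ?thesis using *[of t' t] *[of t t'] assms by (metis nle_le)
qed

definition qform :: "'a set \<Rightarrow> ('a \<Rightarrow> 'a \<Rightarrow> real) \<Rightarrow> ('a \<Rightarrow> real) \<Rightarrow> real" where
  "qform X K w = (\<Sum>u\<in>X. \<Sum>v\<in>X. K u v * w u * w v)"

definition posdef :: "'a set \<Rightarrow> ('a \<Rightarrow> 'a \<Rightarrow> real) \<Rightarrow> bool" where
  "posdef X K \<longleftrightarrow> (\<forall>w. (\<exists>u\<in>X. w u \<noteq> 0) \<longrightarrow> 0 < qform X K w)"

definition symm_on :: "'a set \<Rightarrow> ('a \<Rightarrow> 'a \<Rightarrow> real) \<Rightarrow> bool" where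
  "symm_on X K \<longleftrightarrow> (\<forall>u\<in>X. \<forall>v\<in>X. K u v = K v u)"

definition inverse_on :: "'a set \<Rightarrow> ('a \<Rightarrow> 'a \<Rightarrow> real) \<Rightarrow> ('a \<Rightarrow> 'a \<Rightarrow> real) \<Rightarrow> bool" where
  "inverse_on X Q K \<longleftrightarrow> (\<forall>u\<in>X. \<forall>v\<in>X. (\<Sum>t\<in>X. Q u t * K t v) = of_bool (u = v))"

lemma symm_onD: "symm_on X K \<Longrightarrow> u \<in> X \<Longrightarrow> v \<in> X \<Longrightarrow> K u v = K v u"
  unfolding symm_on_def by blast

lemma qform_insert:
  assumes "finite X" "u \<notin> X" "symm_on (insert u X) K"
  shows "qform (insert u X) K w = qform X K w + 2 * w u * (\<Sum>v\<in>X. K u v * w v) + K u u * (w u)^2"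
proof -
  have 1: "(\<Sum>v\<in>X. K v u * w v * w u) = w u * (\<Sum>v\<in>X. K u v * w v)"
    unfolding sum_distrib_left by (intro sum.cong refl) (simp add: symm_onD[OF assms(3), of _ u])
  have 2: "(\<Sum>v\<in>X. K u v * w u * w v) = w u * (\<Sum>v\<in>X. K u v * w v)"
    unfolding sum_distrib_left by (intro sum.cong) auto
  have "qform (insert u X) K w = K u u * w u * w u + (\<Sum>v\<in>X. K u v * w u * w v)
      + ((\<Sum>v\<in>X. K v u * w v * w u) + qform X K w)"
    unfolding qform_def using assms(1,2) by (simp add: sum.distrib)
  then show ?thesis unfolding 1 2 by (simp add: power2_eq_square)
qed

lemma qform_alt: "qform X K z = (\<Sum>u\<in>X. (\<Sum>v\<in>X. K u v * z v) * z u)"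
  unfolding qform_def by (simp add: sum_distrib_left sum_distrib_right mult_ac)

lemma qform_cong: "(\<And>u. u \<in> X \<Longrightarrow> w u = w' u) \<Longrightarrow> qform X K w = qform X K w'"
  unfolding qform_def by (intro sum.cong) auto

lemma posdefD: "posdef X K \<Longrightarrow> u \<in> X \<Longrightarrow> w u \<noteq> 0 \<Longrightarrow> 0 < qform X K w"
  unfolding posdef_def by blast

lemma posdef_mono:
  assumes "posdef Y K" "X \<subseteq> Y" "finite Y"
  shows "posdef X K"
  unfolding posdef_def
proof (intro allI impI)
  fix w :: "'a \<Rightarrow> real" assume w: "\<exists>u\<in>X. w u \<noteq> 0"
  let ?w = "\<lambda>u. if u \<in> X then w u else 0"
  obtain u where u: "u \<in> X" "w u \<noteq> 0" using w by blast
  then have "0 < qform Y K ?w" using assms(2) by (intro posdefD[OF assms(1), of u]) auto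
  also have "qform Y K ?w = (\<Sum>u\<in>Y. if u \<in> X then \<Sum>v\<in>Y. if v \<in> X then K u v * w u * w v else 0 else 0)"
    unfolding qform_def
  proof (intro sum.cong refl)
    fix u
    show "(\<Sum>v\<in>Y. K u v * ?w u * ?w v)
        = (if u \<in> X then \<Sum>v\<in>Y. if v \<in> X then K u v * w u * w v else 0 else 0)"
      by (cases "u \<in> X") (simp_all, intro sum.cong refl, simp)
  qed
  also have "\<dots> = qform X K w"
    unfolding qform_def sum.inter_restrict[OF assms(3), symmetric] using assms(2) by (simp add: Int_absorb1)
  finally show "0 < qform X K w" .
qed

section \<open>Inverses of symmetric matrices\<close>

lemma inverse_on_transpose:
  assumes "symm_on X Q" "symm_on X K" "inverse_on X Q K"
  shows "inverse_on X K Q"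
  unfolding inverse_on_def
proof (intro ballI)
  fix u v assume uv: "u \<in> X" "v \<in> X"
  have "(\<Sum>t\<in>X. K u t * Q t v) = (\<Sum>t\<in>X. Q v t * K t u)"
    using uv by (intro sum.cong refl)
      (metis assms(1,2) mult.commute symm_onD)
  then show "(\<Sum>t\<in>X. K u t * Q t v) = of_bool (u = v)"
    using assms(3) uv by (auto simp: inverse_on_def)
qed

lemma sum_of_bool_right:
  fixes f :: "'a \<Rightarrow> real"
  assumes "finite X" "v \<in> X"
  shows "(\<Sum>t\<in>X. f t * of_bool (t = v)) = f v" "(\<Sum>t\<in>X. f t * of_bool (v = t)) = f v"
  using assms by (auto simp: of_bool_def if_distrib sum.delta sum.delta' cong: if_cong)

lemma inverse_on_apply:
  assumes "finite X" "inverse_on X Q K" "u \<in> X"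
  shows "(\<Sum>t\<in>X. Q u t * (\<Sum>v\<in>X. K t v * w v)) = w u"
proof -
  have "(\<Sum>t\<in>X. Q u t * (\<Sum>v\<in>X. K t v * w v)) = (\<Sum>v\<in>X. (\<Sum>t\<in>X. Q u t * K t v) * w v)"
    unfolding sum_distrib_left sum_distrib_right by (subst sum.swap) (simp add: mult.assoc)
  also have "\<dots> = (\<Sum>v\<in>X. w v * of_bool (u = v))"
    using assms(2,3) by (intro sum.cong) (auto simp: inverse_on_def)
  also have "\<dots> = w u" using sum_of_bool_right(2)[OF assms(1,3)] .
  finally show ?thesis .
qed

lemma inverse_on_unique:
  assumes "finite X" "inverse_on X Q K" "inverse_on X K Q'" "u \<in> X" "v \<in> X"
  shows "Q u v = Q' u v"
proof -
  have "Q' u v = (\<Sum>t\<in>X. Q u t * (\<Sum>s\<in>X. K t s * Q' s v))"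
    using inverse_on_apply[OF assms(1,2,4), of "\<lambda>s. Q' s v"] by simp
  also have "\<dots> = (\<Sum>t\<in>X. Q u t * of_bool (t = v))"
    using assms(3,5) by (intro sum.cong) (auto simp: inverse_on_def)
  also have "\<dots> = Q u v" using sum_of_bool_right(1)[OF assms(1,5)] .
  finally show ?thesis by simp
qed

text \<open>The substitution \<open>z = Q x\<close>, undone by \<open>K\<close>, turns one form into
  the other. It carries definiteness over to the inverse.\<close>

lemma qform_inverse:
  assumes "finite X" "symm_on X Q" "inverse_on X K Q"
  shows "qform X Q x = qform X K (\<lambda>u. \<Sum>t\<in>X. Q u t * x t)"
proof -
  let ?z = "\<lambda>u. \<Sum>t\<in>X. Q u t * x t"
  have "qform X K ?z = (\<Sum>u\<in>X. (\<Sum>v\<in>X. K u v * ?z v) * ?z u)"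
    by (rule qform_alt)
  also have "\<dots> = (\<Sum>u\<in>X. x u * ?z u)"
    using inverse_on_apply[OF assms(1,3)] by (intro sum.cong) auto
  also have "\<dots> = qform X Q x"
    unfolding qform_alt by (simp add: mult.commute)
  finally show ?thesis by simp
qed

lemma posdef_inverse:
  assumes "finite X" "symm_on X Q" "inverse_on X K Q" "posdef X K"
  shows "posdef X Q"
  unfolding posdef_def
proof (intro allI impI)
  fix x :: "'a \<Rightarrow> real" assume x: "\<exists>u\<in>X. x u \<noteq> 0"
  have "\<exists>u\<in>X. (\<Sum>t\<in>X. Q u t * x t) \<noteq> 0"
  proof (rule ccontr)
    assume "\<not> ?thesis"
    then have "x u = 0" if "u \<in> X" for u
      using inverse_on_apply[OF assms(1,3) that, of x] by simp
    then show False using x by auto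
  qed
  then obtain u where "u \<in> X" "(\<Sum>t\<in>X. Q u t * x t) \<noteq> 0" by blast
  then show "0 < qform X Q x"
    unfolding qform_inverse[OF assms(1-3)] by (rule posdefD[OF assms(4)])
qed

lemma posdef_diag:
  assumes "finite X" "posdef X Q" "u \<in> X"
  shows "Q u u > 0"
proof -
  let ?w = "\<lambda>v. of_bool (v = u) :: real"
  have "0 < qform X Q ?w" by (rule posdefD[OF assms(2,3)]) simp
  also have "qform X Q ?w = (\<Sum>s\<in>X. (\<Sum>t\<in>X. (Q s t * ?w s) * of_bool (t = u)))"
    unfolding qform_def by simp
  also have "\<dots> = (\<Sum>s\<in>X. Q s u * of_bool (s = u))"
    by (intro sum.cong refl sum_of_bool_right(1)[OF assms(1,3)])
  also have "\<dots> = Q u u" by (rule sum_of_bool_right(1)[OF assms(1,3)])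
  finally show ?thesis .
qed

text \<open>Elimination of the unknown \<open>u\<close>: cutting a row and a column out of
  \<open>K\<close> corresponds to a Schur complement in its inverse. This is the algebra behind
  marginals of Gaussians.\<close>

lemma inverse_on_schur:
  assumes "finite X" "u \<notin> X" "inverse_on (insert u X) Q K" "Q u u \<noteq> 0"
  shows "inverse_on X (\<lambda>s t. Q s t - Q s u * Q u t / Q u u) K"
  unfolding inverse_on_def
proof (intro ballI)
  fix s v assume sv: "s \<in> X" "v \<in> X"
  have 1: "(\<Sum>t\<in>X. Q s t * K t v) = of_bool (s = v) - Q s u * K u v"
    using assms sv unfolding inverse_on_def by (simp add: algebra_simps)
  have "u \<noteq> v" using sv assms by auto
  then have 2: "(\<Sum>t\<in>X. Q u t * K t v) = - Q u u * K u v"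
    using assms sv unfolding inverse_on_def by (auto simp: algebra_simps)
  have "(\<Sum>t\<in>X. (Q s t - Q s u * Q u t / Q u u) * K t v)
     = (\<Sum>t\<in>X. Q s t * K t v) - (Q s u / Q u u) * (\<Sum>t\<in>X. Q u t * K t v)"
    unfolding sum_distrib_left sum_subtractf[symmetric]
    by (intro sum.cong refl) (simp add: algebra_simps)
  also have "\<dots> = of_bool (s = v)" unfolding 1 2 using assms(4) by simp
  finally show "(\<Sum>t\<in>X. (Q s t - Q s u * Q u t / Q u u) * K t v) = of_bool (s = v)" .
qed

text \<open>Bordering: the inverse on \<open>insert u X\<close> is assembled from the one on
  \<open>X\<close>. The only division is by the pivot \<open>d\<close>, which is positive as a value
  of the quadratic form.\<close>

lemma posdef_inverse_exists:
  assumes "finite X" "symm_on X K" "posdef X K"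
  shows "\<exists>Q. symm_on X Q \<and> inverse_on X Q K"
  using assms
proof (induction X rule: finite_induct)
  case empty
  then show ?case by (auto simp: symm_on_def inverse_on_def)
next
  case (insert u X)
  have s: "symm_on X K" "posdef X K"
    using insert.prems insert.hyps posdef_mono[of "insert u X" K X] unfolding symm_on_def by blast+
  then obtain Q where Q: "symm_on X Q" "inverse_on X Q K" using insert.IH by blast
  have QT: "inverse_on X K Q" using inverse_on_transpose[OF Q(1) s(1) Q(2)] .
  \<comment> \<open>Regression coefficients of \<open>u\<close> on \<open>X\<close>:
    \<open>y\<close> solves the linear system with matrix \<open>K\<close> whose right-hand side is
    the column of \<open>u\<close>.\<close>
  define y where "y s = (\<Sum>t\<in>X. Q s t * K t u)" for s
  have yK: "(\<Sum>s\<in>X. K v s * y s) = K v u" if "v \<in> X" for v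
    unfolding y_def using inverse_on_apply[OF insert.hyps(1) QT that, of "\<lambda>t. K t u"] by simp
  have yK': "(\<Sum>s\<in>X. y s * K s v) = K u v" if "v \<in> X" for v
  proof -
    have "(\<Sum>s\<in>X. y s * K s v) = (\<Sum>s\<in>X. K v s * y s)"
      using that by (intro sum.cong refl) (metis s(1) mult.commute symm_onD)
    also have "\<dots> = K u v"
      using yK[OF that] symm_onD[OF insert.prems(1), of v u] that by simp
    finally show ?thesis .
  qed
  define d where "d = K u u - (\<Sum>s\<in>X. y s * K s u)"
  have "d > 0"
  proof -
    \<comment> \<open>At this vector, the residual of the regression, the form takes exactly the
      value \<open>d\<close>.\<close>
    let ?w = "\<lambda>v. if v = u then 1 else - y v"
    have "0 < qform (insert u X) K ?w"
      by (rule posdefD[OF insert.prems(2), of u]) simp_all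
    also have "\<dots> = qform X K y + 2 * (\<Sum>v\<in>X. K u v * (- y v)) + K u u"
      unfolding qform_insert[OF insert.hyps insert.prems(1)]
    proof -
      have "qform X K ?w = qform X K y"
        unfolding qform_def using insert.hyps by (intro sum.cong refl) auto
      moreover have "(\<Sum>v\<in>X. K u v * ?w v) = (\<Sum>v\<in>X. K u v * (- y v))"
        using insert.hyps by (intro sum.cong refl) auto
      ultimately show "qform X K ?w + 2 * ?w u * (\<Sum>v\<in>X. K u v * ?w v) + K u u * (?w u)\<^sup>2
         = qform X K y + 2 * (\<Sum>v\<in>X. K u v * (- y v)) + K u u" by simp
    qed
    also have "qform X K y = (\<Sum>v\<in>X. (\<Sum>s\<in>X. K v s * y s) * y v)"
      by (rule qform_alt)
    also have "\<dots> = (\<Sum>v\<in>X. y v * K v u)" using yK by (intro sum.cong) auto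
    also have "(\<Sum>v\<in>X. K u v * (- y v)) = - (\<Sum>v\<in>X. y v * K v u)"
      unfolding sum_negf[symmetric]
      by (intro sum.cong refl) (simp add: symm_onD[OF insert.prems(1), of _ u])
    finally show ?thesis unfolding d_def by simp
  qed
  define Q' where "Q' s t = (if s = u then (if t = u then 1 / d else - y t / d)
     else if t = u then - y s / d else Q s t + y s * y t / d)" for s t
  have "symm_on (insert u X) Q'" unfolding symm_on_def Q'_def using symm_onD[OF Q(1)] by auto
  moreover have "inverse_on (insert u X) Q' K"
    unfolding inverse_on_def
  proof (intro ballI)
    fix s v assume sv: "s \<in> insert u X" "v \<in> insert u X"
    have e1: "(\<Sum>t\<in>insert u X. Q' u t * K t v) = K u v / d - (\<Sum>t\<in>X. y t * K t v) / d" for v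
    proof -
      have "(\<Sum>t\<in>X. Q' u t * K t v) = (\<Sum>t\<in>X. - (y t * K t v / d))"
        using insert.hyps by (intro sum.cong) (auto simp: Q'_def)
      then show ?thesis using insert.hyps by (simp add: Q'_def sum_negf sum_divide_distrib)
    qed
    have e2: "(\<Sum>t\<in>insert u X. Q' s t * K t v)
       = (\<Sum>t\<in>X. Q s t * K t v) + y s / d * ((\<Sum>t\<in>X. y t * K t v) - K u v)" if "s \<in> X" for v
    proof -
      have "s \<noteq> u" using that insert.hyps by auto
      have "(\<Sum>t\<in>X. Q' s t * K t v) = (\<Sum>t\<in>X. Q s t * K t v + y s / d * (y t * K t v))"
        using insert.hyps \<open>s \<noteq> u\<close> by (intro sum.cong) (auto simp: Q'_def algebra_simps)
      then show ?thesis using insert.hyps \<open>s \<noteq> u\<close>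
        by (simp add: Q'_def sum.distrib sum_distrib_left right_diff_distrib)
    qed
    show "(\<Sum>t\<in>insert u X. Q' s t * K t v) = of_bool (s = v)"
    proof (cases "s = u")
      case True
      show ?thesis
      proof (cases "v = u")
        case True
        then show ?thesis using \<open>s = u\<close> e1[of u] \<open>d > 0\<close>
          by (simp add: d_def diff_divide_distrib [symmetric])
      next
        case False
        then show ?thesis using \<open>s = u\<close> e1[of v] yK'[of v] sv by auto
      qed
    next
      case False
      then have s: "s \<in> X" using sv by auto
      show ?thesis
      proof (cases "v = u")
        case True
        have "y s / d * ((\<Sum>t\<in>X. y t * K t u) - K u u) = - y s"
          using \<open>d > 0\<close> unfolding d_def by (simp add: field_simps)
        then show ?thesis using True e2[OF s, of u] False unfolding y_def by simp
      next
        case nv: False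
        then have v: "v \<in> X" using sv by auto
        then show ?thesis using e2[OF s, of v] yK'[OF v] Q(2) s unfolding inverse_on_def by simp
      qed
    qed
  qed
  ultimately show ?case by blast
qed

section \<open>Gaussian measures\<close>

definition gauss_weight :: "'a set \<Rightarrow> ('a \<Rightarrow> 'a \<Rightarrow> real) \<Rightarrow> ('a \<Rightarrow> real) \<Rightarrow> ennreal" where
  "gauss_weight X Q x = ennreal (exp (- qform X Q x / 2))"

definition gauss_norm :: "'a set \<Rightarrow> ('a \<Rightarrow> 'a \<Rightarrow> real) \<Rightarrow> ennreal" where
  "gauss_norm X Q = (\<integral>\<^sup>+x. gauss_weight X Q x \<partial>Pi\<^sub>M X (\<lambda>_. lborel))"

definition gauss_prec :: "'a set \<Rightarrow> ('a \<Rightarrow> 'a \<Rightarrow> real) \<Rightarrow> ('a \<Rightarrow> real) measure" where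
  "gauss_prec X Q = density (Pi\<^sub>M X (\<lambda>_. lborel)) (\<lambda>x. gauss_weight X Q x / gauss_norm X Q)"

text \<open>The density is explicit in the precision matrix, but only the covariance restricts well
  to subsets. The choice of \<open>Q\<close> is harmless: its entries on \<open>X\<close> are
  determined by \<open>K\<close>, and no others enter \<open>gauss_prec\<close>.\<close>

definition gauss :: "'a set \<Rightarrow> ('a \<Rightarrow> 'a \<Rightarrow> real) \<Rightarrow> ('a \<Rightarrow> real) measure" where
  "gauss X K = gauss_prec X (SOME Q. symm_on X Q \<and> inverse_on X Q K)"

interpretation lborel_product: product_sigma_finite "\<lambda>_. lborel :: real measure"
  by standard

lemma measurable_gauss_weight [measurable]:
  "gauss_weight X Q \<in> borel_measurable (Pi\<^sub>M X (\<lambda>_. lborel))"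
  unfolding gauss_weight_def qform_def by measurable

lemma gauss_prec_cong:
  assumes "\<And>u v. u \<in> X \<Longrightarrow> v \<in> X \<Longrightarrow> Q u v = Q' u v"
  shows "gauss_prec X Q = gauss_prec X Q'"
proof -
  have "qform X Q x = qform X Q' x" for x
    unfolding qform_def using assms by (intro sum.cong) auto
  then have "gauss_weight X Q = gauss_weight X Q'"
    unfolding gauss_weight_def by auto
  then show ?thesis unfolding gauss_prec_def gauss_norm_def by simp
qed

lemma gauss_eq:
  assumes "finite X" "symm_on X K" "symm_on X Q" "inverse_on X Q K"
  shows "gauss X K = gauss_prec X Q"
  unfolding gauss_def
proof (rule someI2[of _ Q])
  show "symm_on X Q \<and> inverse_on X Q K" using assms by blast
  fix Q' assume "symm_on X Q' \<and> inverse_on X Q' K"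
  then show "gauss_prec X Q' = gauss_prec X Q"
    using inverse_on_unique[OF assms(1) _ inverse_on_transpose[OF assms(3,2,4)], of Q']
    by (intro gauss_prec_cong) auto
qed

lemma nn_integral_exp_square:
  assumes "c > 0"
  shows "(\<integral>\<^sup>+t. ennreal (exp (- (c * (t + b)\<^sup>2) / 2)) \<partial>lborel) = ennreal (sqrt (2 * pi / c))"
proof -
  have *: "exp (- (c * (t + b)\<^sup>2) / 2) = sqrt (2 * pi / c) * normal_density (- b) (1 / sqrt c) t" for t
    using assms by (simp add: normal_density_def real_sqrt_divide real_sqrt_mult power_divide field_simps)
  have "(\<integral>\<^sup>+t. ennreal (exp (- (c * (t + b)\<^sup>2) / 2)) \<partial>lborel)
     = ennreal (sqrt (2 * pi / c)) * (\<integral>\<^sup>+t. ennreal (normal_density (- b) (1 / sqrt c) t) \<partial>lborel)"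
    unfolding * using assms by (subst nn_integral_cmult[symmetric]) (auto simp: ennreal_mult)
  also have "(\<integral>\<^sup>+t. ennreal (normal_density (- b) (1 / sqrt c) t) \<partial>lborel) = 1"
    using assms by (subst nn_integral_eq_integral) auto
  finally show ?thesis by simp
qed

section \<open>Marginals as Schur complements\<close>

abbreviation schur :: "'a \<Rightarrow> ('a \<Rightarrow> 'a \<Rightarrow> real) \<Rightarrow> 'a \<Rightarrow> 'a \<Rightarrow> real" where
  "schur u Q \<equiv> (\<lambda>s t. Q s t - Q s u * Q u t / Q u u)"

text \<open>Separating the dependence on coordinate \<open>u\<close> into one square leaves the
  Schur complement, so integrating over \<open>t\<close> contributes a factor that does not depend
  on \<open>x\<close>.\<close>

lemma qform_complete_square:
  assumes "finite X" "u \<notin> X" "symm_on (insert u X) Q" "Q u u \<noteq> 0"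
  shows "qform (insert u X) Q (x(u := t))
     = qform X (schur u Q) x + Q u u * (t + (\<Sum>v\<in>X. Q u v * x v) / Q u u)\<^sup>2"
proof -
  let ?b = "\<Sum>v\<in>X. Q u v * x v"
  have 1: "qform X Q (x(u := t)) = qform X Q x" using assms(2) by (intro qform_cong) auto
  have 2: "(\<Sum>v\<in>X. Q u v * (x(u := t)) v) = ?b" using assms(2) by (intro sum.cong) auto
  have "qform X (schur u Q) x = (\<Sum>s\<in>X. \<Sum>v\<in>X. Q s v * x s * x v - (Q u s * x s) * (Q u v * x v) / Q u u)"
    unfolding qform_def
  proof (intro sum.cong refl)
    fix s v assume "s \<in> X"
    then have "Q s u = Q u s" using symm_onD[OF assms(3), of s u] by simp
    then show "(Q s v - Q s u * Q u v / Q u u) * x s * x v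
        = Q s v * x s * x v - (Q u s * x s) * (Q u v * x v) / Q u u"
      by (simp add: algebra_simps)
  qed
  also have "\<dots> = qform X Q x - ?b\<^sup>2 / Q u u"
    unfolding qform_def sum_subtractf power2_eq_square sum_product sum_divide_distrib ..
  finally have 3: "qform X (schur u Q) x = qform X Q x - ?b\<^sup>2 / Q u u" .
  have 4: "c * (t + b / c)\<^sup>2 = b\<^sup>2 / c + 2 * t * b + c * t\<^sup>2" if "c \<noteq> 0" for b c :: real
    using that by (simp add: power2_eq_square field_simps)
  show ?thesis
    unfolding qform_insert[OF assms(1-3)] 1 2 3 4[OF assms(4)] by simp
qed

text \<open>Fubini for a test function that ignores coordinate \<open>u\<close>. The constant
  function gives the normalization and indicators give the marginal law, both with the same
  factor.\<close>

lemma nn_integral_gauss_weight_insert: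
  assumes "finite X" "u \<notin> X" "symm_on (insert u X) Q" "Q u u > 0"
    and f [measurable]: "f \<in> borel_measurable (Pi\<^sub>M X (\<lambda>_. lborel))"
  shows "(\<integral>\<^sup>+x. gauss_weight (insert u X) Q x * f (restrict x X) \<partial>Pi\<^sub>M (insert u X) (\<lambda>_. lborel))
    = ennreal (sqrt (2 * pi / Q u u)) * (\<integral>\<^sup>+x. gauss_weight X (schur u Q) x * f x \<partial>Pi\<^sub>M X (\<lambda>_. lborel))"
proof -
  have [measurable]: "(\<lambda>x. restrict x X) \<in> Pi\<^sub>M (insert u X) (\<lambda>_. lborel) \<rightarrow>\<^sub>M Pi\<^sub>M X (\<lambda>_. lborel :: real measure)"
    by (rule measurable_restrict_subset) auto
  have "(\<integral>\<^sup>+x. gauss_weight (insert u X) Q x * f (restrict x X) \<partial>Pi\<^sub>M (insert u X) (\<lambda>_. lborel))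
     = (\<integral>\<^sup>+x. (\<integral>\<^sup>+t. gauss_weight (insert u X) Q (x(u := t)) * f (restrict (x(u := t)) X) \<partial>lborel) \<partial>Pi\<^sub>M X (\<lambda>_. lborel))"
    using assms(1,2) by (subst lborel_product.product_nn_integral_insert) auto
  also have "\<dots> = (\<integral>\<^sup>+x. ennreal (sqrt (2 * pi / Q u u)) * (gauss_weight X (schur u Q) x * f x) \<partial>Pi\<^sub>M X (\<lambda>_. lborel))"
  proof (rule nn_integral_cong)
    fix x :: "'a \<Rightarrow> real" assume x: "x \<in> space (Pi\<^sub>M X (\<lambda>_. lborel))"
    have r: "restrict (x(u := t)) X = x" for t
      using x assms(2) by (auto simp: space_PiM PiE_def extensional_def fun_eq_iff restrict_def)
    have w: "gauss_weight (insert u X) Q (x(u := t)) = gauss_weight X (schur u Q) x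
        * ennreal (exp (- (Q u u * (t + (\<Sum>v\<in>X. Q u v * x v) / Q u u)\<^sup>2) / 2))" for t
    proof -
      have e: "exp (- (a + b) / 2) = exp (- a / 2) * exp (- b / 2)" for a b :: real
        by (simp add: exp_add[symmetric] add_divide_distrib[symmetric])
      have "Q u u \<noteq> 0" using assms(4) by simp
      then show ?thesis
        unfolding gauss_weight_def qform_complete_square[OF assms(1-3) \<open>Q u u \<noteq> 0\<close>] e
        by (rule_tac ennreal_mult) simp_all
    qed
    have "(\<integral>\<^sup>+t. gauss_weight (insert u X) Q (x(u := t)) * f (restrict (x(u := t)) X) \<partial>lborel)
       = (\<integral>\<^sup>+t. (gauss_weight X (schur u Q) x * f x) * ennreal (exp (- (Q u u * (t + (\<Sum>v\<in>X. Q u v * x v) / Q u u)\<^sup>2) / 2)) \<partial>lborel)"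
      unfolding r w by (simp add: mult_ac)
    also have "\<dots> = (gauss_weight X (schur u Q) x * f x) * ennreal (sqrt (2 * pi / Q u u))"
      unfolding nn_integral_exp_square[OF assms(4), of "(\<Sum>v\<in>X. Q u v * x v) / Q u u", symmetric] by (rule nn_integral_cmult) measurable
    finally show "(\<integral>\<^sup>+t. gauss_weight (insert u X) Q (x(u := t)) * f (restrict (x(u := t)) X) \<partial>lborel)
       = ennreal (sqrt (2 * pi / Q u u)) * (gauss_weight X (schur u Q) x * f x)"
      by (simp add: mult.commute)
  qed
  also have "\<dots> = ennreal (sqrt (2 * pi / Q u u)) * (\<integral>\<^sup>+x. gauss_weight X (schur u Q) x * f x \<partial>Pi\<^sub>M X (\<lambda>_. lborel))"
    by (rule nn_integral_cmult) measurable
  finally show ?thesis .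
qed

lemma symm_on_schur:
  assumes "symm_on (insert u X) Q"
  shows "symm_on X (schur u Q)"
  unfolding symm_on_def
proof (intro ballI)
  fix s t assume "s \<in> X" "t \<in> X"
  then have "Q s t = Q t s" "Q s u = Q u s" "Q u t = Q t u"
    using symm_onD[OF assms] by blast+
  then show "schur u Q s t = schur u Q t s" by (simp only: mult.commute)
qed

lemma posdef_schur:
  assumes "finite X" "u \<notin> X" "symm_on (insert u X) Q" "posdef (insert u X) Q"
  shows "posdef X (schur u Q)"
  unfolding posdef_def
proof (intro allI impI)
  fix x :: "'a \<Rightarrow> real" assume "\<exists>v\<in>X. x v \<noteq> 0"
  then obtain v where v: "v \<in> X" "x v \<noteq> 0" by blast
  have "Q u u > 0" using posdef_diag[OF _ assms(4), of u] assms(1) by simp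
  \<comment> \<open>This value of coordinate \<open>u\<close> makes the completed square vanish, so
    that only the Schur complement remains.\<close>
  moreover have "0 < qform (insert u X) Q (x(u := - (\<Sum>v\<in>X. Q u v * x v) / Q u u))"
    using v assms(2) by (intro posdefD[OF assms(4), of v]) auto
  ultimately show "0 < qform X (schur u Q) x"
    using qform_complete_square[OF assms(1-3)] by simp
qed

lemma gauss_norm_pos_finite:
  assumes "finite X" "symm_on X Q" "posdef X Q"
  shows "0 < gauss_norm X Q \<and> gauss_norm X Q < top"
  using assms
proof (induction X arbitrary: Q rule: finite_induct)
  case empty
  show ?case
    unfolding gauss_norm_def lborel_product.nn_integral_empty[of "gauss_weight {} Q", OF zero_le]
    by (simp add: gauss_weight_def qform_def)
next
  case (insert u X)
  have c: "Q u u > 0" using posdef_diag[OF _ insert.prems(2), of u] insert.hyps by simp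
  have "gauss_norm (insert u X) Q = ennreal (sqrt (2 * pi / Q u u)) * gauss_norm X (schur u Q)"
    using nn_integral_gauss_weight_insert[OF insert.hyps insert.prems(1) c, of "\<lambda>_. 1"]
    unfolding gauss_norm_def by simp
  moreover have "0 < gauss_norm X (schur u Q) \<and> gauss_norm X (schur u Q) < top"
    using insert.IH symm_on_schur[OF insert.prems(1)] posdef_schur[OF insert.hyps insert.prems] by blast
  ultimately show ?case
    using c by (auto simp: ennreal_zero_less_mult_iff ennreal_mult_less_top)
qed

lemma sets_gauss_prec [simp, measurable_cong]: "sets (gauss_prec X Q) = sets (Pi\<^sub>M X (\<lambda>_. lborel))"
  and space_gauss_prec [simp]: "space (gauss_prec X Q) = space (Pi\<^sub>M X (\<lambda>_. lborel))"
  unfolding gauss_prec_def by simp_all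

lemma sets_gauss [simp, measurable_cong]: "sets (gauss X Q) = sets (Pi\<^sub>M X (\<lambda>_. lborel))"
  and space_gauss [simp]: "space (gauss X Q) = space (Pi\<^sub>M X (\<lambda>_. lborel))"
  unfolding gauss_def by simp_all

lemma prob_space_gauss_prec:
  assumes "finite X" "symm_on X Q" "posdef X Q"
  shows "prob_space (gauss_prec X Q)"
proof
  have "emeasure (gauss_prec X Q) (space (gauss_prec X Q))
     = (\<integral>\<^sup>+x. gauss_weight X Q x / gauss_norm X Q \<partial>Pi\<^sub>M X (\<lambda>_. lborel))"
    unfolding gauss_prec_def by (simp add: emeasure_density cong: nn_integral_cong)
  also have "\<dots> = gauss_norm X Q / gauss_norm X Q"
    unfolding gauss_norm_def by (simp add: nn_integral_divide)
  also have "\<dots> = 1"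
    using gauss_norm_pos_finite[OF assms] by (auto simp: ennreal_divide_self)
  finally show "emeasure (gauss_prec X Q) (space (gauss_prec X Q)) = 1" .
qed

lemma distr_gauss_prec_insert:
  assumes "finite X" "u \<notin> X" "symm_on (insert u X) Q" "posdef (insert u X) Q"
  shows "distr (gauss_prec (insert u X) Q) (Pi\<^sub>M X (\<lambda>_. lborel)) (\<lambda>x. restrict x X)
     = gauss_prec X (schur u Q)"
proof (rule measure_eqI)
  show "sets (distr (gauss_prec (insert u X) Q) (Pi\<^sub>M X (\<lambda>_. lborel)) (\<lambda>x. restrict x X))
     = sets (gauss_prec X (schur u Q))" by simp
  fix A assume "A \<in> sets (distr (gauss_prec (insert u X) Q) (Pi\<^sub>M X (\<lambda>_. lborel)) (\<lambda>x. restrict x X))"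
  then have A [measurable]: "A \<in> sets (Pi\<^sub>M X (\<lambda>_. lborel))" by simp
  have R [measurable]: "(\<lambda>x. restrict x X) \<in> Pi\<^sub>M (insert u X) (\<lambda>_. lborel) \<rightarrow>\<^sub>M Pi\<^sub>M X (\<lambda>_. lborel :: real measure)"
    by (rule measurable_restrict_subset) auto
  have c: "Q u u > 0" using posdef_diag[OF _ assms(4), of u] assms(1) by simp
  \<comment> \<open>The factor from integrating out \<open>u\<close>; it occurs in the numerator and
    in the normalization and cancels.\<close>
  let ?k = "ennreal (sqrt (2 * pi / Q u u))"
  have "sqrt (2 * pi / Q u u) > 0" using c by simp
  then have "?k > 0" by (simp only: ennreal_less_zero_iff)
  then have k: "?k \<noteq> 0" "?k \<noteq> top" by auto
  have ins: "(\<integral>\<^sup>+x. gauss_weight (insert u X) Q x * f (restrict x X) \<partial>Pi\<^sub>M (insert u X) (\<lambda>_. lborel))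
    = ?k * (\<integral>\<^sup>+x. gauss_weight X (schur u Q) x * f x \<partial>Pi\<^sub>M X (\<lambda>_. lborel))"
    if "f \<in> borel_measurable (Pi\<^sub>M X (\<lambda>_. lborel))" for f
    by (rule nn_integral_gauss_weight_insert[OF assms(1-3) c that])
  have n: "gauss_norm (insert u X) Q = ?k * gauss_norm X (schur u Q)"
    using ins[of "\<lambda>_. 1"] unfolding gauss_norm_def by simp
  have "emeasure (distr (gauss_prec (insert u X) Q) (Pi\<^sub>M X (\<lambda>_. lborel)) (\<lambda>x. restrict x X)) A
     = emeasure (gauss_prec (insert u X) Q) ((\<lambda>x. restrict x X) -` A \<inter> space (Pi\<^sub>M (insert u X) (\<lambda>_. lborel)))"
    by (subst emeasure_distr) auto
  also have "\<dots> = (\<integral>\<^sup>+x. gauss_weight (insert u X) Q x / gauss_norm (insert u X) Q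
        * indicator ((\<lambda>x. restrict x X) -` A \<inter> space (Pi\<^sub>M (insert u X) (\<lambda>_. lborel))) x \<partial>Pi\<^sub>M (insert u X) (\<lambda>_. lborel))"
    unfolding gauss_prec_def by (rule emeasure_density) measurable
  also have "\<dots> = (\<integral>\<^sup>+x. (gauss_weight (insert u X) Q x * indicator A (restrict x X)) / gauss_norm (insert u X) Q \<partial>Pi\<^sub>M (insert u X) (\<lambda>_. lborel))"
    by (intro nn_integral_cong) (auto split: split_indicator)
  also have "\<dots> = (?k * (\<integral>\<^sup>+x. gauss_weight X (schur u Q) x * indicator A x \<partial>Pi\<^sub>M X (\<lambda>_. lborel))) / (?k * gauss_norm X (schur u Q))"
    unfolding n by (subst nn_integral_divide) (auto simp: ins)
  also have "\<dots> = (\<integral>\<^sup>+x. gauss_weight X (schur u Q) x * indicator A x \<partial>Pi\<^sub>M X (\<lambda>_. lborel)) / gauss_norm X (schur u Q)"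
    unfolding mult.commute[of ?k] using k by (intro divide_mult_eq) simp_all
  also have "\<dots> = (\<integral>\<^sup>+x. gauss_weight X (schur u Q) x / gauss_norm X (schur u Q) * indicator A x \<partial>Pi\<^sub>M X (\<lambda>_. lborel))"
    by (subst nn_integral_divide[symmetric]) (auto intro!: nn_integral_cong split: split_indicator)
  also have "\<dots> = emeasure (gauss_prec X (schur u Q)) A"
    unfolding gauss_prec_def by (rule emeasure_density[symmetric]) measurable
  finally show "emeasure (distr (gauss_prec (insert u X) Q) (Pi\<^sub>M X (\<lambda>_. lborel)) (\<lambda>x. restrict x X)) A
     = emeasure (gauss_prec X (schur u Q)) A" .
qed

lemma gauss_precE:
  assumes "finite X" "symm_on X K" "posdef X K"
  obtains Q where "symm_on X Q" "inverse_on X Q K" "posdef X Q" "gauss X K = gauss_prec X Q"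
proof -
  obtain Q where Q: "symm_on X Q" "inverse_on X Q K" using posdef_inverse_exists[OF assms] by blast
  then have "posdef X Q"
    using posdef_inverse[OF assms(1) Q(1) inverse_on_transpose[OF Q(1) assms(2) Q(2)] assms(3)] by blast
  then show ?thesis using that Q gauss_eq[OF assms(1,2) Q] by blast
qed

lemma prob_space_gauss:
  assumes "finite X" "symm_on X K" "posdef X K"
  shows "prob_space (gauss X K)"
  using gauss_precE[OF assms] prob_space_gauss_prec[OF assms(1)] by metis

lemma symm_on_mono: "symm_on Y K \<Longrightarrow> X \<subseteq> Y \<Longrightarrow> symm_on X K"
  unfolding symm_on_def by blast

text \<open>The coordinates of \<open>Y - X\<close> are integrated out one by one. Each removal
  replaces the precision by a Schur complement, which is again inverse to the restricted
  covariance.\<close>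

lemma distr_gauss_restrict:
  assumes "finite Y" "X \<subseteq> Y" "symm_on Y K" "posdef Y K"
  shows "distr (gauss Y K) (Pi\<^sub>M X (\<lambda>_. lborel)) (\<lambda>x. restrict x X) = gauss X K"
proof -
  have fX: "finite X" using assms finite_subset by blast
  have "symm_on (X \<union> Z) K \<and> posdef (X \<union> Z) K \<longrightarrow>
      distr (gauss (X \<union> Z) K) (Pi\<^sub>M X (\<lambda>_. lborel)) (\<lambda>x. restrict x X) = gauss X K"
    if "finite Z" "Z \<inter> X = {}" for Z
    using that
  proof (induction Z rule: finite_induct)
    case empty
    have "distr (gauss X K) (Pi\<^sub>M X (\<lambda>_. lborel)) (\<lambda>x. restrict x X) = distr (gauss X K) (gauss X K) (\<lambda>x. x)"
      by (rule distr_cong) (auto simp: space_PiM PiE_def extensional_restrict)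
    also have "\<dots> = gauss X K" by (rule distr_id)
    finally show ?case unfolding Un_empty_right by blast
  next
    case (insert u Z)
    show ?case
    proof
      assume a: "symm_on (X \<union> insert u Z) K \<and> posdef (X \<union> insert u Z) K"
      let ?W = "X \<union> Z"
      have e: "X \<union> insert u Z = insert u ?W" by auto
      have fW: "finite ?W" and uW: "u \<notin> ?W" using fX insert by auto
      have sK: "symm_on (insert u ?W) K" and pK: "posdef (insert u ?W) K" using a e by auto
      have sW: "symm_on ?W K" using sK symm_on_mono by blast
      have pW: "posdef ?W K" using posdef_mono[OF pK, of ?W] fW by auto
      obtain Q where Q: "symm_on (insert u ?W) Q" "inverse_on (insert u ?W) Q K" "posdef (insert u ?W) Q"
        "gauss (insert u ?W) K = gauss_prec (insert u ?W) Q"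
        using gauss_precE[OF _ sK pK] fW by auto
      have c: "Q u u > 0" using posdef_diag[OF _ Q(3), of u] fW by simp
      have g: "gauss ?W K = gauss_prec ?W (schur u Q)"
        using c by (intro gauss_eq[OF fW sW] symm_on_schur[OF Q(1)] inverse_on_schur[OF fW uW Q(2)]) auto
      have R1: "(\<lambda>x. restrict x ?W) \<in> Pi\<^sub>M (insert u ?W) (\<lambda>_. lborel) \<rightarrow>\<^sub>M Pi\<^sub>M ?W (\<lambda>_. lborel :: real measure)"
        by (rule measurable_restrict_subset) auto
      have R2: "(\<lambda>x. restrict x X) \<in> Pi\<^sub>M ?W (\<lambda>_. lborel) \<rightarrow>\<^sub>M Pi\<^sub>M X (\<lambda>_. lborel :: real measure)"
        by (rule measurable_restrict_subset) auto
      have "gauss X K = distr (gauss ?W K) (Pi\<^sub>M X (\<lambda>_. lborel)) (\<lambda>x. restrict x X)"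
        using insert.IH insert.prems sW pW by (metis Int_insert_left_if0 Int_insert_left_if1 insert_not_empty)
      also have "gauss ?W K = distr (gauss (insert u ?W) K) (Pi\<^sub>M ?W (\<lambda>_. lborel)) (\<lambda>x. restrict x ?W)"
        unfolding g Q(4) by (rule distr_gauss_prec_insert[OF fW uW Q(1,3), symmetric])
      also have "distr \<dots> (Pi\<^sub>M X (\<lambda>_. lborel)) (\<lambda>x. restrict x X)
         = distr (gauss (insert u ?W) K) (Pi\<^sub>M X (\<lambda>_. lborel)) ((\<lambda>x. restrict x X) \<circ> (\<lambda>x. restrict x ?W))"
        using R1 R2 by (intro distr_distr) (simp_all cong: measurable_cong_sets)
      also have "(\<lambda>x. restrict x X) \<circ> (\<lambda>x. restrict x ?W) = (\<lambda>x::'a \<Rightarrow> real. restrict x X)"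
        by (auto simp: fun_eq_iff restrict_def)
      finally show "distr (gauss (X \<union> insert u Z) K) (Pi\<^sub>M X (\<lambda>_. lborel)) (\<lambda>x. restrict x X) = gauss X K"
        unfolding e by (rule sym)
    qed
  qed
  moreover have "X \<union> (Y - X) = Y" using assms(2) by auto
  ultimately show ?thesis using assms by (metis Diff_disjoint finite_Diff inf_commute)
qed

section \<open>Estimates for two coordinates\<close>

lemma normal_second_moment:
  assumes "\<sigma> > 0"
  shows "(\<integral>\<^sup>+x. ennreal (normal_density m \<sigma> x) * ennreal ((x - c)\<^sup>2) \<partial>lborel) = ennreal (\<sigma>\<^sup>2 + (m - c)\<^sup>2)"
proof -
  have 0: "has_bochner_integral lborel (\<lambda>x. normal_density m \<sigma> x * (x - m) ^ 0) 1"
    using normal_moment_even[OF assms, of m 0] by simp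
  have 1: "has_bochner_integral lborel (\<lambda>x. normal_density m \<sigma> x * (x - m) ^ 1) 0"
    using normal_moment_odd[OF assms, of m 0] by simp
  have 2: "has_bochner_integral lborel (\<lambda>x. normal_density m \<sigma> x * (x - m) ^ 2) (\<sigma>\<^sup>2)"
    using normal_moment_even[OF assms, of m 1] assms by (simp add: numeral_2_eq_2)
  have "has_bochner_integral lborel (\<lambda>x. normal_density m \<sigma> x * (x - m) ^ 2
      + (2 * (m - c)) * (normal_density m \<sigma> x * (x - m) ^ 1) + (m - c)\<^sup>2 * (normal_density m \<sigma> x * (x - m) ^ 0))
      (\<sigma>\<^sup>2 + (2 * (m - c)) * 0 + (m - c)\<^sup>2 * 1)"
    by (intro has_bochner_integral_add has_bochner_integral_mult_right 0 1 2)
  also have "(\<lambda>x. normal_density m \<sigma> x * (x - m) ^ 2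
      + (2 * (m - c)) * (normal_density m \<sigma> x * (x - m) ^ 1) + (m - c)\<^sup>2 * (normal_density m \<sigma> x * (x - m) ^ 0))
     = (\<lambda>x. normal_density m \<sigma> x * (x - c)\<^sup>2)"
    by (auto simp: fun_eq_iff power2_eq_square algebra_simps)
  finally have *: "has_bochner_integral lborel (\<lambda>x. normal_density m \<sigma> x * (x - c)\<^sup>2) (\<sigma>\<^sup>2 + (m - c)\<^sup>2)" by simp
  have "(\<integral>\<^sup>+x. ennreal (normal_density m \<sigma> x) * ennreal ((x - c)\<^sup>2) \<partial>lborel)
      = (\<integral>\<^sup>+x. ennreal (normal_density m \<sigma> x * (x - c)\<^sup>2) \<partial>lborel)"
    by (simp add: ennreal_mult)
  also have "\<dots> = ennreal (\<sigma>\<^sup>2 + (m - c)\<^sup>2)"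
    using * by (subst nn_integral_eq_integral) (auto simp: has_bochner_integral_iff)
  finally show ?thesis .
qed

lemma nn_integral_normal_density:
  assumes "\<sigma> > 0"
  shows "(\<integral>\<^sup>+x. ennreal (normal_density m \<sigma> x) \<partial>lborel) = 1"
  using assms by (subst nn_integral_eq_integral) auto

lemma normal_density_le:
  "normal_density m 1 x \<le> 1 / 2"
proof -
  have "sqrt (2 * pi) \<ge> sqrt 4" using pi_gt3 by (intro real_sqrt_le_mono) simp
  then have "1 / sqrt (2 * pi) \<le> 1 / 2" by (simp add: divide_simps)
  moreover have "exp (- (x - m)\<^sup>2 / 2) \<le> 1" by simp
  ultimately have "1 / sqrt (2 * pi) * exp (- (x - m)\<^sup>2 / 2) \<le> 1 / 2 * 1"
    by (intro mult_mono) auto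
  then show ?thesis by (simp add: normal_density_def)
qed

text \<open>The bivariate density factors: coordinate \<open>b\<close> is standard normal, and given
  its value \<open>t\<close>, coordinate \<open>a\<close> is normal with mean
  \<open>\<kappa> * t\<close> and variance \<open>1 - \<kappa>\<^sup>2\<close>.\<close>

lemma gauss_pair:
  fixes K :: "'a \<Rightarrow> 'a \<Rightarrow> real"
  assumes ab: "a \<noteq> b" and K: "K a a = 1" "K b b = 1" "K a b = \<kappa>" "K b a = \<kappa>" and \<kappa>: "\<kappa>\<^sup>2 < 1"
    and [measurable]: "case_prod g \<in> borel_measurable (borel \<Otimes>\<^sub>M borel)"
  shows "(\<integral>\<^sup>+x. g (x a) (x b) \<partial>gauss {a, b} K)
    = (\<integral>\<^sup>+t. ennreal (normal_density 0 1 t) * (\<integral>\<^sup>+s. ennreal (normal_density (\<kappa> * t) (sqrt (1 - \<kappa>\<^sup>2)) s) * g s t \<partial>lborel) \<partial>lborel)"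
proof -
  define \<sigma> where "\<sigma> = sqrt (1 - \<kappa>\<^sup>2)"
  have \<sigma>: "\<sigma> > 0" "\<sigma>\<^sup>2 = 1 - \<kappa>\<^sup>2" using \<kappa> by (auto simp: \<sigma>_def)
  define Q :: "'a \<Rightarrow> 'a \<Rightarrow> real" where "Q s t = (if s = t then 1 else - \<kappa>) / (1 - \<kappa>\<^sup>2)" for s t
  have nz: "1 - \<kappa> * \<kappa> \<noteq> 0" using \<kappa> by (simp add: power2_eq_square)
  have sQ: "symm_on {a, b} Q" by (simp add: symm_on_def Q_def)
  have sK: "symm_on {a, b} K" using K by (simp add: symm_on_def)
  have iQ: "inverse_on {a, b} Q K"
    using ab K nz by (auto simp: inverse_on_def Q_def power2_eq_square divide_simps)
  have g: "gauss {a, b} K = gauss_prec {a, b} Q" using gauss_eq[OF _ sK sQ iQ] by simp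
  have qf: "qform {a, b} Q x = (x b)\<^sup>2 + (x a - \<kappa> * x b)\<^sup>2 / \<sigma>\<^sup>2" for x
    using ab nz unfolding \<sigma>(2) by (simp add: qform_def Q_def power2_eq_square divide_simps) (simp add: algebra_simps)
  define c where "c = 2 * pi * \<sigma>"
  have c: "c > 0" using \<sigma> by (simp add: c_def)
  have w: "gauss_weight {a, b} Q x
      = ennreal c * (ennreal (normal_density 0 1 (x b)) * ennreal (normal_density (\<kappa> * x b) \<sigma> (x a)))" for x
  proof -
    have "sqrt (2 * pi * \<sigma>\<^sup>2) = sqrt (2 * pi) * \<sigma>"
      using \<sigma>(1) by (simp add: real_sqrt_mult)
    then have sq: "sqrt (2 * pi) * sqrt (2 * pi * \<sigma>\<^sup>2) = c"
      unfolding c_def by (simp flip: mult.assoc)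
    have "normal_density 0 1 (x b) * normal_density (\<kappa> * x b) \<sigma> (x a)
       = 1 / (sqrt (2 * pi) * sqrt (2 * pi * \<sigma>\<^sup>2)) * (exp (- (x b)\<^sup>2 / 2) * exp (- (x a - \<kappa> * x b)\<^sup>2 / (2 * \<sigma>\<^sup>2)))"
      unfolding normal_density_def by simp
    also have "\<dots> = 1 / c * exp (- qform {a, b} Q x / 2)"
      unfolding sq qf exp_add[symmetric] by (simp add: field_simps)
    finally have "exp (- qform {a, b} Q x / 2) = c * (normal_density 0 1 (x b) * normal_density (\<kappa> * x b) \<sigma> (x a))"
      using c by simp
    then show ?thesis unfolding gauss_weight_def using c by (simp add: ennreal_mult)
  qed
  have main: "(\<integral>\<^sup>+x. gauss_weight {a, b} Q x * h (x a) (x b) \<partial>Pi\<^sub>M {a, b} (\<lambda>_. lborel))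
     = ennreal c * (\<integral>\<^sup>+t. ennreal (normal_density 0 1 t) * (\<integral>\<^sup>+s. ennreal (normal_density (\<kappa> * t) \<sigma> s) * h s t \<partial>lborel) \<partial>lborel)"
    if [measurable]: "case_prod h \<in> borel_measurable (borel \<Otimes>\<^sub>M borel)" for h
  proof -
    let ?f = "\<lambda>s t. ennreal c * (ennreal (normal_density 0 1 t) * (ennreal (normal_density (\<kappa> * t) \<sigma> s) * h s t))"
    have [measurable]: "case_prod ?f \<in> borel_measurable (borel \<Otimes>\<^sub>M borel)"
      unfolding normal_density_def by measurable
    have "(\<integral>\<^sup>+x. gauss_weight {a, b} Q x * h (x a) (x b) \<partial>Pi\<^sub>M {a, b} (\<lambda>_. lborel))
       = (\<integral>\<^sup>+x. case_prod ?f (x a, x b) \<partial>Pi\<^sub>M {a, b} (\<lambda>_. lborel))"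
      unfolding w by (simp add: mult_ac)
    also have "\<dots> = (\<integral>\<^sup>+x. (\<integral>\<^sup>+s. case_prod ?f ((x(a := s)) a, (x(a := s)) b) \<partial>lborel) \<partial>Pi\<^sub>M {b} (\<lambda>_. lborel))"
      using ab by (intro lborel_product.product_nn_integral_insert) (auto simp del: split_beta)
    also have "\<dots> = (\<integral>\<^sup>+x. (\<integral>\<^sup>+s. ?f s (x b) \<partial>lborel) \<partial>Pi\<^sub>M {b} (\<lambda>_. lborel))"
      using ab by simp
    also have "\<dots> = (\<integral>\<^sup>+t. (\<integral>\<^sup>+s. ?f s t \<partial>lborel) \<partial>lborel)"
      by (rule lborel_product.product_nn_integral_singleton[of "\<lambda>t. \<integral>\<^sup>+s. ?f s t \<partial>lborel"]) measurable
    also have "\<dots> = (\<integral>\<^sup>+t. ennreal c * (ennreal (normal_density 0 1 t) * (\<integral>\<^sup>+s. ennreal (normal_density (\<kappa> * t) \<sigma> s) * h s t \<partial>lborel)) \<partial>lborel)"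
      by (simp add: nn_integral_cmult normal_density_def)
    also have "\<dots> = ennreal c * (\<integral>\<^sup>+t. ennreal (normal_density 0 1 t) * (\<integral>\<^sup>+s. ennreal (normal_density (\<kappa> * t) \<sigma> s) * h s t \<partial>lborel) \<partial>lborel)"
      unfolding normal_density_def by (rule nn_integral_cmult) measurable
    finally show ?thesis .
  qed
  have n: "gauss_norm {a, b} Q = ennreal c"
    using main[of "\<lambda>_ _. 1"] \<sigma>(1) by (simp add: gauss_norm_def nn_integral_normal_density)
  have [measurable]: "(\<lambda>x. g (x a) (x b)) \<in> borel_measurable (Pi\<^sub>M {a, b} (\<lambda>_. lborel))"
  proof -
    have "(\<lambda>x. case_prod g (x a, x b)) \<in> borel_measurable (Pi\<^sub>M {a, b} (\<lambda>_. lborel))"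
      by measurable
    then show ?thesis by simp
  qed
  have "(\<integral>\<^sup>+x. g (x a) (x b) \<partial>gauss {a, b} K)
     = (\<integral>\<^sup>+x. gauss_weight {a, b} Q x * g (x a) (x b) / ennreal c \<partial>Pi\<^sub>M {a, b} (\<lambda>_. lborel))"
    unfolding g gauss_prec_def n
    by (subst nn_integral_density) (auto intro!: nn_integral_cong simp: divide_ennreal_def mult_ac)
  also have "\<dots> = (ennreal c * (\<integral>\<^sup>+t. ennreal (normal_density 0 1 t) * (\<integral>\<^sup>+s. ennreal (normal_density (\<kappa> * t) \<sigma> s) * g s t \<partial>lborel) \<partial>lborel)) / ennreal c"
    by (subst nn_integral_divide) (auto simp: main)
  also have "\<dots> = (\<integral>\<^sup>+t. ennreal (normal_density 0 1 t) * (\<integral>\<^sup>+s. ennreal (normal_density (\<kappa> * t) \<sigma> s) * g s t \<partial>lborel) \<partial>lborel)"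
    using c unfolding mult.commute[of "ennreal c"] by (intro ennreal_mult_divide_eq) auto
  finally show ?thesis unfolding \<sigma>_def .
qed

text \<open>Given coordinate \<open>b\<close>, coordinate \<open>a\<close> has a density of at most
  1/2 and must hit an interval of length \<open>2 * s\<close>. It shows that the largest coordinate
  of a variable is rarely a close call.\<close>

lemma gauss_pair_small_ball:
  assumes ab: "a \<noteq> b" and K: "K a a = 1" "K b b = 1" "K a b = 0" "K b a = 0" and s: "s \<ge> 0"
  shows "emeasure (gauss {a, b} K) {x \<in> space (gauss {a, b} K). \<bar>x a - x b\<bar> \<le> s} \<le> ennreal s"
proof -
  let ?g = "\<lambda>x y. indicator {p. \<bar>fst p - snd p\<bar> \<le> s} (x, y) :: ennreal"
  have m: "case_prod ?g \<in> borel_measurable (borel \<Otimes>\<^sub>M borel)" by measurable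
  have "emeasure (gauss {a, b} K) {x \<in> space (gauss {a, b} K). \<bar>x a - x b\<bar> \<le> s}
      = (\<integral>\<^sup>+x. indicator {x \<in> space (gauss {a, b} K). \<bar>x a - x b\<bar> \<le> s} x \<partial>gauss {a, b} K)"
    by (rule nn_integral_indicator[symmetric]) measurable
  also have "\<dots> = (\<integral>\<^sup>+x. ?g (x a) (x b) \<partial>gauss {a, b} K)"
    by (intro nn_integral_cong) (auto split: split_indicator)
  also have "\<dots> = (\<integral>\<^sup>+t. ennreal (normal_density 0 1 t) * (\<integral>\<^sup>+x. ennreal (normal_density (0 * t) (sqrt (1 - 0\<^sup>2)) x) * ?g x t \<partial>lborel) \<partial>lborel)"
    by (rule gauss_pair[OF ab K _ m]) simp
  also have "\<dots> \<le> (\<integral>\<^sup>+t. ennreal (normal_density 0 1 t) * ennreal s \<partial>lborel)"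
  proof (intro nn_integral_mono mult_left_mono)
    fix t :: real
    have "(\<integral>\<^sup>+x. ennreal (normal_density (0 * t) (sqrt (1 - 0\<^sup>2)) x) * ?g x t \<partial>lborel)
       \<le> (\<integral>\<^sup>+x. ennreal (1 / 2) * indicator {t - s..t + s} x \<partial>lborel)"
    proof (intro nn_integral_mono)
      fix x :: real
      have "ennreal (normal_density (0 * t) (sqrt (1 - 0\<^sup>2)) x) \<le> ennreal (1 / 2)"
        using normal_density_le[of 0 x] by (intro ennreal_leI) simp
      then show "ennreal (normal_density (0 * t) (sqrt (1 - 0\<^sup>2)) x) * ?g x t
          \<le> ennreal (1 / 2) * indicator {t - s..t + s} x"
        by (auto split: split_indicator simp: abs_le_iff)
    qed
    also have "\<dots> = ennreal (1 / 2) * ennreal (2 * s)"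
      using s by (simp only: nn_integral_cmult_indicator sets_lborel sets.top atLeastAtMost_borel)
        simp
    also have "\<dots> = ennreal (1 / 2 * (2 * s))" using s by (intro ennreal_mult[symmetric]) auto
    also have "\<dots> = ennreal s" by simp
    finally show "(\<integral>\<^sup>+x. ennreal (normal_density (0 * t) (sqrt (1 - 0\<^sup>2)) x) * ?g x t \<partial>lborel) \<le> ennreal s" .
  qed simp
  also have "\<dots> = ennreal s"
    by (subst nn_integral_multc) (auto simp: nn_integral_normal_density)
  finally show ?thesis .
qed

text \<open>Chebyshev: the second moment of the difference is \<open>(1 - \<kappa>\<^sup>2) + (1 -
  \<kappa>)\<^sup>2 = 2 - 2 * \<kappa>\<close>.\<close>

lemma gauss_pair_large_deviation:
  assumes ab: "a \<noteq> b" and K: "K a a = 1" "K b b = 1" "K a b = \<kappa>" "K b a = \<kappa>" and \<kappa>: "\<kappa>\<^sup>2 < 1" and s: "s > 0"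
  shows "emeasure (gauss {a, b} K) {x \<in> space (gauss {a, b} K). s \<le> \<bar>x a - x b\<bar>} \<le> ennreal ((2 - 2 * \<kappa>) / s\<^sup>2)"
proof -
  let ?g = "\<lambda>x y. ennreal ((x - y)\<^sup>2) * ennreal (1 / s\<^sup>2)"
  have m: "case_prod ?g \<in> borel_measurable (borel \<Otimes>\<^sub>M borel)" by measurable
  have k1: "\<kappa> < 1" using \<kappa> by (metis abs_square_less_1 abs_less_iff)
  have "emeasure (gauss {a, b} K) {x \<in> space (gauss {a, b} K). s \<le> \<bar>x a - x b\<bar>}
      = (\<integral>\<^sup>+x. indicator {x \<in> space (gauss {a, b} K). s \<le> \<bar>x a - x b\<bar>} x \<partial>gauss {a, b} K)"
    by (rule nn_integral_indicator[symmetric]) measurable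
  also have "\<dots> \<le> (\<integral>\<^sup>+x. ?g (x a) (x b) \<partial>gauss {a, b} K)"
  proof (intro nn_integral_mono)
    fix x
    have "1 \<le> (x a - x b)\<^sup>2 * (1 / s\<^sup>2)" if "s \<le> \<bar>x a - x b\<bar>"
      using that s power_mono[OF that, of 2] by (simp add: field_simps)
    then show "indicator {x \<in> space (gauss {a, b} K). s \<le> \<bar>x a - x b\<bar>} x \<le> ?g (x a) (x b)"
      by (auto split: split_indicator simp flip: ennreal_mult)
  qed
  also have "\<dots> = (\<integral>\<^sup>+t. ennreal (normal_density 0 1 t) * (\<integral>\<^sup>+x. ennreal (normal_density (\<kappa> * t) (sqrt (1 - \<kappa>\<^sup>2)) x) * ?g x t \<partial>lborel) \<partial>lborel)"
    by (rule gauss_pair[OF ab K \<kappa> m])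
  also have "\<dots> = (\<integral>\<^sup>+t. ennreal (1 / s\<^sup>2) * (ennreal (1 - \<kappa>\<^sup>2) * ennreal (normal_density 0 1 t)
      + ennreal ((1 - \<kappa>)\<^sup>2) * (ennreal (normal_density 0 1 t) * ennreal ((t - 0)\<^sup>2))) \<partial>lborel)"
  proof (rule nn_integral_cong)
    fix t :: real
    have "(\<integral>\<^sup>+x. ennreal (normal_density (\<kappa> * t) (sqrt (1 - \<kappa>\<^sup>2)) x) * ?g x t \<partial>lborel)
       = (\<integral>\<^sup>+x. ennreal (1 / s\<^sup>2) * (ennreal (normal_density (\<kappa> * t) (sqrt (1 - \<kappa>\<^sup>2)) x) * ennreal ((x - t)\<^sup>2)) \<partial>lborel)"
      by (simp add: mult_ac)
    also have "\<dots> = ennreal (1 / s\<^sup>2) * ennreal ((sqrt (1 - \<kappa>\<^sup>2))\<^sup>2 + (\<kappa> * t - t)\<^sup>2)"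
      using \<kappa> by (subst nn_integral_cmult) (auto simp: normal_second_moment)
    also have "(sqrt (1 - \<kappa>\<^sup>2))\<^sup>2 + (\<kappa> * t - t)\<^sup>2 = (1 - \<kappa>\<^sup>2) + (1 - \<kappa>)\<^sup>2 * t\<^sup>2"
      using \<kappa> by (simp add: power2_eq_square algebra_simps)
    also have "ennreal \<dots> = ennreal (1 - \<kappa>\<^sup>2) + ennreal ((1 - \<kappa>)\<^sup>2) * ennreal (t\<^sup>2)"
      using \<kappa> by (simp add: ennreal_plus ennreal_mult)
    finally show "ennreal (normal_density 0 1 t) * (\<integral>\<^sup>+x. ennreal (normal_density (\<kappa> * t) (sqrt (1 - \<kappa>\<^sup>2)) x) * ?g x t \<partial>lborel)
      = ennreal (1 / s\<^sup>2) * (ennreal (1 - \<kappa>\<^sup>2) * ennreal (normal_density 0 1 t)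
      + ennreal ((1 - \<kappa>)\<^sup>2) * (ennreal (normal_density 0 1 t) * ennreal ((t - 0)\<^sup>2)))"
      by (simp only: distrib_left mult_ac diff_zero)
  qed
  also have "\<dots> = ennreal (1 / s\<^sup>2) * (ennreal (1 - \<kappa>\<^sup>2) * 1 + ennreal ((1 - \<kappa>)\<^sup>2) * ennreal (1\<^sup>2 + (0 - 0)\<^sup>2))"
    unfolding normal_second_moment[OF zero_less_one, symmetric] nn_integral_normal_density[OF zero_less_one, of 0, symmetric]
    by (simp add: nn_integral_cmult nn_integral_add)
  also have "\<dots> = ennreal ((2 - 2 * \<kappa>) / s\<^sup>2)"
    using \<kappa> by (simp flip: ennreal_mult ennreal_plus) (simp add: power2_eq_square algebra_simps)
  finally show ?thesis .
qed

section \<open>Rounding Gaussian labels\<close>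

lemma symm_on_UNIV: "(\<And>a b. K a b = K b a) \<Longrightarrow> symm_on X K"
  unfolding symm_on_def by blast

lemma measure_gauss_pair:
  assumes Y: "finite Y" "symm_on Y K" "posdef Y K" "{a, b} \<subseteq> Y"
    and m: "{x \<in> space (gauss {a, b} K). P (x a) (x b)} \<in> sets (gauss {a, b} K)"
  shows "{x \<in> space (gauss Y K). P (x a) (x b)} \<in> sets (gauss Y K)"
    and "measure (gauss Y K) {x \<in> space (gauss Y K). P (x a) (x b)}
      = measure (gauss {a, b} K) {x \<in> space (gauss {a, b} K). P (x a) (x b)}"
proof -
  have R: "(\<lambda>x. restrict x {a, b}) \<in> gauss Y K \<rightarrow>\<^sub>M Pi\<^sub>M {a, b} (\<lambda>_. lborel :: real measure)"
    using measurable_restrict_subset[OF Y(4), of "\<lambda>_. lborel :: real measure"]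
    by (simp cong: measurable_cong_sets)
  have e: "{x \<in> space (gauss Y K). P (x a) (x b)}
     = (\<lambda>x. restrict x {a, b}) -` {x \<in> space (gauss {a, b} K). P (x a) (x b)} \<inter> space (gauss Y K)"
    using measurable_space[OF R] by auto
  show "{x \<in> space (gauss Y K). P (x a) (x b)} \<in> sets (gauss Y K)"
    unfolding e by (rule measurable_sets[OF R]) (use m in \<open>simp only: sets_gauss\<close>)
  show "measure (gauss Y K) {x \<in> space (gauss Y K). P (x a) (x b)}
      = measure (gauss {a, b} K) {x \<in> space (gauss {a, b} K). P (x a) (x b)}"
  proof -
    have "measure (gauss {a, b} K) {x \<in> space (gauss {a, b} K). P (x a) (x b)}
       = measure (distr (gauss Y K) (Pi\<^sub>M {a, b} (\<lambda>_. lborel)) (\<lambda>x. restrict x {a, b}))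
           {x \<in> space (gauss {a, b} K). P (x a) (x b)}"
      by (simp only: distr_gauss_restrict[OF Y(1,4,2,3)])
    also have "\<dots> = measure (gauss Y K) {x \<in> space (gauss Y K). P (x a) (x b)}"
      unfolding e by (rule measure_distr[OF R]) (use m in \<open>simp only: sets_gauss\<close>)
    finally show ?thesis by (rule sym)
  qed
qed

section \<open>Discrete labels from Gaussian coordinates\<close>

lemma measure_pmf_Abs_distr:
  assumes "prob_space M" and f: "f \<in> M \<rightarrow>\<^sub>M count_space UNIV" and fin: "finite (f ` space M)"
  shows "measure_pmf (Abs_pmf (distr M (count_space UNIV) f)) = distr M (count_space UNIV) f"
proof (rule Abs_pmf_inverse, safe)
  interpret prob_space M by fact
  let ?D = "distr M (count_space UNIV) f"
  interpret D: prob_space ?D by (rule prob_space_distr[OF f])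
  show "prob_space ?D" by (rule D.prob_space_axioms)
  \<comment> \<open>Since the range is finite, the values of probability zero can be discarded one
    at a time.\<close>
  have "AE x in ?D. \<forall>y\<in>f ` space M. x = y \<longrightarrow> measure ?D {y} \<noteq> 0"
  proof (rule AE_finite_allI[OF fin])
    fix y
    show "AE x in ?D. x = y \<longrightarrow> measure ?D {y} \<noteq> 0"
    proof (cases "measure ?D {y} = 0")
      case True
      then have "{y} \<in> null_sets ?D" by (auto simp: null_sets_def D.emeasure_eq_measure)
      from AE_not_in[OF this] show ?thesis by eventually_elim simp
    qed simp
  qed
  moreover have "AE x in ?D. x \<in> f ` space M"
    using f by (subst AE_distr_iff) auto
  ultimately show "AE x in ?D. measure ?D {x} \<noteq> 0"
    by eventually_elim auto
qed auto

text \<open>\<open>LEAST\<close> breaks ties, so the label is defined for every \<open>x\<close>.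
  The estimates use only that the winning coordinate is maximal, and ties need no separate
  argument.\<close>

definition winner :: "nat \<Rightarrow> (nat \<times> nat \<Rightarrow> real) \<Rightarrow> nat \<Rightarrow> nat" where
  "winner q x v = (LEAST i. i < q \<and> (\<forall>j<q. x (v, j) \<le> x (v, i)))"

lemma winner:
  assumes "q > 0"
  shows "winner q x v < q" "j < q \<Longrightarrow> x (v, j) \<le> x (v, winner q x v)"
proof -
  have "finite ((\<lambda>j. x (v, j)) ` {..<q})" "(\<lambda>j. x (v, j)) ` {..<q} \<noteq> {}" using assms by auto
  from Max_in[OF this] obtain i where i: "i < q" "Max ((\<lambda>j. x (v, j)) ` {..<q}) = x (v, i)" by auto
  have "\<forall>j<q. x (v, j) \<le> x (v, i)" unfolding i(2)[symmetric] by auto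
  then have "i < q \<and> (\<forall>j<q. x (v, j) \<le> x (v, i))" using i by blast
  then have "winner q x v < q \<and> (\<forall>j<q. x (v, j) \<le> x (v, winner q x v))"
    unfolding winner_def by (rule LeastI)
  then show "winner q x v < q" "j < q \<Longrightarrow> x (v, j) \<le> x (v, winner q x v)" by auto
qed

definition winners :: "nat \<Rightarrow> nat set \<Rightarrow> (nat \<times> nat \<Rightarrow> real) \<Rightarrow> assignment" where
  "winners q S x = (\<lambda>v\<in>S. winner q x v)"

lemma measurable_winner:
  assumes "v \<in> S"
  shows "(\<lambda>x. winner q x v) \<in> Pi\<^sub>M (S \<times> {..<q}) (\<lambda>_. lborel :: real measure) \<rightarrow>\<^sub>M count_space UNIV"
  unfolding winner_def
proof (rule measurable_Least)
  fix i
  show "(\<lambda>x. i < q \<and> (\<forall>j<q. x (v, j) \<le> x (v, i)))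
      \<in> Pi\<^sub>M (S \<times> {..<q}) (\<lambda>_. lborel :: real measure) \<rightarrow>\<^sub>M count_space UNIV"
  proof (cases "i < q")
    case True
    have "{x \<in> space (Pi\<^sub>M (S \<times> {..<q}) (\<lambda>_. lborel :: real measure)). x (v, j) \<le> x (v, i)}
        \<in> sets (Pi\<^sub>M (S \<times> {..<q}) (\<lambda>_. lborel))" if "j < q" for j
      using True that assms by (intro borel_measurable_le) (auto intro!: measurable_component_singleton)
    then have "{x \<in> space (Pi\<^sub>M (S \<times> {..<q}) (\<lambda>_. lborel :: real measure)). \<forall>j\<in>{..<q}. x (v, j) \<le> x (v, i)}
        \<in> sets (Pi\<^sub>M (S \<times> {..<q}) (\<lambda>_. lborel))"
      by (intro sets.sets_Collect_finite_All) auto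
    moreover have "(i < q \<and> (\<forall>j<q. x (v, j) \<le> x (v, i))) \<longleftrightarrow> (\<forall>j\<in>{..<q}. x (v, j) \<le> x (v, i))"
      for x :: "nat \<times> nat \<Rightarrow> real" using True by blast
    ultimately show ?thesis unfolding pred_def by (simp only:)
  qed simp
qed

lemma measurable_winners:
  assumes "finite S" "q > 0"
  shows "winners q S \<in> Pi\<^sub>M (S \<times> {..<q}) (\<lambda>_. lborel :: real measure) \<rightarrow>\<^sub>M count_space UNIV"
    and "finite (range (winners q S))"
proof -
  let ?M = "Pi\<^sub>M (S \<times> {..<q}) (\<lambda>_. lborel :: real measure)"
  have r: "winners q S x \<in> S \<rightarrow>\<^sub>E {..<q}" for x
    unfolding winners_def using winner(1)[OF assms(2)] by auto
  have f: "finite (S \<rightarrow>\<^sub>E {..<q})" using assms by (intro finite_PiE) auto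
  then show "finite (range (winners q S))" using r by (rule_tac finite_subset) auto
  show "winners q S \<in> ?M \<rightarrow>\<^sub>M count_space UNIV"
  proof (rule measurable_compose[where g = "\<lambda>x. x" and N = "count_space (S \<rightarrow>\<^sub>E {..<q})"])
    show "winners q S \<in> ?M \<rightarrow>\<^sub>M count_space (S \<rightarrow>\<^sub>E {..<q})"
      unfolding measurable_count_space_eq2[OF f]
    proof (intro conjI ballI)
      show "winners q S \<in> space ?M \<rightarrow> S \<rightarrow>\<^sub>E {..<q}" using r by auto
      fix w assume w: "w \<in> S \<rightarrow>\<^sub>E {..<q}"
      have "winners q S -` {w} \<inter> space ?M = {x \<in> space ?M. \<forall>v\<in>S. winner q x v = w v}"
        using w by (auto simp: winners_def fun_eq_iff PiE_def extensional_def)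
      also have "\<dots> \<in> sets ?M"
      proof (intro sets.sets_Collect_finite_All assms(1))
        fix v assume "v \<in> S"
        from measurable_sets[OF measurable_winner[OF this], of "{w v}" q]
        show "{x \<in> space ?M. winner q x v = w v} \<in> sets ?M"
          by (simp add: vimage_def Int_def conj_commute)
      qed
      finally show "winners q S -` {w} \<inter> space ?M \<in> sets ?M" .
    qed
  qed simp
qed

definition winner_pmf :: "nat \<Rightarrow> (nat \<times> nat \<Rightarrow> nat \<times> nat \<Rightarrow> real) \<Rightarrow> nat set \<Rightarrow> assignment pmf" where
  "winner_pmf q K S = Abs_pmf (distr (gauss (S \<times> {..<q}) K) (count_space UNIV) (winners q S))"

definition shift_label :: "nat \<Rightarrow> nat set \<Rightarrow> nat \<Rightarrow> assignment \<Rightarrow> assignment" where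
  "shift_label q S t w = (\<lambda>v\<in>S. (w v + t) mod q)"

text \<open>The shift bounds the probability of any one value of a variable by \<open>1 / q\<close>.
  As it is common to all variables, it leaves differences of labels modulo \<open>q\<close>
  unchanged.\<close>

definition rounded_pmf :: "nat \<Rightarrow> (nat \<times> nat \<Rightarrow> nat \<times> nat \<Rightarrow> real) \<Rightarrow> nat set \<Rightarrow> assignment pmf" where
  "rounded_pmf q K S = bind_pmf (pmf_of_set {..<q}) (\<lambda>t. map_pmf (shift_label q S t) (winner_pmf q K S))"

context
  fixes q :: nat and K :: "nat \<times> nat \<Rightarrow> nat \<times> nat \<Rightarrow> real"
  assumes q: "q > 0" and sym: "\<And>a b. K a b = K b a"
begin

lemma winner_pmf_rep:
  assumes "finite S" "posdef (S \<times> {..<q}) K"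
  shows "measure_pmf (winner_pmf q K S) = distr (gauss (S \<times> {..<q}) K) (count_space UNIV) (winners q S)"
  unfolding winner_pmf_def
proof (rule measure_pmf_Abs_distr)
  show "prob_space (gauss (S \<times> {..<q}) K)"
    using assms by (intro prob_space_gauss symm_on_UNIV sym) auto
  show "winners q S \<in> gauss (S \<times> {..<q}) K \<rightarrow>\<^sub>M count_space UNIV"
    using measurable_winners(1)[OF assms(1) q] by (simp cong: measurable_cong_sets)
  show "finite (winners q S ` space (gauss (S \<times> {..<q}) K))"
    using measurable_winners(2)[OF assms(1) q] by (rule finite_subset[rotated]) auto
qed

lemma winner_pmf_restrict:
  assumes "finite S" "posdef (S \<times> {..<q}) K" "S' \<subseteq> S"
  shows "map_pmf (\<lambda>\<alpha>. restrict \<alpha> S') (winner_pmf q K S) = winner_pmf q K S'"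
proof -
  let ?G = "gauss (S \<times> {..<q}) K" and ?G' = "gauss (S' \<times> {..<q}) K"
  let ?M' = "Pi\<^sub>M (S' \<times> {..<q}) (\<lambda>_. lborel :: real measure)"
  have S': "finite S'" using assms finite_subset by blast
  have sub: "S' \<times> {..<q} \<subseteq> S \<times> {..<q}" using assms(3) by auto
  have p': "posdef (S' \<times> {..<q}) K"
    using assms(1) by (intro posdef_mono[OF assms(2) sub]) auto
  have R: "(\<lambda>x. restrict x (S' \<times> {..<q})) \<in> ?G \<rightarrow>\<^sub>M ?M'"
    using measurable_restrict_subset[OF sub, of "\<lambda>_. lborel :: real measure"]
    by (simp cong: measurable_cong_sets)
  have W: "winners q S \<in> ?G \<rightarrow>\<^sub>M count_space UNIV"
    using measurable_winners(1)[OF assms(1) q] by (simp cong: measurable_cong_sets)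
  have comp: "(\<lambda>\<alpha>. restrict \<alpha> S') \<circ> winners q S = winners q S' \<circ> (\<lambda>x. restrict x (S' \<times> {..<q}))"
  proof
    fix x
    have "winner q (restrict x (S' \<times> {..<q})) v = winner q x v" if "v \<in> S'" for v
      unfolding winner_def using that by (intro arg_cong[of _ _ Least]) (auto simp: fun_eq_iff)
    then show "((\<lambda>\<alpha>. restrict \<alpha> S') \<circ> winners q S) x = (winners q S' \<circ> (\<lambda>x. restrict x (S' \<times> {..<q}))) x"
      using assms(3) by (auto simp: winners_def fun_eq_iff restrict_def)
  qed
  have "measure_pmf (map_pmf (\<lambda>\<alpha>. restrict \<alpha> S') (winner_pmf q K S))
     = distr (distr ?G (count_space UNIV) (winners q S)) (count_space UNIV) (\<lambda>\<alpha>. restrict \<alpha> S')"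
    unfolding map_pmf_rep_eq winner_pmf_rep[OF assms(1,2)] ..
  also have "\<dots> = distr ?G (count_space UNIV) ((\<lambda>\<alpha>. restrict \<alpha> S') \<circ> winners q S)"
    using W by (intro distr_distr) auto
  also have "\<dots> = distr (distr ?G ?M' (\<lambda>x. restrict x (S' \<times> {..<q}))) (count_space UNIV) (winners q S')"
    unfolding comp using R measurable_winners(1)[OF S' q] by (intro distr_distr[symmetric])
  also have "distr ?G ?M' (\<lambda>x. restrict x (S' \<times> {..<q})) = ?G'"
    using assms sub by (intro distr_gauss_restrict symm_on_UNIV sym) auto
  also have "distr ?G' (count_space UNIV) (winners q S') = measure_pmf (winner_pmf q K S')"
    by (rule winner_pmf_rep[OF S' p', symmetric])
  finally show ?thesis by (rule measure_pmf_inject[THEN iffD1])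
qed

lemma rounded_pmf_restrict:
  assumes "finite S" "posdef (S \<times> {..<q}) K" "S' \<subseteq> S"
  shows "map_pmf (\<lambda>\<alpha>. restrict \<alpha> S') (rounded_pmf q K S) = rounded_pmf q K S'"
proof -
  have "restrict (shift_label q S t w) S' = shift_label q S' t (restrict w S')" for t w
    using assms(3) by (auto simp: shift_label_def fun_eq_iff restrict_def)
  then show ?thesis
    unfolding rounded_pmf_def winner_pmf_restrict[OF assms, symmetric]
    by (simp add: map_bind_pmf map_pmf_comp o_def)
qed

lemma set_rounded_pmf: "set_pmf (rounded_pmf q K S) \<subseteq> assignments q S"
  using q by (auto simp: rounded_pmf_def assignments_def shift_label_def)

lemma rounded_pmf_uniform:
  assumes "v \<in> S"
  shows "measure_pmf.prob (rounded_pmf q K S) {\<alpha>. \<alpha> v = a} \<le> 1 / real q"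
proof -
  have *: "emeasure (map_pmf (\<lambda>t. shift_label q S t w) (pmf_of_set {..<q})) {\<alpha>. \<alpha> v = a} \<le> ennreal (1 / real q)" for w
  proof -
    have "inj_on (\<lambda>t. (w v + t) mod q) {..<q}"
      by (intro inj_onI) (auto intro: add_mod_inject)
    then have "card {t \<in> {..<q}. (w v + t) mod q = a} \<le> 1"
      by (intro card_le_Suc0_iff_eq[THEN iffD2, folded One_nat_def]) (auto simp: inj_on_def)
    moreover have "{..<q} \<inter> (\<lambda>t. shift_label q S t w) -` {\<alpha>. \<alpha> v = a} = {t \<in> {..<q}. (w v + t) mod q = a}"
      using assms by (auto simp: shift_label_def)
    ultimately show ?thesis
      unfolding measure_pmf.emeasure_eq_measure using q
      by (intro ennreal_leI) (auto simp: measure_pmf_of_set divide_right_mono lessThan_empty_iff)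
  qed
  \<comment> \<open>Exchanging the two independent choices fixes the winners first; the shift alone
    then decides whether the value \<open>a\<close> is hit.\<close>
  have "rounded_pmf q K S
     = bind_pmf (winner_pmf q K S) (\<lambda>w. map_pmf (\<lambda>t. shift_label q S t w) (pmf_of_set {..<q}))"
    unfolding rounded_pmf_def map_pmf_def by (rule bind_commute_pmf)
  then have "emeasure (rounded_pmf q K S) {\<alpha>. \<alpha> v = a}
     = (\<integral>\<^sup>+w. emeasure (map_pmf (\<lambda>t. shift_label q S t w) (pmf_of_set {..<q})) {\<alpha>. \<alpha> v = a} \<partial>winner_pmf q K S)"
    by simp
  also have "\<dots> \<le> (\<integral>\<^sup>+w. ennreal (1 / real q) \<partial>winner_pmf q K S)"
    by (intro nn_integral_mono *)
  finally show ?thesis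
    by (simp add: measure_pmf.emeasure_eq_measure)
qed

lemma rounded_pmf_disagree:
  assumes "u \<in> S" "v \<in> S"
  shows "measure_pmf.prob (rounded_pmf q K S) {\<alpha>. (\<alpha> u + b) mod q \<noteq> (\<alpha> v + c) mod q}
    \<le> measure_pmf.prob (winner_pmf q K S) {w. (w u + b) mod q \<noteq> (w v + c) mod q}"
proof -
  have *: "emeasure (map_pmf (shift_label q S t) (winner_pmf q K S)) {\<alpha>. (\<alpha> u + b) mod q \<noteq> (\<alpha> v + c) mod q}
    \<le> emeasure (winner_pmf q K S) {w. (w u + b) mod q \<noteq> (w v + c) mod q}" for t
  proof -
    have "shift_label q S t -` {\<alpha>. (\<alpha> u + b) mod q \<noteq> (\<alpha> v + c) mod q} \<subseteq> {w. (w u + b) mod q \<noteq> (w v + c) mod q}"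
    proof safe
      fix w assume e: "(w u + b) mod q = (w v + c) mod q"
        and n: "(shift_label q S t w u + b) mod q \<noteq> (shift_label q S t w v + c) mod q"
      have "((w u + t) mod q + b) mod q = ((w u + b) mod q + t) mod q" "((w v + t) mod q + c) mod q = ((w v + c) mod q + t) mod q"
        by (simp_all add: mod_simps add_ac)
      then show False using n assms e by (simp add: shift_label_def)
    qed
    then show ?thesis by (simp add: emeasure_mono)
  qed
  have "emeasure (rounded_pmf q K S) {\<alpha>. (\<alpha> u + b) mod q \<noteq> (\<alpha> v + c) mod q}
     = (\<integral>\<^sup>+t. emeasure (map_pmf (shift_label q S t) (winner_pmf q K S)) {\<alpha>. (\<alpha> u + b) mod q \<noteq> (\<alpha> v + c) mod q} \<partial>pmf_of_set {..<q})"
    unfolding rounded_pmf_def by (rule emeasure_bind_pmf)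
  also have "\<dots> \<le> (\<integral>\<^sup>+t. emeasure (winner_pmf q K S) {w. (w u + b) mod q \<noteq> (w v + c) mod q} \<partial>pmf_of_set {..<q})"
    by (intro nn_integral_mono *)
  finally show ?thesis
    by (simp add: measure_pmf.emeasure_eq_measure)
qed

text \<open>Suppose that the winners of \<open>u\<close> and \<open>v\<close>, read relative to
  \<open>a\<close>, are \<open>b\<close> and \<open>c\<close> with \<open>b \<noteq> c\<close>. If
  matched coordinates differ by less than \<open>s / 2\<close>, the two maximality conditions force
  the coordinates \<open>b\<close> and \<open>c\<close> of \<open>u\<close> to within
  \<open>s\<close> of each other. A small-ball bound and two deviation bounds then give the estimate
  for each of at most \<open>q\<^sup>2\<close> pairs.\<close>

lemma winner_pmf_disagree:
  assumes S: "finite S" "posdef (S \<times> {..<q}) K" and uv: "u \<in> S" "v \<in> S" "u \<noteq> v"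
    and a: "a u < q" "a v < q"
    and diag: "\<And>w i j. w \<in> {u, v} \<Longrightarrow> i < q \<Longrightarrow> j < q \<Longrightarrow> K (w, i) (w, j) = of_bool (i = j)"
    and k: "\<And>i. i < q \<Longrightarrow> K (u, (i + a u) mod q) (v, (i + a v) mod q) = \<kappa>"
    and \<kappa>: "\<kappa>\<^sup>2 < 1" and s: "s > 0"
  shows "measure_pmf.prob (winner_pmf q K S) {w. (w u + (q - a u)) mod q \<noteq> (w v + (q - a v)) mod q}
     \<le> (real q)\<^sup>2 * (s + 16 * (1 - \<kappa>) / s\<^sup>2)"
proof -
  let ?Y = "S \<times> {..<q}"
  let ?G = "gauss ?Y K"
  interpret G: prob_space ?G using S by (intro prob_space_gauss symm_on_UNIV sym) auto
  \<comment> \<open>\<open>g b\<close> and \<open>h b\<close> are the coordinates of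
    \<open>u\<close> and \<open>v\<close> matched by the forbidden values: their correlation is
    \<open>\<kappa>\<close>, while distinct coordinates of one variable are uncorrelated.\<close>
  define g where "g b = (u, (b + a u) mod q)" for b
  define h where "h b = (v, (b + a v) mod q)" for b
  have gh: "g b \<in> ?Y" "h b \<in> ?Y" "g b \<noteq> h b" for b using uv q by (auto simp: g_def h_def)
  have ginj: "g b \<noteq> g c" if "b < q" "c < q" "b \<noteq> c" for b c
    using that add_mod_inject[of "a u" b q c] unfolding g_def by (auto simp: add.commute)
  have Kg: "K (g b) (g c) = of_bool (g b = g c)" "K (h b) (h c) = of_bool (h b = h c)" for b c
    using q diag by (auto simp: g_def h_def)
  have Kgh: "K (g b) (h b) = \<kappa>" if "b < q" for b using k[OF that] by (simp add: g_def h_def)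
  define A where "A b c = {x \<in> space ?G. \<bar>x (g b) - x (g c)\<bar> \<le> s}" for b c
  define B where "B b = {x \<in> space ?G. s / 2 \<le> \<bar>x (g b) - x (h b)\<bar>}" for b
  have fY: "finite ?Y" using S by auto
  have A: "A b c \<in> sets ?G \<and> measure ?G (A b c) \<le> s" if "b < q" "c < q" "b \<noteq> c" for b c
  proof -
    have m: "{x \<in> space (gauss {g b, g c} K). \<bar>x (g b) - x (g c)\<bar> \<le> s} \<in> sets (gauss {g b, g c} K)"
      by measurable
    interpret P: prob_space "gauss {g b, g c} K"
      using gh fY by (intro prob_space_gauss symm_on_UNIV sym posdef_mono[OF S(2)]) auto
    have "emeasure (gauss {g b, g c} K) {x \<in> space (gauss {g b, g c} K). \<bar>x (g b) - x (g c)\<bar> \<le> s} \<le> ennreal s"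
      using ginj[OF that] s by (intro gauss_pair_small_ball) (auto simp: Kg)
    then have "measure (gauss {g b, g c} K) {x \<in> space (gauss {g b, g c} K). \<bar>x (g b) - x (g c)\<bar> \<le> s} \<le> s"
      using s by (simp add: P.emeasure_eq_measure)
    then show ?thesis
      unfolding A_def
      using measure_gauss_pair[OF fY symm_on_UNIV[OF sym] S(2) _ m] gh by auto
  qed
  have B: "B b \<in> sets ?G \<and> measure ?G (B b) \<le> 8 * (1 - \<kappa>) / s\<^sup>2" if "b < q" for b
  proof -
    have m: "{x \<in> space (gauss {g b, h b} K). s / 2 \<le> \<bar>x (g b) - x (h b)\<bar>} \<in> sets (gauss {g b, h b} K)"
      by measurable
    interpret P: prob_space "gauss {g b, h b} K"
      using gh fY by (intro prob_space_gauss symm_on_UNIV sym posdef_mono[OF S(2)]) auto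
    have k1: "\<kappa> < 1" using \<kappa> by (metis abs_square_less_1 abs_less_iff)
    have "emeasure (gauss {g b, h b} K) {x \<in> space (gauss {g b, h b} K). s / 2 \<le> \<bar>x (g b) - x (h b)\<bar>}
        \<le> ennreal ((2 - 2 * \<kappa>) / (s / 2)\<^sup>2)"
      using gh s \<kappa> Kgh[OF that] sym[of "h b" "g b"] by (intro gauss_pair_large_deviation) (auto simp: Kg)
    also have "(2 - 2 * \<kappa>) / (s / 2)\<^sup>2 = 8 * (1 - \<kappa>) / s\<^sup>2"
      by (simp add: power_divide)
    finally have "measure (gauss {g b, h b} K) {x \<in> space (gauss {g b, h b} K). s / 2 \<le> \<bar>x (g b) - x (h b)\<bar>} \<le> 8 * (1 - \<kappa>) / s\<^sup>2"
      using s k1 by (simp add: P.emeasure_eq_measure)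
    then show ?thesis
      unfolding B_def
      using measure_gauss_pair[OF fY symm_on_UNIV[OF sym] S(2) _ m] gh by auto
  qed
  let ?I = "{p \<in> {..<q} \<times> {..<q}. fst p \<noteq> snd p}"
  let ?D = "{w :: assignment. (w u + (q - a u)) mod q \<noteq> (w v + (q - a v)) mod q}"
  have W: "winners q S \<in> ?G \<rightarrow>\<^sub>M count_space UNIV"
    using measurable_winners(1)[OF S(1) q] by (simp cong: measurable_cong_sets)
  have cover: "winners q S -` ?D \<inter> space ?G \<subseteq> (\<Union>p\<in>?I. A (fst p) (snd p) \<union> (B (fst p) \<union> B (snd p)))"
  proof
    fix x assume x: "x \<in> winners q S -` ?D \<inter> space ?G"
    define b where "b = (winner q x u + (q - a u)) mod q"
    define c where "c = (winner q x v + (q - a v)) mod q"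
    have bc: "b \<noteq> c" "b < q" "c < q" using x uv q by (auto simp: winners_def b_def c_def)
    have inv: "((i + (q - e)) mod q + e) mod q = i" if "i < q" "e < q" for i e
      using that by (simp add: mod_simps)
    have wu: "winner q x u = (b + a u) mod q" and wv: "winner q x v = (c + a v) mod q"
      unfolding b_def c_def using inv winner(1)[OF q] a by simp_all
    have 1: "x (g c) \<le> x (g b)"
      unfolding g_def wu[symmetric] using q by (intro winner(2)) auto
    have 2: "x (h b) \<le> x (h c)"
      unfolding h_def wv[symmetric] using q by (intro winner(2)) auto
    have "\<bar>x (g b) - x (g c)\<bar> \<le> s \<or> s / 2 \<le> \<bar>x (g b) - x (h b)\<bar> \<or> s / 2 \<le> \<bar>x (g c) - x (h c)\<bar>"
      using 1 2 by linarith
    then have "x \<in> A b c \<union> (B b \<union> B c)" using x by (auto simp: A_def B_def)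
    moreover have "(b, c) \<in> ?I" using bc by auto
    ultimately show "x \<in> (\<Union>p\<in>?I. A (fst p) (snd p) \<union> (B (fst p) \<union> B (snd p)))" by force
  qed
  have mI: "A (fst p) (snd p) \<union> (B (fst p) \<union> B (snd p)) \<in> sets ?G" if "p \<in> ?I" for p
    using that A[of "fst p" "snd p"] B[of "fst p"] B[of "snd p"] by (intro sets.Un) auto
  have "measure_pmf.prob (winner_pmf q K S) ?D = measure ?G (winners q S -` ?D \<inter> space ?G)"
    unfolding winner_pmf_rep[OF S] using W by (subst measure_distr) auto
  also have "\<dots> \<le> measure ?G (\<Union>p\<in>?I. A (fst p) (snd p) \<union> (B (fst p) \<union> B (snd p)))"
    using mI by (intro G.finite_measure_mono cover sets.finite_UN) auto
  also have "\<dots> \<le> (\<Sum>p\<in>?I. measure ?G (A (fst p) (snd p) \<union> (B (fst p) \<union> B (snd p))))"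
    using mI by (intro measure_UNION_le) auto
  also have "\<dots> \<le> (\<Sum>p\<in>?I. s + 16 * (1 - \<kappa>) / s\<^sup>2)"
  proof (rule sum_mono)
    fix p assume p: "p \<in> ?I"
    have p': "A (fst p) (snd p) \<in> sets ?G" "B (fst p) \<in> sets ?G" "B (snd p) \<in> sets ?G"
      "measure ?G (A (fst p) (snd p)) \<le> s" "measure ?G (B (fst p)) \<le> 8 * (1 - \<kappa>) / s\<^sup>2"
      "measure ?G (B (snd p)) \<le> 8 * (1 - \<kappa>) / s\<^sup>2"
      using p A[of "fst p" "snd p"] B[of "fst p"] B[of "snd p"] by auto
    have "measure ?G (A (fst p) (snd p) \<union> (B (fst p) \<union> B (snd p)))
       \<le> measure ?G (A (fst p) (snd p)) + (measure ?G (B (fst p)) + measure ?G (B (snd p)))"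
      using p' by (intro order_trans[OF measure_Un_le] add_left_mono measure_Un_le) auto
    also have "\<dots> \<le> s + (8 * (1 - \<kappa>) / s\<^sup>2 + 8 * (1 - \<kappa>) / s\<^sup>2)" using p' by (intro add_mono)
    finally show "measure ?G (A (fst p) (snd p) \<union> (B (fst p) \<union> B (snd p))) \<le> s + 16 * (1 - \<kappa>) / s\<^sup>2"
      by (simp add: field_simps)
  qed
  also have "\<dots> = card ?I * (s + 16 * (1 - \<kappa>) / s\<^sup>2)" by simp
  also have "\<dots> \<le> (real q)\<^sup>2 * (s + 16 * (1 - \<kappa>) / s\<^sup>2)"
  proof (rule mult_right_mono)
    have "card ?I \<le> card ({..<q} \<times> {..<q})" by (intro card_mono) auto
    then have "card ?I \<le> q\<^sup>2" by (simp add: power2_eq_square card_cartesian_product)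
    then show "real (card ?I) \<le> (real q)\<^sup>2" by (metis of_nat_le_iff of_nat_power)
    have "\<kappa> < 1" using \<kappa> by (metis abs_square_less_1 abs_less_iff)
    then show "0 \<le> s + 16 * (1 - \<kappa>) / s\<^sup>2" using s by simp
  qed
  finally show ?thesis .
qed

text \<open>A violated predicate has some \<open>u\<close> with its forbidden value. Either
  \<open>u\<close> disagrees with a fixed reference variable \<open>v\<close> after removing the
  forbidden values, or \<open>v\<close> has its own forbidden value too. The latter costs only
  \<open>1 / q\<close> once, not once for each variable.\<close>

lemma rounded_pmf_ne_sat:
  assumes S: "finite S" "S \<noteq> {}" "posdef (S \<times> {..<q}) K"
    and a: "a \<in> S \<rightarrow> {..<q}"
    and diag: "\<And>w i j. w \<in> S \<Longrightarrow> i < q \<Longrightarrow> j < q \<Longrightarrow> K (w, i) (w, j) = of_bool (i = j)"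
    and k: "\<And>u v i. u \<in> S \<Longrightarrow> v \<in> S \<Longrightarrow> u \<noteq> v \<Longrightarrow> i < q \<Longrightarrow> K (u, (i + a u) mod q) (v, (i + a v) mod q) = \<kappa>"
    and \<kappa>: "\<kappa>\<^sup>2 < 1" and s: "s > 0"
  shows "measure_pmf.prob (rounded_pmf q K S) {\<alpha>. ne_sat (S, a) \<alpha>}
     \<ge> 1 - 1 / real q - real (card S) * ((real q)\<^sup>2 * (s + 16 * (1 - \<kappa>) / s\<^sup>2))"
proof -
  let ?p = "rounded_pmf q K S" and ?e = "(real q)\<^sup>2 * (s + 16 * (1 - \<kappa>) / s\<^sup>2)"
  obtain v where v: "v \<in> S" using S by auto
  let ?B = "\<lambda>u. {\<alpha> :: assignment. (\<alpha> u + (q - a u)) mod q \<noteq> (\<alpha> v + (q - a v)) mod q}"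
  have \<kappa>1: "\<kappa> < 1" using \<kappa> by (metis abs_square_less_1 abs_less_iff)
  have e0: "?e \<ge> 0" using s \<kappa>1 by simp
  have B: "measure_pmf.prob ?p (?B u) \<le> ?e" if u: "u \<in> S" for u
  proof (cases "u = v")
    case False
    have "measure_pmf.prob ?p (?B u)
        \<le> measure_pmf.prob (winner_pmf q K S) {w. (w u + (q - a u)) mod q \<noteq> (w v + (q - a v)) mod q}"
      by (rule rounded_pmf_disagree[OF u v])
    also have "\<dots> \<le> ?e"
      using a u v False by (intro winner_pmf_disagree[OF S(1,3) u v False] diag k \<kappa> s) auto
    finally show ?thesis .
  qed (use e0 in simp)
  have "measure_pmf.prob ?p (UNIV - {\<alpha>. ne_sat (S, a) \<alpha>})
      \<le> measure_pmf.prob ?p ({\<alpha>. \<alpha> v = a v} \<union> (\<Union>u\<in>S. ?B u))"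
  proof (intro measure_pmf.finite_measure_mono_AE AE_pmfI impI)
    fix \<alpha> assume \<alpha>: "\<alpha> \<in> set_pmf ?p" "\<alpha> \<in> UNIV - {\<alpha>. ne_sat (S, a) \<alpha>}"
    then obtain u where u: "u \<in> S" "\<alpha> u = a u" by (auto simp: ne_sat_def)
    have l: "\<alpha> v < q" using \<alpha>(1) set_rounded_pmf v by (fastforce simp: assignments_def)
    show "\<alpha> \<in> {\<alpha>. \<alpha> v = a v} \<union> (\<Union>u\<in>S. ?B u)"
    proof (cases "\<alpha> \<in> ?B u")
      case False
      have "a u < q" "a v < q" using a u v by auto
      then have "(\<alpha> v + (q - a v)) mod q = 0" using False u by simp
      then have "((\<alpha> v + (q - a v)) mod q + a v) mod q = a v" using \<open>a v < q\<close> by simp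
      then have "\<alpha> v = a v" using l \<open>a v < q\<close> by (simp add: mod_simps)
      then show ?thesis by simp
    next
      case True
      then show ?thesis using u(1) by blast
    qed
  qed simp
  also have "\<dots> \<le> measure_pmf.prob ?p {\<alpha>. \<alpha> v = a v} + measure_pmf.prob ?p (\<Union>u\<in>S. ?B u)"
    by (intro measure_Un_le) auto
  also have "\<dots> \<le> 1 / real q + (\<Sum>u\<in>S. measure_pmf.prob ?p (?B u))"
    using S by (intro add_mono rounded_pmf_uniform v measure_UNION_le) auto
  also have "\<dots> \<le> 1 / real q + (\<Sum>u\<in>S. ?e)"
    by (intro add_left_mono sum_mono B)
  finally show ?thesis
    by (subst (asm) measure_pmf.prob_compl[of "{\<alpha>. ne_sat (S, a) \<alpha>}" ?p, simplified]) simp_all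
qed

lemma rounded_pmf_sa_solution:
  assumes "\<And>S. S \<subseteq> {1..n} \<Longrightarrow> card S \<le> r \<Longrightarrow> posdef (S \<times> {..<q}) K"
  shows "sa_solution q n r (rounded_pmf q K)"
  unfolding sa_solution_def
proof (intro allI impI conjI set_rounded_pmf)
  fix S S' assume "S \<subseteq> {1..n} \<and> card S \<le> r" "S' \<subseteq> S"
  then show "map_pmf (\<lambda>\<alpha>. restrict \<alpha> S') (rounded_pmf q K S) = rounded_pmf q K S'"
    using assms finite_subset[of S "{1..n}"] by (intro rounded_pmf_restrict) auto
qed

end

section \<open>Sparse graphs and non-backtracking walks\<close>

definition nbrs :: "('v \<Rightarrow> 'v \<Rightarrow> bool) \<Rightarrow> 'v set \<Rightarrow> 'v \<Rightarrow> 'v set" where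
  "nbrs adj U x = {y \<in> U. adj x y}"

text \<open>The share of one undirected edge in \<open>bethe_form\<close>. Together with the vertex
  term \<open>(1 - \<rho>\<^sup>2) * b\<^sup>2\<close> of one end it is the square
  \<open>(b - \<rho> * a)\<^sup>2\<close>.\<close>

definition edge_cost :: "real \<Rightarrow> real \<Rightarrow> real \<Rightarrow> real" where
  "edge_cost \<rho> a b = \<rho>\<^sup>2 * (a\<^sup>2 + b\<^sup>2) - 2 * \<rho> * a * b"

text \<open>A rescaled Bethe Hessian at \<open>1 / \<rho>\<close>. Degrees are taken inside
  \<open>U\<close>, so deleting vertices leads to a form of the same shape.\<close>

definition bethe_form :: "('v \<Rightarrow> 'v \<Rightarrow> bool) \<Rightarrow> real \<Rightarrow> 'v set \<Rightarrow> ('v \<Rightarrow> real) \<Rightarrow> real" where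
  "bethe_form adj \<rho> U w = (\<Sum>x\<in>U. (1 - \<rho>\<^sup>2 + \<rho>\<^sup>2 * card (nbrs adj U x)) * (w x)\<^sup>2
     - \<rho> * (\<Sum>y\<in>nbrs adj U x. w x * w y))"

section \<open>Energy along chains and paths\<close>

lemma edge_cost_commute: "edge_cost \<rho> a b = edge_cost \<rho> b a"
  by (simp add: edge_cost_def)

text \<open>In a single step \<open>x\<close> becomes \<open>\<rho> * x + s\<close>, and the slack
  of the inequality is a perfect square. The squares on the right are the ones that the quadratic
  form supplies along a path.\<close>

lemma chain_bound:
  fixes a :: "nat \<Rightarrow> real"
  assumes "\<rho>\<^sup>2 < 1"
  shows "(1 - \<rho>\<^sup>2) * (a h)\<^sup>2 \<le> (1 - \<rho>\<^sup>2) * (a 0)\<^sup>2 + (\<Sum>i<h. (a (Suc i) - \<rho> * a i)\<^sup>2)"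
proof (induction h)
  case (Suc h)
  have *: "(1 - r\<^sup>2) * (r * x + s)\<^sup>2 \<le> (1 - r\<^sup>2) * x\<^sup>2 + s\<^sup>2" for r x s :: real
  proof -
    have "(1 - r\<^sup>2) * x\<^sup>2 + s\<^sup>2 - (1 - r\<^sup>2) * (r * x + s)\<^sup>2 = ((1 - r\<^sup>2) * x - r * s)\<^sup>2"
      by (simp add: power2_eq_square algebra_simps)
    then show ?thesis by (smt (verit) zero_le_power2)
  qed
  from *[of \<rho> "a h" "a (Suc h) - \<rho> * a h"] Suc show ?case by simp
qed simp

text \<open>Subtracting \<open>\<rho> ^ i * a 0\<close>, the solution without increments, leaves a
  chain that starts at zero and obeys \<open>chain_bound\<close>. The factor
  \<open>\<rho> * (1 - \<rho>)\<close> is the negative weight of a middle edge at each end; the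
  coefficient 3/4 leaves a quarter of the squares to spare.\<close>

lemma chain_decay:
  fixes a :: "nat \<Rightarrow> real"
  assumes "0 < \<rho>" "\<rho> < 1"
  shows "\<rho> * (1 - \<rho>) * (a h)\<^sup>2 \<le> \<rho> ^ (2 * h) * (a 0)\<^sup>2 + 3 / 4 * (\<Sum>i<h. (a (Suc i) - \<rho> * a i)\<^sup>2)"
proof -
  let ?\<sigma> = "\<Sum>i<h. (a (Suc i) - \<rho> * a i)\<^sup>2"
  define b where "b i = a i - \<rho> ^ i * a 0" for i
  have r2: "\<rho>\<^sup>2 < 1" using assms by (simp add: power_less_one_iff)
  have bs: "b (Suc i) - \<rho> * b i = a (Suc i) - \<rho> * a i" for i by (simp add: b_def algebra_simps)
  have b: "(1 - \<rho>\<^sup>2) * (b h)\<^sup>2 \<le> ?\<sigma>"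
    using chain_bound[OF r2, of b h] unfolding bs by (simp add: b_def)
  \<comment> \<open>The weights 3 and 3/2 suit the next estimate, where
    \<open>\<rho> * (1 - \<rho>) \<le> 1 / 4\<close> and
    \<open>2 * \<rho> * (1 - \<rho>) \<le> 1 - \<rho>\<^sup>2\<close> turn them into 1 and
    3/4.\<close>
  have "(a h)\<^sup>2 \<le> 3 * (\<rho> ^ h * a 0)\<^sup>2 + 3 / 2 * (b h)\<^sup>2"
  proof -
    have *: "(x + y)\<^sup>2 \<le> 3 * x\<^sup>2 + 3 / 2 * y\<^sup>2" for x y :: real
    proof -
      have "3 * x\<^sup>2 + 3 / 2 * y\<^sup>2 - (x + y)\<^sup>2 = 2 * (x - y / 2)\<^sup>2"
        by (simp add: power2_eq_square algebra_simps)
      then show ?thesis by (smt (verit) zero_le_power2)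
    qed
    from *[of "\<rho> ^ h * a 0" "b h"] show ?thesis by (simp add: b_def)
  qed
  then have "\<rho> * (1 - \<rho>) * (a h)\<^sup>2 \<le> \<rho> * (1 - \<rho>) * (3 * (\<rho> ^ h * a 0)\<^sup>2 + 3 / 2 * (b h)\<^sup>2)"
    using assms by (intro mult_left_mono) auto
  also have "\<dots> = 3 * (\<rho> * (1 - \<rho>)) * (\<rho> ^ h * a 0)\<^sup>2 + 3 / 2 * (\<rho> * (1 - \<rho>)) * (b h)\<^sup>2"
    by (simp add: algebra_simps)
  also have "\<dots> \<le> 1 * (\<rho> ^ h * a 0)\<^sup>2 + 3 / 4 * (1 - \<rho>\<^sup>2) * (b h)\<^sup>2"
  proof (intro add_mono mult_right_mono)
    have "1 / 4 - \<rho> * (1 - \<rho>) = (\<rho> - 1 / 2)\<^sup>2" by (simp add: power2_eq_square algebra_simps)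
    then have "\<rho> * (1 - \<rho>) \<le> 1 / 4" by (smt (verit) zero_le_power2)
    then show "3 * (\<rho> * (1 - \<rho>)) \<le> 1" by simp
    have "(1 - \<rho>\<^sup>2) - 2 * (\<rho> * (1 - \<rho>)) = (1 - \<rho>)\<^sup>2" by (simp add: power2_eq_square algebra_simps)
    then have "2 * (\<rho> * (1 - \<rho>)) \<le> 1 - \<rho>\<^sup>2" by (smt (verit) zero_le_power2)
    then show "3 / 2 * (\<rho> * (1 - \<rho>)) \<le> 3 / 4 * (1 - \<rho>\<^sup>2)" by simp
  qed auto
  also have "\<dots> = \<rho> ^ (2 * h) * (a 0)\<^sup>2 + 3 / 4 * ((1 - \<rho>\<^sup>2) * (b h)\<^sup>2)"
    by (simp add: power_mult_distrib power_mult[symmetric] mult.commute[of h] mult.assoc)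
  also have "\<dots> \<le> \<rho> ^ (2 * h) * (a 0)\<^sup>2 + 3 / 4 * ?\<sigma>"
    using b by (intro add_left_mono mult_left_mono) auto
  finally show ?thesis .
qed

text \<open>
  The terms contributed by a path of \<open>2h\<close> vertices are almost a sum of squares: orient both halves
  away from the end points; only the middle edge is left over, and its negative part has decayed by \<open>\<rho>\<^sup>h\<close>.
\<close>

lemma path_energy:
  fixes a :: "nat \<Rightarrow> real"
  assumes r: "0 < \<rho>" "\<rho> < 1"
  obtains \<sigma> where "\<sigma> \<ge> 0"
    "(\<Sum>i<2 * h. (1 - \<rho>\<^sup>2) * (a (Suc i))\<^sup>2 + edge_cost \<rho> (a i) (a (Suc i))) + edge_cost \<rho> (a (2 * h)) (a (Suc (2 * h)))
      \<ge> \<sigma> / 4 - \<rho> ^ (2 * h) * ((a 0)\<^sup>2 + (a (Suc (2 * h)))\<^sup>2)"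
    "\<And>i. i \<le> Suc (2 * h) \<Longrightarrow> (1 - \<rho>\<^sup>2) * (a i)\<^sup>2 \<le> (1 - \<rho>\<^sup>2) * max ((a 0)\<^sup>2) ((a (Suc (2 * h)))\<^sup>2) + \<sigma>"
proof -
  define b where "b i = a (Suc (2 * h) - i)" for i
  define S where "S c n = (\<Sum>i<n. (c (Suc i) - \<rho> * c i)\<^sup>2)" for c :: "nat \<Rightarrow> real" and n
  have r2: "\<rho>\<^sup>2 < 1" using r by (simp add: power_less_one_iff)
  have S0: "S c n \<ge> 0" for c n unfolding S_def by (intro sum_nonneg) auto
  have Smono: "S c m \<le> S c n" if "m \<le> n" for c m n
    unfolding S_def using that by (intro sum_mono2) auto
  have sq: "(1 - \<rho>\<^sup>2) * (c (Suc i))\<^sup>2 + edge_cost \<rho> (c i) (c (Suc i)) = (c (Suc i) - \<rho> * c i)\<^sup>2"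
    for c :: "nat \<Rightarrow> real" and i
    by (simp add: edge_cost_def power2_eq_square algebra_simps)
  \<comment> \<open>Regroups the second half: its first edge, the middle one, is split off, and
    every vertex is paired with the edge on its far side. Read backwards, this half then has the
    form of the first.\<close>
  have shift: "(\<Sum>i<n. f i + c i) + c n = c 0 + (\<Sum>i<n. f i + c (Suc i))" for f c :: "nat \<Rightarrow> real" and n
    by (induction n) auto
  let ?f = "\<lambda>i. (1 - \<rho>\<^sup>2) * (a (Suc i))\<^sup>2 + edge_cost \<rho> (a i) (a (Suc i))"
  have split: "(\<Sum>i<h + n. ?f i) = (\<Sum>i<h. ?f i) + (\<Sum>i<n. ?f (h + i))" for n
    by (induction n) auto
  have "(\<Sum>i<2 * h. ?f i) + edge_cost \<rho> (a (2 * h)) (a (Suc (2 * h)))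
     = (\<Sum>i<h. ?f i) + ((\<Sum>i<h. ?f (h + i)) + edge_cost \<rho> (a (h + h)) (a (Suc (h + h))))"
    using split[of h] by (simp add: mult_2)
  also have "(\<Sum>i<h. ?f (h + i)) + edge_cost \<rho> (a (h + h)) (a (Suc (h + h)))
     = edge_cost \<rho> (a h) (a (Suc h)) + (\<Sum>i<h. (1 - \<rho>\<^sup>2) * (a (Suc (h + i)))\<^sup>2 + edge_cost \<rho> (a (h + Suc i)) (a (Suc (h + Suc i))))"
    using shift[of "\<lambda>i. (1 - \<rho>\<^sup>2) * (a (Suc (h + i)))\<^sup>2" "\<lambda>i. edge_cost \<rho> (a (h + i)) (a (Suc (h + i)))" h] by simp
  also have "(\<Sum>i<h. (1 - \<rho>\<^sup>2) * (a (Suc (h + i)))\<^sup>2 + edge_cost \<rho> (a (h + Suc i)) (a (Suc (h + Suc i))))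
     = (\<Sum>i<h. (1 - \<rho>\<^sup>2) * (b (Suc i))\<^sup>2 + edge_cost \<rho> (b i) (b (Suc i)))"
    by (subst sum.nat_diff_reindex[symmetric], intro sum.cong refl)
      (auto simp: b_def edge_cost_commute Suc_diff_le mult_2 intro!: arg_cong2[where f = "(+)"] arg_cong2[where f = "edge_cost \<rho>"] arg_cong[where f = a] arg_cong[where f = "\<lambda>x. (1 - \<rho>\<^sup>2) * (a x)\<^sup>2"])
  finally have Q: "(\<Sum>i<2 * h. ?f i) + edge_cost \<rho> (a (2 * h)) (a (Suc (2 * h)))
     = S a h + (edge_cost \<rho> (a h) (a (Suc h)) + S b h)"
    unfolding sq S_def .
  have bh: "b h = a (Suc h)" "b 0 = a (Suc (2 * h))" by (simp_all add: b_def)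
  \<comment> \<open>Both ends of the middle edge have spent their vertex terms, so the edge is
    completed to \<open>\<rho> * (x - y)\<^sup>2\<close> at the cost of
    \<open>\<rho> * (1 - \<rho>)\<close> on each end.\<close>
  have "edge_cost \<rho> (a h) (a (Suc h)) \<ge> - (\<rho> * (1 - \<rho>) * (a h)\<^sup>2) - \<rho> * (1 - \<rho>) * (a (Suc h))\<^sup>2"
  proof -
    have "edge_cost \<rho> x y + \<rho> * (1 - \<rho>) * x\<^sup>2 + \<rho> * (1 - \<rho>) * y\<^sup>2 = \<rho> * (x - y)\<^sup>2" for x y
      by (simp add: edge_cost_def power2_eq_square algebra_simps)
    moreover have "\<rho> * (a h - a (Suc h))\<^sup>2 \<ge> 0" using r by simp
    ultimately show ?thesis by (smt (verit))
  qed
  moreover have "\<rho> * (1 - \<rho>) * (a h)\<^sup>2 \<le> \<rho> ^ (2 * h) * (a 0)\<^sup>2 + 3 / 4 * S a h"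
    unfolding S_def by (rule chain_decay[OF r])
  moreover have "\<rho> * (1 - \<rho>) * (a (Suc h))\<^sup>2 \<le> \<rho> ^ (2 * h) * (a (Suc (2 * h)))\<^sup>2 + 3 / 4 * S b h"
    using chain_decay[OF r, of b h] unfolding S_def bh .
  ultimately have 1: "(\<Sum>i<2 * h. ?f i) + edge_cost \<rho> (a (2 * h)) (a (Suc (2 * h)))
      \<ge> (S a h + S b h) / 4 - \<rho> ^ (2 * h) * ((a 0)\<^sup>2 + (a (Suc (2 * h)))\<^sup>2)"
    unfolding Q by (simp add: algebra_simps)
  have 2: "(1 - \<rho>\<^sup>2) * (a i)\<^sup>2 \<le> (1 - \<rho>\<^sup>2) * max ((a 0)\<^sup>2) ((a (Suc (2 * h)))\<^sup>2) + (S a h + S b h)"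
    if i: "i \<le> Suc (2 * h)" for i
  proof (cases "i \<le> h")
    case True
    have "(1 - \<rho>\<^sup>2) * (a i)\<^sup>2 \<le> (1 - \<rho>\<^sup>2) * (a 0)\<^sup>2 + S a i"
      unfolding S_def by (rule chain_bound[OF r2])
    also have "\<dots> \<le> (1 - \<rho>\<^sup>2) * max ((a 0)\<^sup>2) ((a (Suc (2 * h)))\<^sup>2) + (S a h + S b h)"
      using r2 Smono[OF True, of a] S0[of b h] by (intro add_mono mult_left_mono) auto
    finally show ?thesis .
  next
    case False
    define j where "j = Suc (2 * h) - i"
    have j: "j \<le> h" "a i = b j" using False i by (auto simp: j_def b_def)
    have "(1 - \<rho>\<^sup>2) * (a i)\<^sup>2 \<le> (1 - \<rho>\<^sup>2) * (b 0)\<^sup>2 + S b j"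
      unfolding S_def j by (rule chain_bound[OF r2])
    also have "\<dots> \<le> (1 - \<rho>\<^sup>2) * max ((a 0)\<^sup>2) ((a (Suc (2 * h)))\<^sup>2) + (S a h + S b h)"
      unfolding bh using r2 Smono[OF j(1), of b] S0[of a h] by (intro add_mono mult_left_mono) auto
    finally show ?thesis .
  qed
  show ?thesis using that[of "S a h + S b h"] S0 1 2 by auto
qed

section \<open>Non-backtracking walks in graphs of large girth\<close>

definition nbwalk :: "('v \<Rightarrow> 'v \<Rightarrow> bool) \<Rightarrow> 'v list \<Rightarrow> bool" where
  "nbwalk adj xs \<longleftrightarrow> xs \<noteq> [] \<and> (\<forall>i. Suc i < length xs \<longrightarrow> adj (xs ! i) (xs ! Suc i))
     \<and> (\<forall>i. Suc (Suc i) < length xs \<longrightarrow> xs ! i \<noteq> xs ! Suc (Suc i))"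

locale sgraph =
  fixes adj :: "'v \<Rightarrow> 'v \<Rightarrow> bool"
  assumes adj_sym: "adj x y \<Longrightarrow> adj y x" and adj_irrefl: "\<not> adj x x"
begin

lemma finite_nbrs: "finite U \<Longrightarrow> finite (nbrs adj U x)"
  by (simp add: nbrs_def)

text \<open>Deleting \<open>v\<close> also lowers the degrees of its neighbours. Their lost diagonal
  terms complete each incident edge to a full \<open>edge_cost\<close>.\<close>

lemma bethe_form_remove:
  assumes "finite U" "v \<in> U"
  shows "bethe_form adj \<rho> U w = bethe_form adj \<rho> (U - {v}) w + (1 - \<rho>\<^sup>2) * (w v)\<^sup>2
    + (\<Sum>y\<in>nbrs adj U v. edge_cost \<rho> (w v) (w y))"
proof -
  let ?V = "U - {v}"
  let ?N = "nbrs adj U v"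
  have fV: "finite ?V" using assms by simp
  have N: "?N = {x \<in> ?V. adj x v}" using adj_sym adj_irrefl by (auto simp: nbrs_def)
  have one: "(1 - \<rho>\<^sup>2 + \<rho>\<^sup>2 * card (nbrs adj U x)) * (w x)\<^sup>2 - \<rho> * (\<Sum>y\<in>nbrs adj U x. w x * w y)
     = ((1 - \<rho>\<^sup>2 + \<rho>\<^sup>2 * card (nbrs adj ?V x)) * (w x)\<^sup>2 - \<rho> * (\<Sum>y\<in>nbrs adj ?V x. w x * w y))
       + (if adj x v then \<rho>\<^sup>2 * (w x)\<^sup>2 - \<rho> * w x * w v else 0)" if "x \<in> ?V" for x
  proof (cases "adj x v")
    case True
    then have "nbrs adj U x = insert v (nbrs adj ?V x)" "v \<notin> nbrs adj ?V x"
      using assms by (auto simp: nbrs_def)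
    then show ?thesis using True finite_nbrs[OF fV] by (simp add: algebra_simps)
  next
    case False
    then have "nbrs adj U x = nbrs adj ?V x" by (auto simp: nbrs_def)
    then show ?thesis using False by simp
  qed
  have "bethe_form adj \<rho> U w = ((1 - \<rho>\<^sup>2 + \<rho>\<^sup>2 * card ?N) * (w v)\<^sup>2 - \<rho> * (\<Sum>y\<in>?N. w v * w y))
     + (\<Sum>x\<in>?V. (1 - \<rho>\<^sup>2 + \<rho>\<^sup>2 * card (nbrs adj U x)) * (w x)\<^sup>2 - \<rho> * (\<Sum>y\<in>nbrs adj U x. w x * w y))"
    unfolding bethe_form_def by (rule sum.remove[OF assms])
  also have "(\<Sum>x\<in>?V. (1 - \<rho>\<^sup>2 + \<rho>\<^sup>2 * card (nbrs adj U x)) * (w x)\<^sup>2 - \<rho> * (\<Sum>y\<in>nbrs adj U x. w x * w y))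
     = bethe_form adj \<rho> ?V w + (\<Sum>x\<in>?V. if adj x v then \<rho>\<^sup>2 * (w x)\<^sup>2 - \<rho> * w x * w v else 0)"
    unfolding bethe_form_def sum.distrib[symmetric] by (intro sum.cong refl one)
  also have "(\<Sum>x\<in>?V. if adj x v then \<rho>\<^sup>2 * (w x)\<^sup>2 - \<rho> * w x * w v else 0)
     = (\<Sum>x\<in>?N. \<rho>\<^sup>2 * (w x)\<^sup>2 - \<rho> * w x * w v)"
    unfolding N by (rule sum.inter_filter[OF fV, symmetric])
  also have "((1 - \<rho>\<^sup>2 + \<rho>\<^sup>2 * card ?N) * (w v)\<^sup>2 - \<rho> * (\<Sum>y\<in>?N. w v * w y))
     = (1 - \<rho>\<^sup>2) * (w v)\<^sup>2 + (\<Sum>y\<in>?N. \<rho>\<^sup>2 * (w v)\<^sup>2 - \<rho> * (w v * w y))"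
    by (simp add: sum_subtractf sum_distrib_left algebra_simps)
  finally have "bethe_form adj \<rho> U w = bethe_form adj \<rho> ?V w + (1 - \<rho>\<^sup>2) * (w v)\<^sup>2
     + ((\<Sum>y\<in>?N. \<rho>\<^sup>2 * (w v)\<^sup>2 - \<rho> * (w v * w y)) + (\<Sum>x\<in>?N. \<rho>\<^sup>2 * (w x)\<^sup>2 - \<rho> * w x * w v))"
    by simp
  also have "(\<Sum>y\<in>?N. \<rho>\<^sup>2 * (w v)\<^sup>2 - \<rho> * (w v * w y)) + (\<Sum>x\<in>?N. \<rho>\<^sup>2 * (w x)\<^sup>2 - \<rho> * w x * w v)
     = (\<Sum>y\<in>?N. edge_cost \<rho> (w v) (w y))"
    unfolding sum.distrib[symmetric] edge_cost_def by (intro sum.cong refl) (simp add: algebra_simps)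
  finally show ?thesis .
qed

text \<open>The vertices \<open>p 1\<close>, ..., \<open>p j\<close> are deleted in order. The first
  takes two edges with it; each later one takes only the edge ahead, since the one behind is already
  gone.\<close>

lemma bethe_form_remove_path:
  assumes U: "finite U" and inj: "inj_on p {..Suc l}" and pU: "p ` {..Suc l} \<subseteq> U"
    and N: "\<And>t. t < l \<Longrightarrow> nbrs adj U (p (Suc t)) = {p t, p (Suc (Suc t))}"
    and j: "1 \<le> j" "j \<le> l"
  shows "bethe_form adj \<rho> U w = bethe_form adj \<rho> (U - p ` {1..j}) w
     + ((\<Sum>i<j. (1 - \<rho>\<^sup>2) * (w (p (Suc i)))\<^sup>2 + edge_cost \<rho> (w (p i)) (w (p (Suc i)))) + edge_cost \<rho> (w (p j)) (w (p (Suc j))))"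
  using j
proof (induction j rule: dec_induct)
  case base
  have p: "p 0 \<noteq> p 2" using inj_onD[OF inj, of 0 2] base by auto
  have "p 1 \<in> U" using pU base by auto
  from bethe_form_remove[OF U this, of \<rho> w] show ?case
    using N[of 0] base p by (simp add: numeral_2_eq_2 edge_cost_commute)
next
  case (step j)
  let ?V = "U - p ` {1..j}"
  have v: "p (Suc j) \<in> ?V" using pU step inj_onD[OF inj, of "Suc j"] by fastforce
  have "nbrs adj ?V (p (Suc j)) = nbrs adj U (p (Suc j)) - p ` {1..j}" by (auto simp: nbrs_def)
  also have "\<dots> = {p (Suc (Suc j))}"
  proof -
    have "p (Suc (Suc j)) \<notin> p ` {1..j}" using step inj_onD[OF inj, of "Suc (Suc j)"] by fastforce
    moreover have "p j \<in> p ` {1..j}" using step by auto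
    ultimately show ?thesis using N[of j] step by auto
  qed
  finally have n: "nbrs adj ?V (p (Suc j)) = {p (Suc (Suc j))}" .
  have e: "?V - {p (Suc j)} = U - p ` {1..Suc j}" by (auto simp: atLeastAtMostSuc_conv)
  have "bethe_form adj \<rho> ?V w = bethe_form adj \<rho> (U - p ` {1..Suc j}) w + (1 - \<rho>\<^sup>2) * (w (p (Suc j)))\<^sup>2
     + edge_cost \<rho> (w (p (Suc j))) (w (p (Suc (Suc j))))"
    using bethe_form_remove[OF _ v, of \<rho> w] U unfolding n e by simp
  then show ?case using step by simp
qed

lemma card_nbrs_ge2:
  assumes "finite U" "a \<in> U" "b \<in> U" "a \<noteq> b" "adj x a" "adj x b"
  shows "2 \<le> card (nbrs adj U x)"
proof -
  have "card {a, b} \<le> card (nbrs adj U x)"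
    using assms finite_nbrs by (intro card_mono) (auto simp: nbrs_def)
  then show ?thesis using assms by simp
qed

lemma nbwalk_rev:
  assumes "nbwalk adj xs"
  shows "nbwalk adj (rev xs)"
  unfolding nbwalk_def
proof (intro conjI allI impI)
  show "rev xs \<noteq> []" using assms by (simp add: nbwalk_def)
  fix i assume i: "Suc i < length (rev xs)"
  define j where "j = length xs - Suc (Suc i)"
  have "rev xs ! i = xs ! Suc j" "rev xs ! Suc i = xs ! j" "Suc j < length xs"
    using i by (auto simp: rev_nth j_def Suc_diff_Suc)
  then show "adj (rev xs ! i) (rev xs ! Suc i)" using assms adj_sym by (auto simp: nbwalk_def)
next
  fix i assume i: "Suc (Suc i) < length (rev xs)"
  define j where "j = length xs - Suc (Suc (Suc i))"
  have "rev xs ! i = xs ! Suc (Suc j)" "rev xs ! Suc (Suc i) = xs ! j" "Suc (Suc j) < length xs"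
    using i by (auto simp: rev_nth j_def Suc_diff_Suc)
  then show "rev xs ! i \<noteq> rev xs ! Suc (Suc i)" using assms by (auto simp: nbwalk_def)
qed

lemma nbwalk_slice:
  assumes "nbwalk adj xs" "i + n \<le> length xs" "0 < n"
  shows "nbwalk adj (take n (drop i xs))"
  using assms unfolding nbwalk_def by (auto simp: min_def)

lemma nbwalk_append:
  assumes p: "nbwalk adj p" and r: "nbwalk adj r" and e: "last p = hd r"
    and nb: "2 \<le> length p \<Longrightarrow> 2 \<le> length r \<Longrightarrow> p ! (length p - 2) \<noteq> r ! 1"
  shows "nbwalk adj (p @ tl r)"
proof -
  let ?l = "length p"
  have l: "?l > 0" "length r > 0" using p r by (auto simp: nbwalk_def)
  have c1: "(p @ tl r) ! i = p ! i" if "i < ?l" for i using that by (simp add: nth_append)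
  have c2: "(p @ tl r) ! i = r ! (Suc i - ?l)" if "?l \<le> Suc i" "i < ?l + length r - 1" for i
  proof (cases "i < ?l")
    case True
    then have "i = ?l - 1" using that by simp
    then show ?thesis using e l c1[OF True] by (simp add: last_conv_nth hd_conv_nth)
  next
    case False
    then show ?thesis using that by (simp add: nth_append nth_tl Suc_diff_le)
  qed
  have len: "length (p @ tl r) = ?l + length r - 1" using l by (cases r) auto
  show ?thesis
    unfolding nbwalk_def
  proof (intro conjI allI impI)
    show "p @ tl r \<noteq> []" using l by auto
    fix i assume i: "Suc i < length (p @ tl r)"
    show "adj ((p @ tl r) ! i) ((p @ tl r) ! Suc i)"
    proof (cases "Suc i < ?l")
      case True
      then show ?thesis using p c1[of i] c1[of "Suc i"] by (auto simp: nbwalk_def)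
    next
      case False
      then show ?thesis using r i c2[of i] c2[of "Suc i"] len l
        by (auto simp: nbwalk_def Suc_diff_le)
    qed
  next
    fix i assume i: "Suc (Suc i) < length (p @ tl r)"
    consider "Suc (Suc i) < ?l" | "Suc (Suc i) = ?l" | "?l \<le> Suc i" by linarith
    then show "(p @ tl r) ! i \<noteq> (p @ tl r) ! Suc (Suc i)"
    proof cases
      case 1
      then show ?thesis using p c1[of i] c1[of "Suc (Suc i)"] by (auto simp: nbwalk_def)
    next
      case 2
      then have "i = ?l - 2" by simp
      then show ?thesis using nb 2 i len c1[of i] c2[of "Suc (Suc i)"] by auto
    next
      case 3
      then show ?thesis using r i c2[of i] c2[of "Suc (Suc i)"] len l
        by (auto simp: nbwalk_def Suc_diff_le)
    qed
  qed
qed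

end

text \<open>In terms of edges, every small induced subgraph has fewer edges than vertices. Such a
  count is what the random model provides; absence of short cycles follows from it.\<close>

locale acyclic_graph = sgraph +
  fixes u0 :: nat
  assumes few_edges: "finite W \<Longrightarrow> W \<noteq> {} \<Longrightarrow> card W \<le> u0 \<Longrightarrow> (\<Sum>x\<in>W. card (nbrs adj W x)) < 2 * card W"
begin

text \<open>If the walk returns to its start along a different edge, every vertex on it has two
  neighbours on it, which is too many edges. Otherwise both end points can be cut off, and the
  shorter walk is again closed and non-backtracking. Backtracking at the closing point is thus
  allowed.\<close>

lemma no_closed_nbwalk:
  assumes "nbwalk adj xs" "2 \<le> length xs" "length xs \<le> u0" "hd xs = last xs"
  shows False
  using assms
proof (induction "length xs" arbitrary: xs rule: less_induct)
  case less
  let ?n = "length xs"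
  have adj: "adj (xs ! i) (xs ! Suc i)" if "Suc i < ?n" for i using less.prems(1) that by (auto simp: nbwalk_def)
  have nb: "xs ! i \<noteq> xs ! Suc (Suc i)" if "Suc (Suc i) < ?n" for i using less.prems(1) that by (auto simp: nbwalk_def)
  have ne: "xs \<noteq> []" using less.prems by auto
  have hl: "xs ! 0 = xs ! (?n - 1)" using less.prems(4) unfolding hd_conv_nth[OF ne] last_conv_nth[OF ne] .
  show False
  proof (cases "xs ! 1 = xs ! (?n - 2)")
    case False
    let ?W = "set xs"
    have "2 \<le> card (nbrs adj ?W x)" if x: "x \<in> ?W" for x
    proof -
      obtain i where i: "i < ?n" "x = xs ! i" using x by (auto simp: in_set_conv_nth)
      have mem: "xs ! j \<in> ?W" if "j < ?n" for j using that by simp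
      show ?thesis
      proof (cases "i = 0 \<or> i = ?n - 1")
        case True
        then have x: "x = xs ! 0" "x = xs ! (?n - 1)" using i hl by auto
        have "adj x (xs ! 1)" using adj[of 0] x less.prems(2) by auto
        moreover have "adj x (xs ! (?n - 2))"
        proof -
          have "Suc (?n - 2) = ?n - 1" using less.prems(2) by simp
          then show ?thesis using adj[of "?n - 2"] adj_sym x(2) less.prems(2) by auto
        qed
        ultimately show ?thesis
          using False less.prems(2) by (intro card_nbrs_ge2[of _ "xs ! 1" "xs ! (?n - 2)"] mem) auto
      next
        case False
        then obtain j where j: "i = Suc j" "Suc (Suc j) < ?n" using i by (cases i) auto
        show ?thesis
          using j i adj[of j] adj[of "Suc j"] adj_sym nb[of j]
          by (intro card_nbrs_ge2[of _ "xs ! j" "xs ! Suc (Suc j)"] mem) auto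
      qed
    qed
    then have "(\<Sum>x\<in>?W. 2) \<le> (\<Sum>x\<in>?W. card (nbrs adj ?W x))" by (intro sum_mono)
    moreover have "card ?W \<le> u0" using card_length[of xs] less.prems(3) by simp
    ultimately show False using few_edges[of ?W] ne by simp
  next
    case True
    have "?n \<noteq> 2" using adj[of 0] hl adj_irrefl by (auto simp: numeral_2_eq_2)
    moreover have "?n \<noteq> 3" using nb[of 0] hl by (auto simp: numeral_3_eq_3 numeral_2_eq_2)
    ultimately have n: "4 \<le> ?n" using less.prems(2) by simp
    let ?ys = "take (?n - 2) (drop 1 xs)"
    have nbw: "nbwalk adj ?ys" using n by (intro nbwalk_slice less.prems) auto
    have hdl: "hd ?ys = last ?ys"
    proof -
      have ys: "?ys \<noteq> []" using n by simp
      have "length ?ys - 1 = ?n - 3" using n by simp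
      then have "hd ?ys = ?ys ! 0" "last ?ys = ?ys ! (?n - 3)"
        using hd_conv_nth[OF ys] last_conv_nth[OF ys] by (simp_all only:)
      moreover have "?ys ! 0 = xs ! 1" "?ys ! (?n - 3) = xs ! (?n - 2)"
      proof -
        have "Suc (?n - 3) = ?n - 2" using n by simp
        then show "?ys ! 0 = xs ! 1" "?ys ! (?n - 3) = xs ! (?n - 2)" using n by auto
      qed
      ultimately show ?thesis using True by (simp only:)
    qed
    have "length ?ys < ?n" "2 \<le> length ?ys" "length ?ys \<le> u0" using n less.prems(3) by auto
    then show False by (rule less.hyps[OF _ nbw _ _ hdl])
  qed
qed

lemma nbwalk_distinct:
  assumes "nbwalk adj xs" "length xs \<le> u0"
  shows "distinct xs"
proof (rule ccontr)
  assume "\<not> distinct xs"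
  then obtain i j where ij: "i < j" "j < length xs" "xs ! i = xs ! j"
    by (metis distinct_conv_nth linorder_neqE_nat)
  let ?ys = "take (Suc (j - i)) (drop i xs)"
  have l: "length ?ys = Suc (j - i)" using ij by simp
  have nb: "nbwalk adj ?ys" using ij by (intro nbwalk_slice assms) auto
  have ys: "?ys \<noteq> []" using l by (metis Zero_not_Suc list.size(3))
  have "length ?ys - 1 = j - i" using l by simp
  then have "hd ?ys = ?ys ! 0" "last ?ys = ?ys ! (j - i)"
    using hd_conv_nth[OF ys] last_conv_nth[OF ys] by (simp_all only:)
  moreover have "?ys ! 0 = xs ! i" "?ys ! (j - i) = xs ! j" using ij by simp_all
  ultimately have hdl: "hd ?ys = last ?ys" using ij by (simp only:)
  have "2 \<le> length ?ys" "length ?ys \<le> u0" unfolding l using ij assms(2) by auto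
  then show False by (rule no_closed_nbwalk[OF nb _ _ hdl])
qed

text \<open>A common first or last step is cut off from both walks. If the last steps differ,
  following one walk by the reverse of the other does not backtrack in the middle and is
  closed.\<close>

lemma nbwalk_unique:
  assumes "nbwalk adj p" "nbwalk adj r" "hd p = hd r" "last p = last r" "length p + length r \<le> u0"
  shows "p = r"
  using assms
proof (induction "length p + length r" arbitrary: p r rule: less_induct)
  case less
  have ne: "p \<noteq> []" "r \<noteq> []" using less.prems by (auto simp: nbwalk_def)
  have short: "False" if "length a = 1" "2 \<le> length b" "nbwalk adj b" "hd a = hd b" "last a = last b" "length b \<le> u0"
    for a b :: "'a list"
    using that no_closed_nbwalk[of b] by (cases a) auto
  have lb: "last (butlast zs) = zs ! (length zs - 2)" if "2 \<le> length zs" for zs :: "'a list"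
  proof -
    have "butlast zs \<noteq> []" using that by (cases zs; cases "tl zs") auto
    then have "last (butlast zs) = butlast zs ! (length (butlast zs) - 1)" by (rule last_conv_nth)
    also have "\<dots> = zs ! (length (butlast zs) - 1)" using that by (intro nth_butlast) auto
    also have "length (butlast zs) - 1 = length zs - 2" by simp
    finally show ?thesis .
  qed
  consider "length p = 1" "length r = 1" | "length p = 1" "2 \<le> length r" | "2 \<le> length p" "length r = 1"
    | "2 \<le> length p" "2 \<le> length r"
    using ne by (metis One_nat_def Suc_1 Suc_leI length_greater_0_conv le_neq_implies_less)
  then show ?case
  proof cases
    case 1
    then show ?thesis using less.prems(3) by (cases p; cases r) auto
  next
    case 2
    then show ?thesis using short[of p r] less.prems by auto
  next
    case 3
    then show ?thesis using short[of r p] less.prems by auto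
  next
    case 4
    obtain x p' where p: "p = x # p'" "p' \<noteq> []" using 4 by (cases p; cases "tl p") auto
    obtain y r' where r: "r = y # r'" "r' \<noteq> []" using 4 by (cases r; cases "tl r") auto
    have xy: "x = y" using less.prems(3) p r by simp
    show ?thesis
    proof (cases "hd p' = hd r'")
      case True
      have "nbwalk adj p'" "nbwalk adj r'"
        using nbwalk_slice[OF less.prems(1), of 1 "length p'"] nbwalk_slice[OF less.prems(2), of 1 "length r'"] p r by auto
      then have "p' = r'"
        using less.prems p r True by (intro less.hyps) auto
      then show ?thesis using p r xy by simp
    next
      case hd: False
      show ?thesis
      proof (cases "p ! (length p - 2) = r ! (length r - 2)")
        case True
        have "nbwalk adj (butlast p)" "nbwalk adj (butlast r)"
          using nbwalk_slice[OF less.prems(1), of 0 "length p - 1"] nbwalk_slice[OF less.prems(2), of 0 "length r - 1"] 4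
          by (auto simp: butlast_conv_take)
        moreover have "last (butlast p) = p ! (length p - 2)" "last (butlast r) = r ! (length r - 2)"
          using lb 4 by auto
        moreover have "hd (butlast p) = hd p" "hd (butlast r) = hd r" using p r by auto
        ultimately have "butlast p = butlast r"
          using less.prems True 4 ne by (intro less.hyps) auto
        then show ?thesis using less.prems(4) ne by (metis append_butlast_last_id)
      next
        case False
        have rr: "rev r ! 1 = r ! (length r - 2)" using 4 by (simp add: rev_nth numeral_2_eq_2)
        let ?c = "p @ tl (rev r)"
        have nbw: "nbwalk adj ?c"
          using False rr less.prems ne by (intro nbwalk_append nbwalk_rev) (auto simp: hd_rev)
        have hdl: "hd ?c = last ?c"
        proof -
          have "tl (rev r) = rev (butlast r)" by (metis butlast_rev rev_rev_ident)
          moreover have "rev (butlast r) \<noteq> []" using r by auto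
          ultimately have "last ?c = hd r" using r by (simp add: last_rev)
          then show ?thesis using p less.prems(3) by simp
        qed
        have "2 \<le> length ?c" "length ?c \<le> u0" using 4 less.prems(5) by auto
        then have False by (rule no_closed_nbwalk[OF nbw _ _ hdl])
        then show ?thesis ..
      qed
    qed
  qed
qed

end

section \<open>Peeling a sparse graph\<close>

context acyclic_graph
begin

text \<open>The average degree is at most \<open>2 + 1 / (2 * l)\<close>, so vertices of degree at
  least 3 are rare. If every directed edge, followed forward, met one of them within
  \<open>l\<close> steps, tracing back from these few vertices would reach too few directed
  edges.\<close>

lemma long_path_exists:
  assumes U: "finite U" "U \<noteq> {}" and deg2: "\<And>x. x \<in> U \<Longrightarrow> 2 \<le> card (nbrs adj U x)"
    and sparse: "4 * l * (\<Sum>x\<in>U. card (nbrs adj U x)) \<le> (8 * l + 2) * card U"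
    and l: "1 \<le> l" "l + 2 \<le> u0"
  obtains p where "inj_on p {..Suc l}" "p ` {..Suc l} \<subseteq> U"
    "\<And>t. t < l \<Longrightarrow> nbrs adj U (p (Suc t)) = {p t, p (Suc (Suc t))}"
proof -
  let ?d = "\<lambda>x. card (nbrs adj U x)"
  define A where "A = (SIGMA x:U. nbrs adj U x)"
  define B where "B = (SIGMA x:{x \<in> U. ?d x \<noteq> 2}. nbrs adj U x)"
  \<comment> \<open>Continues a directed edge without backtracking. At a vertex of degree 2 there is
    no choice, so the step can be undone by reversing direction (\<open>rev_nxt\<close>).\<close>
  define nxt where "nxt d = (snd d, SOME z. z \<in> nbrs adj U (snd d) \<and> z \<noteq> fst d)" for d :: "'a \<times> 'a"
  have A_iff: "d \<in> A \<longleftrightarrow> fst d \<in> U \<and> snd d \<in> U \<and> adj (fst d) (snd d)" for d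
    by (cases d) (auto simp: A_def nbrs_def)
  have fN: "finite (nbrs adj U x)" for x using U finite_nbrs by blast
  have swapA: "prod.swap d \<in> A" if "d \<in> A" for d using that adj_sym by (auto simp: A_iff)
  have nxt: "snd (nxt d) \<in> nbrs adj U (snd d) \<and> snd (nxt d) \<noteq> fst d" if "d \<in> A" for d
  proof -
    have "\<exists>z. z \<in> nbrs adj U (snd d) \<and> z \<noteq> fst d"
    proof (rule ccontr)
      assume "\<not> ?thesis"
      then have "nbrs adj U (snd d) \<subseteq> {fst d}" by auto
      then have "?d (snd d) \<le> 1" using card_mono[of "{fst d}"] by fastforce
      then show False using deg2[of "snd d"] that by (auto simp: A_iff)
    qed
    from someI_ex[OF this] show ?thesis by (simp add: nxt_def)
  qed
  have nxtA: "nxt d \<in> A" if "d \<in> A" for d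
    using nxt[OF that] that by (auto simp: A_iff nbrs_def nxt_def)
  have iterA: "(nxt ^^ t) d \<in> A" if "d \<in> A" for d t using that by (induction t) (auto intro: nxtA)
  have two: "nbrs adj U (snd d) = {fst d, snd (nxt d)}" if "d \<in> A" "?d (snd d) = 2" for d
  proof -
    have "{fst d, snd (nxt d)} \<subseteq> nbrs adj U (snd d)"
      using nxt[OF that(1)] that(1) adj_sym by (auto simp: A_iff nbrs_def)
    moreover have "card {fst d, snd (nxt d)} = 2" using nxt[OF that(1)] by auto
    ultimately show ?thesis using card_subset_eq[OF fN, of "{fst d, snd (nxt d)}" "snd d"] that(2) by auto
  qed
  have rev_nxt: "nxt (prod.swap (nxt d)) = prod.swap d" if d: "d \<in> A" "?d (snd d) = 2" for d
  proof -
    have s: "prod.swap (nxt d) \<in> A" using nxtA swapA d by blast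
    have "snd (prod.swap (nxt d)) = snd d" by (simp add: nxt_def)
    then have "snd (nxt (prod.swap (nxt d))) \<in> {fst d, snd (nxt d)}" "snd (nxt (prod.swap (nxt d))) \<noteq> snd (nxt d)"
      using nxt[OF s] two[OF d] by auto
    then have "snd (nxt (prod.swap (nxt d))) = fst d" by auto
    moreover have "fst (nxt (prod.swap (nxt d))) = snd d" by (simp add: nxt_def)
    ultimately show ?thesis by (simp add: prod_eq_iff)
  qed
  have cardA: "card A = (\<Sum>x\<in>U. ?d x)" unfolding A_def using U fN by simp
  have "\<exists>d\<in>A. \<forall>t<l. ?d (snd ((nxt ^^ t) d)) = 2"
  proof (rule ccontr)
    assume neg: "\<not> ?thesis"
    \<comment> \<open>\<open>d\<close> is recovered from the number \<open>t\<close> of steps to the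
      first branching vertex and the reversed edge there, which belongs to \<open>B\<close>. Hence
      \<open>card A \<le> l * card B\<close>.\<close>
    have "A \<subseteq> (\<Union>t<l. (\<lambda>f. prod.swap ((nxt ^^ t) f)) ` B)"
    proof
      fix d assume d: "d \<in> A"
      define t where "t = (LEAST t. ?d (snd ((nxt ^^ t) d)) \<noteq> 2)"
      obtain t' where t': "t' < l" "?d (snd ((nxt ^^ t') d)) \<noteq> 2" using neg d by blast
      have tl: "t < l" using Least_le[of "\<lambda>t. ?d (snd ((nxt ^^ t) d)) \<noteq> 2", OF t'(2)] t'(1) by (simp add: t_def)
      have tn: "?d (snd ((nxt ^^ t) d)) \<noteq> 2" unfolding t_def by (rule LeastI, rule t'(2))
      have tb: "?d (snd ((nxt ^^ i) d)) = 2" if "i < t" for i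
        using not_less_Least[of i "\<lambda>t. ?d (snd ((nxt ^^ t) d)) \<noteq> 2"] that by (simp add: t_def)
      have "(nxt ^^ s) (prod.swap ((nxt ^^ t) d)) = prod.swap ((nxt ^^ (t - s)) d)" if "s \<le> t" for s
        using that
      proof (induction s)
        case (Suc s)
        define i where "i = t - Suc s"
        have i: "t - s = Suc i" "i < t" using Suc.prems by (auto simp: i_def)
        have "(nxt ^^ Suc s) (prod.swap ((nxt ^^ t) d)) = nxt (prod.swap (nxt ((nxt ^^ i) d)))"
          using Suc i by simp
        also have "\<dots> = prod.swap ((nxt ^^ i) d)"
          by (rule rev_nxt[OF iterA[OF d] tb[OF i(2)]])
        finally show ?case by (simp add: i_def)
      qed simp
      from this[of t] have "d = prod.swap ((nxt ^^ t) (prod.swap ((nxt ^^ t) d)))" by simp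
      moreover have "prod.swap ((nxt ^^ t) d) \<in> B"
        using swapA[OF iterA[OF d, of t]] tn by (cases "(nxt ^^ t) d") (auto simp: B_def A_def)
      ultimately show "d \<in> (\<Union>t<l. (\<lambda>f. prod.swap ((nxt ^^ t) f)) ` B)" using tl by blast
    qed
    moreover have fB: "finite B" unfolding B_def using U fN by auto
    ultimately have "card A \<le> card (\<Union>t<l. (\<lambda>f. prod.swap ((nxt ^^ t) f)) ` B)"
      by (intro card_mono) auto
    also have "\<dots> \<le> (\<Sum>t<l. card ((\<lambda>f. prod.swap ((nxt ^^ t) f)) ` B))" by (rule card_UN_le) simp
    also have "\<dots> \<le> (\<Sum>t<l. card B)" by (intro sum_mono card_image_le fB)
    finally have AB: "card A \<le> l * card B" by simp
    have "int (card B) = (\<Sum>x\<in>{x \<in> U. ?d x \<noteq> 2}. int (?d x))"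
      unfolding B_def using U fN by simp
    \<comment> \<open>Equality holds at degree 3; the right side charges the directed edges of
      \<open>B\<close> to the excess of the degree sum over \<open>2 * card U\<close>.\<close>
    also have "\<dots> \<le> (\<Sum>x\<in>{x \<in> U. ?d x \<noteq> 2}. 3 * (int (?d x) - 2))"
    proof (rule sum_mono)
      fix x assume "x \<in> {x \<in> U. ?d x \<noteq> 2}"
      then have "?d x \<ge> 3" using deg2[of x] by simp
      then show "int (?d x) \<le> 3 * (int (?d x) - 2)" by simp
    qed
    also have "\<dots> = (\<Sum>x\<in>U. 3 * (int (?d x) - 2))"
      using U by (intro sum.mono_neutral_left) auto
    also have "\<dots> = 3 * (int (card A) - 2 * int (card U))"
      unfolding cardA by (simp add: sum_subtractf sum_distrib_left[symmetric])
    finally have "int (card B) \<le> 3 * (int (card A) - 2 * int (card U))" .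
    then have "int l * int (card B) \<le> int l * (3 * (int (card A) - 2 * int (card U)))"
      by (intro mult_left_mono) auto
    moreover have "int (card A) \<le> int l * int (card B)" using AB by (metis of_nat_le_iff of_nat_mult)
    ultimately have "4 * int (card A) \<le> 12 * (int l * int (card A)) - 24 * (int l * int (card U))"
      by (simp add: algebra_simps)
    moreover have "4 * (int l * int (card A)) \<le> 8 * (int l * int (card U)) + 2 * int (card U)"
    proof -
      have "int (4 * l * card A) \<le> int ((8 * l + 2) * card U)" using sparse unfolding cardA by (rule of_nat_mono)
      then show ?thesis by (simp add: algebra_simps)
    qed
    \<comment> \<open>Average degree at most 3/2 contradicts minimum degree 2.\<close>
    ultimately have "4 * int (card A) \<le> 6 * int (card U)" by linarith
    moreover have "2 * card U \<le> card A"
      unfolding cardA using sum_mono[of U "\<lambda>_. 2" ?d] deg2 by simp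
    moreover have "card U > 0" using U by (simp add: card_gt_0_iff)
    ultimately show False by linarith
  qed
  then obtain d where d: "d \<in> A" and dt: "\<And>t. t < l \<Longrightarrow> ?d (snd ((nxt ^^ t) d)) = 2" by blast
  define p where "p t = fst ((nxt ^^ t) d)" for t
  have p1: "snd ((nxt ^^ t) d) = p (Suc t)" for t by (simp add: p_def nxt_def)
  have pU: "p t \<in> U" and padj: "adj (p t) (p (Suc t))" for t
    using iterA[OF d, of t] unfolding A_iff p1[symmetric] by (simp_all add: p_def)
  have pnb: "p (Suc (Suc t)) \<noteq> p t" for t
    using nxt[OF iterA[OF d, of t]] p1[of "Suc t"] by (simp add: p_def)
  have pN: "nbrs adj U (p (Suc t)) = {p t, p (Suc (Suc t))}" if "t < l" for t
  proof -
    have "snd (nxt ((nxt ^^ t) d)) = p (Suc (Suc t))" "fst ((nxt ^^ t) d) = p t"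
      using p1[of "Suc t"] by (simp_all add: p_def)
    then show ?thesis using two[OF iterA[OF d] dt[OF that]] unfolding p1 by (simp only:)
  qed
  let ?xs = "map p [0..<Suc (Suc l)]"
  have "nbwalk adj ?xs"
    unfolding nbwalk_def using padj pnb by (auto simp: nth_append simp del: upt_Suc) (metis pnb)
  then have "distinct ?xs" using l by (intro nbwalk_distinct) auto
  then have "inj_on p {0..<Suc (Suc l)}" by (simp only: distinct_map set_upt)
  moreover have "{0..<Suc (Suc l)} = {..Suc l}" by auto
  ultimately have "inj_on p {..Suc l}" by simp
  then show ?thesis using pU pN by (intro that[of p]) auto
qed

text \<open>The number \<open>s\<close> dominates all entries and at the same time measures the
  form. It grows by the squares that each deletion releases. Deleting a path incurs a debt
  proportional to the entries at its end points, which remain in the graph and are therefore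
  controlled by the previous \<open>s\<close>. Each deletion costs at most
  \<open>\<theta> * s\<close>, and there are at most \<open>card U\<close> of them.\<close>

lemma bethe_form_lower_bound:
  fixes \<rho> \<theta> :: real
  assumes r: "0 < \<rho>" "\<rho> < 1" and h: "1 \<le> h" "2 * h + 2 \<le> u0"
    and sparse: "\<And>W. finite W \<Longrightarrow> card W \<le> N \<Longrightarrow>
      4 * (2 * h) * (\<Sum>x\<in>W. card (nbrs adj W x)) \<le> (8 * (2 * h) + 2) * card W"
    and \<theta>: "\<theta> = 2 * \<rho> ^ (2 * h) / (1 - \<rho>\<^sup>2)"
    and U: "finite U" "card U \<le> N"
  shows "\<exists>s\<ge>0. (\<forall>v\<in>U. (1 - \<rho>\<^sup>2) * (w v)\<^sup>2 \<le> s) \<and> (1 / 4 - \<theta> * card U) * s \<le> bethe_form adj \<rho> U w"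
  using U
proof (induction "card U" arbitrary: U rule: less_induct)
  case less
  have r2: "\<rho>\<^sup>2 < 1" using r by (simp add: power_less_one_iff)
  have \<theta>0: "\<theta> \<ge> 0" unfolding \<theta> using r r2 by simp
  \<comment> \<open>Adding \<open>t\<close> to the measure while \<open>d\<close> new vertices pay
    the debt \<open>\<theta> * d * s\<close>: \<open>d\<close> is 0 for a vertex of degree at most
    one and 1 for a path.\<close>
  have weaken: "(1 / 4 - \<theta> * c) * s + t / 4 - \<theta> * d * s \<ge> (1 / 4 - \<theta> * c') * (s + t)"
    if "s \<ge> 0" "t \<ge> 0" "c + d \<le> c'" "0 \<le> c'" for s t c c' d :: real
  proof -
    have "\<theta> * ((c + d) * s) \<le> \<theta> * (c' * s)" "0 \<le> \<theta> * (c' * t)"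
      using that \<theta>0 by (auto intro!: mult_left_mono mult_right_mono mult_nonneg_nonneg)
    then show ?thesis by (simp add: algebra_simps add_divide_distrib)
  qed
  show ?case
  proof (cases "U = {}")
    case True
    then show ?thesis by (intro exI[of _ 0]) (simp add: bethe_form_def)
  next
    case ne: False
    show ?thesis
    proof (cases "\<exists>v\<in>U. card (nbrs adj U v) \<le> 1")
      case True
      then obtain v where v: "v \<in> U" "card (nbrs adj U v) \<le> 1" by blast
      let ?V = "U - {v}"
      have cV: "card ?V < card U" "real (card ?V) + 1 = real (card U)"
        using v less.prems card_Suc_Diff1[of U v] by (auto simp: card_Diff1_less simp flip: of_nat_Suc)
      obtain s where s: "s \<ge> 0" "\<And>u. u \<in> ?V \<Longrightarrow> (1 - \<rho>\<^sup>2) * (w u)\<^sup>2 \<le> s"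
        "(1 / 4 - \<theta> * card ?V) * s \<le> bethe_form adj \<rho> ?V w"
        using less.hyps[OF cV(1)] less.prems cV(1) by auto
      have rem: "bethe_form adj \<rho> U w = bethe_form adj \<rho> ?V w + (1 - \<rho>\<^sup>2) * (w v)\<^sup>2
          + (\<Sum>y\<in>nbrs adj U v. edge_cost \<rho> (w v) (w y))"
        by (rule bethe_form_remove[OF less.prems(1) v(1)])
      \<comment> \<open>\<open>t\<close> is the vertex term if \<open>v\<close> is isolated, and
        otherwise the full square along its only edge; in both cases the deletion is exact.\<close>
      obtain t where t: "t \<ge> 0" "bethe_form adj \<rho> U w = bethe_form adj \<rho> ?V w + t" "(1 - \<rho>\<^sup>2) * (w v)\<^sup>2 \<le> s + t"
      proof (cases "nbrs adj U v = {}")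
        case True
        then show ?thesis using that[of "(1 - \<rho>\<^sup>2) * (w v)\<^sup>2"] rem r2 s(1) by simp
      next
        case False
        then have "card (nbrs adj U v) = 1"
          using v(2) finite_nbrs[OF less.prems(1), of v] by (simp add: le_Suc_eq card_eq_0_iff)
        then obtain y where y: "nbrs adj U v = {y}" by (auto simp: card_1_singleton_iff)
        then have yV: "y \<in> ?V" using adj_irrefl by (auto simp: nbrs_def)
        have "(1 - \<rho>\<^sup>2) * (w v)\<^sup>2 \<le> (1 - \<rho>\<^sup>2) * (w y)\<^sup>2 + (w v - \<rho> * w y)\<^sup>2"
          using chain_bound[OF r2, of "\<lambda>i. if i = 0 then w y else w v" 1] by simp
        moreover have "(1 - \<rho>\<^sup>2) * (w v)\<^sup>2 + edge_cost \<rho> (w v) (w y) = (w v - \<rho> * w y)\<^sup>2"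
          by (simp add: edge_cost_def power2_eq_square algebra_simps)
        ultimately show ?thesis
          using s(2)[OF yV] rem unfolding y by (intro that[of "(w v - \<rho> * w y)\<^sup>2"]) auto
      qed
      show ?thesis
      proof (intro exI[of _ "s + t"] conjI ballI)
        show "0 \<le> s + t" using s t by simp
        show "(1 - \<rho>\<^sup>2) * (w u)\<^sup>2 \<le> s + t" if "u \<in> U" for u
          using s(2)[of u] t that by (cases "u = v") auto
        show "(1 / 4 - \<theta> * card U) * (s + t) \<le> bethe_form adj \<rho> U w"
          using weaken[OF s(1) t(1), of "card ?V" 0 "card U"] cV s(3) t(1,2) by simp
      qed
    next
      case False
      then have deg2: "2 \<le> card (nbrs adj U x)" if "x \<in> U" for x using that by force
      let ?l = "2 * h"
      obtain p where p: "inj_on p {..Suc ?l}" "p ` {..Suc ?l} \<subseteq> U"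
        "\<And>t. t < ?l \<Longrightarrow> nbrs adj U (p (Suc t)) = {p t, p (Suc (Suc t))}"
        using long_path_exists[OF less.prems(1) ne deg2 sparse[OF less.prems]] h by auto
      let ?P = "p ` {1..?l}"
      let ?V = "U - ?P"
      have "p 1 \<in> ?P" using h by auto
      moreover have "?P \<subseteq> U" using p(2) by auto
      ultimately have "?V \<subset> U" by blast
      then have cV: "card ?V < card U"
        using less.prems(1) by (intro psubset_card_mono)
      obtain s where s: "s \<ge> 0" "\<And>u. u \<in> ?V \<Longrightarrow> (1 - \<rho>\<^sup>2) * (w u)\<^sup>2 \<le> s"
        "(1 / 4 - \<theta> * card ?V) * s \<le> bethe_form adj \<rho> ?V w"
        using less.hyps[OF cV] less.prems cV by auto
      obtain \<sigma> where \<sigma>: "\<sigma> \<ge> 0"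
        "(\<Sum>i<?l. (1 - \<rho>\<^sup>2) * (w (p (Suc i)))\<^sup>2 + edge_cost \<rho> (w (p i)) (w (p (Suc i)))) + edge_cost \<rho> (w (p ?l)) (w (p (Suc ?l)))
          \<ge> \<sigma> / 4 - \<rho> ^ ?l * ((w (p 0))\<^sup>2 + (w (p (Suc ?l)))\<^sup>2)"
        "\<And>i. i \<le> Suc ?l \<Longrightarrow> (1 - \<rho>\<^sup>2) * (w (p i))\<^sup>2 \<le> (1 - \<rho>\<^sup>2) * max ((w (p 0))\<^sup>2) ((w (p (Suc ?l)))\<^sup>2) + \<sigma>"
        using path_energy[OF r, of h "\<lambda>i. w (p i)"] by blast
      have rem: "bethe_form adj \<rho> U w = bethe_form adj \<rho> ?V w
         + ((\<Sum>i<?l. (1 - \<rho>\<^sup>2) * (w (p (Suc i)))\<^sup>2 + edge_cost \<rho> (w (p i)) (w (p (Suc i)))) + edge_cost \<rho> (w (p ?l)) (w (p (Suc ?l))))"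
        using h by (intro bethe_form_remove_path[OF less.prems(1) p]) auto
      have "p 0 \<notin> ?P" "p (Suc ?l) \<notin> ?P"
        using inj_onD[OF p(1), of 0] inj_onD[OF p(1), of "Suc ?l"] by fastforce+
      then have ends: "p 0 \<in> ?V" "p (Suc ?l) \<in> ?V" using p(2) by auto
      \<comment> \<open>Both end points survive the deletion, so the induction hypothesis bounds
        their entries; this is the origin of the factor 2 in \<open>\<theta>\<close>.\<close>
      have "(w (p 0))\<^sup>2 + (w (p (Suc ?l)))\<^sup>2 \<le> 2 * s / (1 - \<rho>\<^sup>2)"
        using s(2)[OF ends(1)] s(2)[OF ends(2)] r2 by (simp add: field_simps)
      then have "\<rho> ^ ?l * ((w (p 0))\<^sup>2 + (w (p (Suc ?l)))\<^sup>2) \<le> \<rho> ^ ?l * (2 * s / (1 - \<rho>\<^sup>2))"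
        using r by (intro mult_left_mono) auto
      also have "\<dots> = \<theta> * s" by (simp add: \<theta>)
      finally have bf: "(1 / 4 - \<theta> * card ?V) * s + \<sigma> / 4 - \<theta> * s \<le> bethe_form adj \<rho> U w"
        using s(3) \<sigma>(2) rem by linarith
      show ?thesis
      proof (intro exI[of _ "s + \<sigma>"] conjI ballI)
        show "0 \<le> s + \<sigma>" using s \<sigma> by simp
        show "(1 / 4 - \<theta> * card U) * (s + \<sigma>) \<le> bethe_form adj \<rho> U w"
          using weaken[OF s(1) \<sigma>(1), of "card ?V" 1 "card U"] cV bf by simp
        fix u assume u: "u \<in> U"
        show "(1 - \<rho>\<^sup>2) * (w u)\<^sup>2 \<le> s + \<sigma>"
        proof (cases "u \<in> ?P")
          case True
          then obtain i where i: "i \<in> {1..?l}" "u = p i" by blast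
          then have i: "i \<le> Suc ?l" "u = p i" by auto
          have "(1 - \<rho>\<^sup>2) * max ((w (p 0))\<^sup>2) ((w (p (Suc ?l)))\<^sup>2) \<le> s"
            using s(2)[OF ends(1)] s(2)[OF ends(2)] by (simp add: max_def)
          then show ?thesis using \<sigma>(3)[OF i(1)] i(2) by simp
        next
          case False
          then show ?thesis using s(2)[of u] u \<sigma>(1) by auto
        qed
      qed
    qed
  qed
qed

end

section \<open>The walk kernel\<close>

definition nbdist :: "('v \<Rightarrow> 'v \<Rightarrow> bool) \<Rightarrow> nat \<Rightarrow> 'v \<Rightarrow> 'v \<Rightarrow> bool" where
  "nbdist adj t x y \<longleftrightarrow> (\<exists>xs. nbwalk adj xs \<and> hd xs = x \<and> last xs = y \<and> length xs = Suc t)"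

text \<open>The sum avoids speaking of distances: when short walks are unique, at most one term is
  nonzero.\<close>

definition walk_kernel :: "('v \<Rightarrow> 'v \<Rightarrow> bool) \<Rightarrow> real \<Rightarrow> nat \<Rightarrow> 'v \<Rightarrow> 'v \<Rightarrow> real" where
  "walk_kernel adj \<rho> L x y = (\<Sum>t\<le>L. if nbdist adj t x y then \<rho> ^ t else 0)"

text \<open>The inverse relation at a vertex at distance up to \<open>L + 1\<close> looks at its
  neighbours at distance up to \<open>L + 2\<close>, whose walks have \<open>L + 3\<close>
  vertices.\<close>

locale unique_walks = sgraph +
  fixes L :: nat
  assumes uniq: "nbwalk adj p \<Longrightarrow> nbwalk adj r \<Longrightarrow> hd p = hd r \<Longrightarrow> last p = last r \<Longrightarrow>
    length p \<le> L + 3 \<Longrightarrow> length r \<le> L + 3 \<Longrightarrow> p = r"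
begin

lemma nbdist_0: "nbdist adj 0 x y \<longleftrightarrow> x = y"
proof
  assume "nbdist adj 0 x y"
  then obtain xs where "hd xs = x" "last xs = y" "length xs = Suc 0" by (auto simp: nbdist_def)
  then show "x = y" by (cases xs) auto
next
  assume "x = y"
  then show "nbdist adj 0 x y" unfolding nbdist_def by (intro exI[of _ "[x]"]) (auto simp: nbwalk_def)
qed

lemma nbdist_sym: "nbdist adj t x y \<Longrightarrow> nbdist adj t y x"
  unfolding nbdist_def by (metis nbwalk_rev hd_rev last_rev length_rev)

lemma nbdist_unique:
  assumes "nbdist adj s x y" "nbdist adj t x y" "s \<le> L + 2" "t \<le> L + 2"
  shows "s = t"
proof -
  obtain p r where p: "nbwalk adj p" "hd p = x" "last p = y" "length p = Suc s"
    and r: "nbwalk adj r" "hd r = x" "last r = y" "length r = Suc t"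
    using assms(1,2) unfolding nbdist_def by blast
  have "p = r" by (rule uniq) (use p r assms in auto)
  then show ?thesis using p r by simp
qed

lemma walk_kernel_eq:
  assumes "nbdist adj t x y" "t \<le> L + 2"
  shows "walk_kernel adj \<rho> L x y = (if t \<le> L then \<rho> ^ t else 0)"
proof -
  have "walk_kernel adj \<rho> L x y = (\<Sum>s\<le>L. if s = t then \<rho> ^ t else 0)"
    unfolding walk_kernel_def
  proof (intro sum.cong refl)
    fix s assume "s \<in> {..L}"
    then have "nbdist adj s x y \<longleftrightarrow> s = t"
      using nbdist_unique[OF _ assms(1), of s] assms by (metis atMost_iff trans_le_add1)
    then show "(if nbdist adj s x y then \<rho> ^ s else 0) = (if s = t then \<rho> ^ t else 0)" by simp
  qed
  then show ?thesis by simp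
qed

lemma walk_kernel_0: "(\<And>t. t \<le> L \<Longrightarrow> \<not> nbdist adj t x y) \<Longrightarrow> walk_kernel adj \<rho> L x y = 0"
  unfolding walk_kernel_def by simp

lemma walk_kernel_sym: "walk_kernel adj \<rho> L x y = walk_kernel adj \<rho> L y x"
proof -
  have "nbdist adj t x y \<longleftrightarrow> nbdist adj t y x" for t using nbdist_sym by blast
  then show ?thesis unfolding walk_kernel_def by (simp only:)
qed

lemma walk_kernel_refl: "walk_kernel adj \<rho> L x x = 1"
  using walk_kernel_eq[of 0 x x] nbdist_0 by simp

lemma nbdist_extend:
  assumes "nbwalk adj xs" "adj (last xs) z" "\<And>s. length xs = Suc (Suc s) \<Longrightarrow> xs ! s \<noteq> z"
  shows "nbdist adj (length xs) (hd xs) z"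
proof -
  have ne: "xs \<noteq> []" using assms by (auto simp: nbwalk_def)
  have "nbwalk adj [last xs, z]" using assms by (auto simp: nbwalk_def)
  moreover have "xs ! (length xs - 2) \<noteq> z" if "2 \<le> length xs"
    using assms(3)[of "length xs - 2"] that by simp
  ultimately have "nbwalk adj (xs @ tl [last xs, z])"
    using assms(1) by (intro nbwalk_append) auto
  then show ?thesis unfolding nbdist_def using ne by (intro exI[of _ "xs @ [z]"]) auto
qed

lemma nbdist_penultimate:
  assumes "nbwalk adj xs" "length xs = Suc (Suc s)"
  shows "nbdist adj s (hd xs) (xs ! s)" "adj (last xs) (xs ! s)"
proof -
  have "nbwalk adj (take (Suc s) (drop 0 xs))" using assms by (intro nbwalk_slice) auto
  moreover have "last (take (Suc s) xs) = xs ! s" using assms by (simp add: take_Suc_conv_app_nth)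
  moreover have "hd (take (Suc s) xs) = hd xs" using assms by (simp add: hd_take)
  ultimately show "nbdist adj s (hd xs) (xs ! s)"
    unfolding nbdist_def using assms by (intro exI[of _ "take (Suc s) xs"]) auto
  have "last xs = xs ! Suc s" using assms by (subst last_conv_nth) auto
  then show "adj (last xs) (xs ! s)" using assms adj_sym by (auto simp: nbwalk_def)
qed

text \<open>
  On a tree, \<open>\<rho>\<^sup>d\<close> (\<open>d\<close> the distance) is \<open>(1 - \<rho>\<^sup>2)\<close> times the inverse of
  \<open>(1 - \<rho>\<^sup>2) I + \<rho>\<^sup>2 D - \<rho> A\<close>; cutting the kernel off at distance \<open>L\<close> costs an error of
  order \<open>\<rho>\<^sup>L\<close>.
\<close>

lemma walk_kernel_bethe:
  fixes \<rho> :: real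
  assumes Y: "finite Y" "y \<in> Y" "\<And>a b. adj a b \<Longrightarrow> a \<in> Y \<and> b \<in> Y" and L: "1 \<le> L" and r: "0 < \<rho>" "\<rho> < 1"
  shows "\<bar>(1 - \<rho>\<^sup>2 + \<rho>\<^sup>2 * card (nbrs adj Y y)) * walk_kernel adj \<rho> L x y
     - \<rho> * (\<Sum>z\<in>nbrs adj Y y. walk_kernel adj \<rho> L x z) - (1 - \<rho>\<^sup>2) * of_bool (x = y)\<bar> \<le> \<rho> ^ (L + 1) * card Y"
proof -
  let ?N = "nbrs adj Y y" and ?k = "walk_kernel adj \<rho> L"
  have fN: "finite ?N" using Y finite_nbrs by blast
  have Niff: "z \<in> ?N \<longleftrightarrow> adj y z" for z using Y by (auto simp: nbrs_def)
  have e0: "0 \<le> \<rho> ^ (L + 1) * card Y" using r by simp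
  have cN: "card ?N \<le> card Y" using Y by (intro card_mono) (auto simp: nbrs_def)
  show ?thesis
  proof (cases "\<exists>t\<le>L + 1. nbdist adj t x y")
    case False
    then have "x \<noteq> y" using nbdist_0[of x y] by auto
    moreover have "?k x y = 0" using False by (intro walk_kernel_0) auto
    \<comment> \<open>A short walk to the neighbour \<open>z\<close> either passes \<open>y\<close>
      just before its end or can be extended to \<open>y\<close>; both place \<open>y\<close> within
      distance \<open>L + 1\<close>.\<close>
    moreover have "?k x z = 0" if "z \<in> ?N" for z
    proof (rule walk_kernel_0)
      fix s assume s: "s \<le> L"
      show "\<not> nbdist adj s x z"
      proof
        assume "nbdist adj s x z"
        then obtain xs where xs: "nbwalk adj xs" "hd xs = x" "last xs = z" "length xs = Suc s"
          by (auto simp: nbdist_def)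
        have zy: "adj (last xs) y" using that adj_sym xs by (auto simp: Niff)
        show False
        proof (cases "\<exists>s'. length xs = Suc (Suc s') \<and> xs ! s' = y")
          case True
          then obtain s' where s': "length xs = Suc (Suc s')" "xs ! s' = y" by blast
          then have "nbdist adj s' x y" using nbdist_penultimate(1)[OF xs(1) s'(1)] xs(2) by simp
          moreover have "s' \<le> L + 1" using s' xs s by simp
          ultimately show False using False by blast
        next
          case n: False
          then have "nbdist adj (Suc s) x y" using nbdist_extend[OF xs(1) zy] xs by auto
          moreover have "Suc s \<le> L + 1" using s by simp
          ultimately show False using False by blast
        qed
      qed
    qed
    ultimately show ?thesis using e0 by simp
  next
    case True
    then obtain t where t: "t \<le> L + 1" "nbdist adj t x y" by blast
    then obtain xs where xs: "nbwalk adj xs" "hd xs = x" "last xs = y" "length xs = Suc t"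
      by (auto simp: nbdist_def)
    show ?thesis
    proof (cases t)
      case 0
      then have xy: "x = y" using t nbdist_0 by simp
      have "?k x z = \<rho>" if "z \<in> ?N" for z
      proof -
        have "nbdist adj (Suc 0) x z" using nbdist_extend[OF xs(1), of z] xs 0 that by (auto simp: Niff)
        then show ?thesis using walk_kernel_eq[of "Suc 0"] L by simp
      qed
      then have "(\<Sum>z\<in>?N. ?k x z) = card ?N * \<rho>" by simp
      then show ?thesis using xy walk_kernel_refl[of \<rho> x] e0 by (simp add: power2_eq_square algebra_simps)
    next
      case (Suc s)
      have "x \<noteq> y"
      proof
        assume "x = y"
        then have "nbdist adj 0 x y" using nbdist_0 by simp
        then show False using nbdist_unique[OF t(2), of 0] t Suc by simp
      qed
      let ?z = "xs ! s"
      have z: "nbdist adj s x ?z" "?z \<in> ?N"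
        using nbdist_penultimate[OF xs(1), of s] xs Suc by (auto simp: Niff)
      have kz: "?k x ?z = \<rho> ^ s" using walk_kernel_eq[OF z(1)] t Suc by simp
      have ko: "?k x z' = (if t < L then \<rho> ^ Suc t else 0)" if "z' \<in> ?N - {?z}" for z'
      proof -
        have "nbdist adj (Suc t) x z'"
          using nbdist_extend[OF xs(1), of z'] xs Suc that by (auto simp: Niff)
        then show ?thesis using walk_kernel_eq[of "Suc t" x z'] t by (simp add: Suc_le_eq)
      qed
      have c: "card ?N = Suc (card (?N - {?z}))" using card_Suc_Diff1[OF fN z(2)] by (rule sym)
      have S: "(\<Sum>z\<in>?N. ?k x z) = \<rho> ^ s + card (?N - {?z}) * (if t < L then \<rho> ^ Suc t else 0)"
        using z fN kz ko by (simp add: sum.remove)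
      have ky: "?k x y = (if t \<le> L then \<rho> ^ t else 0)" using walk_kernel_eq[OF t(2)] t by simp
      \<comment> \<open>Below the cutoff one neighbour is closer and all others are farther, and the
        terms cancel exactly. At distance \<open>L\<close> the farther neighbours have been cut off;
        at \<open>L + 1\<close> only the closer one still counts.\<close>
      consider "t < L" | "t = L" | "t = L + 1" using t by linarith
      then show ?thesis
      proof cases
        case 1
        then show ?thesis using S ky c Suc \<open>x \<noteq> y\<close> e0 by (simp add: power2_eq_square algebra_simps)
      next
        case 2
        then have "\<rho> ^ L = \<rho> * \<rho> ^ s" using Suc by (metis power_Suc)
        then have "(1 - \<rho>\<^sup>2 + \<rho>\<^sup>2 * card ?N) * ?k x y - \<rho> * (\<Sum>z\<in>?N. ?k x z) - (1 - \<rho>\<^sup>2) * of_bool (x = y)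
           = \<rho> ^ (L + 2) * card (?N - {?z})"
          using 2 S ky c Suc \<open>x \<noteq> y\<close> by (simp add: power2_eq_square algebra_simps)
        also have "\<bar>\<dots>\<bar> \<le> \<rho> ^ (L + 1) * card Y"
        proof -
          have "\<rho> ^ (L + 2) \<le> \<rho> ^ (L + 1)" using r by (intro power_decreasing) auto
          moreover have "real (card (?N - {?z})) \<le> card Y" using c cN by simp
          ultimately show ?thesis using r by (simp add: abs_mult mult_mono)
        qed
        finally show ?thesis .
      next
        case 3
        have "card Y \<ge> 1" using c cN by simp
        have "(1 - \<rho>\<^sup>2 + \<rho>\<^sup>2 * card ?N) * ?k x y - \<rho> * (\<Sum>z\<in>?N. ?k x z) - (1 - \<rho>\<^sup>2) * of_bool (x = y)
           = - (\<rho> ^ (L + 1) * 1)"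
          using 3 S ky Suc \<open>x \<noteq> y\<close> by simp
        also have "\<bar>\<dots>\<bar> \<le> \<rho> ^ (L + 1) * card Y"
          unfolding abs_minus_cancel using r \<open>card Y \<ge> 1\<close> by (simp add: abs_mult)
        finally show ?thesis .
      qed
    qed
  qed
qed

end

section \<open>Restrictions and cyclic lifts\<close>

definition restrict_adj :: "('v \<Rightarrow> 'v \<Rightarrow> bool) \<Rightarrow> 'v set \<Rightarrow> 'v \<Rightarrow> 'v \<Rightarrow> bool" where
  "restrict_adj adj Y x y \<longleftrightarrow> adj x y \<and> x \<in> Y \<and> y \<in> Y"

lemma nbwalk_restrict_adj: "nbwalk (restrict_adj adj Y) xs \<Longrightarrow> nbwalk adj xs"
  unfolding nbwalk_def restrict_adj_def by blast

lemma nbwalk_restrict_adjI: "nbwalk adj xs \<Longrightarrow> set xs \<subseteq> Y \<Longrightarrow> nbwalk (restrict_adj adj Y) xs"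
  unfolding nbwalk_def restrict_adj_def by (meson Suc_lessD nth_mem subsetD)

lemma walk_kernel_restrict_adj:
  assumes "\<And>xs. nbwalk adj xs \<Longrightarrow> hd xs = x \<Longrightarrow> last xs = y \<Longrightarrow> length xs \<le> L + 1 \<Longrightarrow> set xs \<subseteq> Y"
  shows "walk_kernel (restrict_adj adj Y) \<rho> L x y = walk_kernel adj \<rho> L x y"
proof -
  have "nbdist (restrict_adj adj Y) t x y \<longleftrightarrow> nbdist adj t x y" if "t \<le> L" for t
    unfolding nbdist_def
  proof (intro ex_cong1 iffI; elim conjE; intro conjI)
    fix xs assume xs: "nbwalk adj xs" "hd xs = x" "last xs = y" "length xs = Suc t"
    then show "nbwalk (restrict_adj adj Y) xs" using assms[of xs] that by (intro nbwalk_restrict_adjI) auto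
  qed (auto intro: nbwalk_restrict_adj)
  then show ?thesis unfolding walk_kernel_def by (intro sum.cong) auto
qed

lemma (in sgraph) sgraph_restrict: "sgraph (restrict_adj adj Y)"
  by standard (auto simp: restrict_adj_def adj_sym adj_irrefl)

lemma (in unique_walks) unique_walks_restrict: "unique_walks (restrict_adj adj Y) L"
proof -
  interpret R: sgraph "restrict_adj adj Y" by (rule sgraph_restrict)
  show ?thesis by standard (auto intro: uniq nbwalk_restrict_adj)
qed

text \<open>The cyclic \<open>q\<close>-fold cover of a graph with voltages \<open>s\<close>. Its
  fibre over a variable is the set of values of that variable.\<close>

definition lift_adj :: "nat \<Rightarrow> ('v \<Rightarrow> 'v \<Rightarrow> nat) \<Rightarrow> ('v \<Rightarrow> 'v \<Rightarrow> bool) \<Rightarrow> 'v \<times> nat \<Rightarrow> 'v \<times> nat \<Rightarrow> bool" where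
  "lift_adj q s adj x y \<longleftrightarrow> adj (fst x) (fst y) \<and> snd x < q \<and> snd y < q \<and> snd y = (snd x + s (fst x) (fst y)) mod q"

locale shift_graph = sgraph +
  fixes q :: nat and s :: "'a \<Rightarrow> 'a \<Rightarrow> nat"
  assumes q: "q > 0" and shift: "adj x y \<Longrightarrow> (s x y + s y x) mod q = 0"
begin

abbreviation "ladj \<equiv> lift_adj q s adj"

lemma shift_back:
  assumes "adj x y" "i < q"
  shows "((i + s x y) mod q + s y x) mod q = i"
proof -
  have "((i + s x y) mod q + s y x) mod q = (i + (s x y + s y x) mod q) mod q" by (simp add: mod_simps add_ac)
  then show ?thesis using shift[OF assms(1)] assms(2) by simp
qed

lemma sgraph_lift: "sgraph ladj"
proof
  show "ladj y x" if "ladj x y" for x y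
    using that shift_back[of "fst x" "fst y" "snd x"] adj_sym by (auto simp: lift_adj_def)
  show "\<not> ladj x x" for x using adj_irrefl by (auto simp: lift_adj_def)
qed

text \<open>Crossing an edge and returning has total shift 0, so a walk whose projection backtracks
  would itself backtrack in the cover.\<close>

lemma nbwalk_lift:
  assumes "nbwalk ladj xs"
  shows "nbwalk adj (map fst xs)"
  unfolding nbwalk_def
proof (intro conjI allI impI)
  have l: "ladj (xs ! i) (xs ! Suc i)" if "Suc i < length xs" for i using assms that by (auto simp: nbwalk_def)
  show "map fst xs \<noteq> []" using assms by (auto simp: nbwalk_def)
  show "adj (map fst xs ! i) (map fst xs ! Suc i)" if "Suc i < length (map fst xs)" for i
    using l[of i] that by (auto simp: lift_adj_def)
  fix i assume i: "Suc (Suc i) < length (map fst xs)"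
  show "map fst xs ! i \<noteq> map fst xs ! Suc (Suc i)"
  proof
    assume "map fst xs ! i = map fst xs ! Suc (Suc i)"
    then have e: "fst (xs ! Suc (Suc i)) = fst (xs ! i)" using i by simp
    have a: "ladj (xs ! i) (xs ! Suc i)" "ladj (xs ! Suc i) (xs ! Suc (Suc i))" using l i by auto
    then have "snd (xs ! Suc (Suc i)) = snd (xs ! i)"
      using shift_back[of "fst (xs ! i)" "fst (xs ! Suc i)" "snd (xs ! i)"] e by (auto simp: lift_adj_def)
    then have "xs ! i = xs ! Suc (Suc i)" using e by (simp add: prod_eq_iff)
    then show False using assms i by (auto simp: nbwalk_def)
  qed
qed

lemma nbwalk_lift_unique:
  assumes "nbwalk ladj xs" "nbwalk ladj ys" "hd xs = hd ys" "map fst xs = map fst ys"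
  shows "xs = ys"
proof (rule nth_equalityI)
  show len: "length xs = length ys" using assms(4) by (metis length_map)
  have ne: "xs \<noteq> []" "ys \<noteq> []" using assms by (auto simp: nbwalk_def)
  fix i assume "i < length xs"
  then show "xs ! i = ys ! i"
  proof (induction i)
    case 0
    then show ?case using assms(3) ne by (simp add: hd_conv_nth[symmetric])
  next
    case (Suc i)
    have f: "fst (xs ! Suc i) = fst (ys ! Suc i)"
      using arg_cong[OF assms(4), of "\<lambda>l. l ! Suc i"] Suc.prems len by simp
    have "ladj (xs ! i) (xs ! Suc i)" "ladj (ys ! i) (ys ! Suc i)"
      using assms(1,2) Suc.prems len by (auto simp: nbwalk_def)
    then show ?case using Suc f by (auto simp: lift_adj_def prod_eq_iff)
  qed
qed

lemma unique_walks_lift: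
  assumes "unique_walks adj L"
  shows "unique_walks ladj L"
proof -
  interpret B: unique_walks adj L by fact
  interpret S: sgraph ladj by (rule sgraph_lift)
  show ?thesis
  proof
    fix p r assume a: "nbwalk ladj p" "nbwalk ladj r" "hd p = hd r" "last p = last r" "length p \<le> L + 3" "length r \<le> L + 3"
    then have ne: "p \<noteq> []" "r \<noteq> []" by (auto simp: nbwalk_def)
    have "map fst p = map fst r"
      using a ne by (intro B.uniq nbwalk_lift) (auto simp: hd_map last_map)
    then show "p = r" using nbwalk_lift_unique a by blast
  qed
qed

text \<open>The cover acts on each edge by a permutation of the fibre, so Cauchy-Schwarz bounds the
  cross term by the product of the fibre norms. A lower bound on the base graph thus serves every
  choice of voltages.\<close>

lemma qform_lift_ge:
  fixes \<rho> :: real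
  assumes Y: "finite Y" and r: "0 < \<rho>"
  defines "M \<equiv> \<lambda>x y. (if x = y then 1 - \<rho>\<^sup>2 + \<rho>\<^sup>2 * card (nbrs adj Y (fst x)) else 0) - \<rho> * of_bool (ladj x y)"
  shows "bethe_form adj \<rho> Y (\<lambda>v. L2_set (\<lambda>i. w (v, i)) {..<q}) \<le> qform (Y \<times> {..<q}) M w"
proof -
  let ?W = "\<lambda>v. L2_set (\<lambda>i. w (v, i)) {..<q}"
  let ?c = "\<lambda>v. 1 - \<rho>\<^sup>2 + \<rho>\<^sup>2 * card (nbrs adj Y v)"
  have W2: "(?W v)\<^sup>2 = (\<Sum>i<q. (w (v, i))\<^sup>2)" for v
    by (simp add: L2_set_def sum_nonneg)
  have cs: "(\<Sum>i<q. w (u, i) * w (v, (i + s u v) mod q)) \<le> ?W u * ?W v" for u v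
  proof -
    have inj: "inj_on (\<lambda>i. (i + s u v) mod q) {..<q}"
      by (intro inj_onI) (metis add.commute add_mod_inject lessThan_iff)
    then have im: "(\<lambda>i. (i + s u v) mod q) ` {..<q} = {..<q}"
      using q by (intro endo_inj_surj) auto
    have "(\<Sum>i<q. w (u, i) * w (v, (i + s u v) mod q)) \<le> (\<Sum>i<q. \<bar>w (u, i)\<bar> * \<bar>w (v, (i + s u v) mod q)\<bar>)"
      by (intro sum_mono) (simp add: abs_mult[symmetric])
    also have "\<dots> \<le> L2_set (\<lambda>i. w (u, i)) {..<q} * L2_set (\<lambda>i. w (v, (i + s u v) mod q)) {..<q}"
      by (rule L2_set_mult_ineq)
    also have "L2_set (\<lambda>i. w (v, (i + s u v) mod q)) {..<q} = ?W v"
      using sum.reindex[OF inj, of "\<lambda>j. (w (v, j))\<^sup>2"] unfolding im L2_set_def by (simp add: o_def)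
    finally show ?thesis .
  qed
  have row: "(\<Sum>y\<in>Y \<times> {..<q}. M (u, i) y * w (u, i) * w y)
     = ?c u * (w (u, i))\<^sup>2 - \<rho> * (\<Sum>v\<in>nbrs adj Y u. w (u, i) * w (v, (i + s u v) mod q))"
    if "u \<in> Y" "i < q" for u i
  proof -
    have fY: "finite (Y \<times> {..<q})" using Y by simp
    have "(\<Sum>y\<in>Y \<times> {..<q}. M (u, i) y * w (u, i) * w y)
       = (\<Sum>y\<in>Y \<times> {..<q}. if (u, i) = y then ?c u * (w (u, i))\<^sup>2 else 0)
         - \<rho> * (\<Sum>y\<in>Y \<times> {..<q}. if ladj (u, i) y then w (u, i) * w y else 0)"
      unfolding sum_distrib_left sum_subtractf[symmetric]
      by (intro sum.cong refl) (auto simp: M_def power2_eq_square algebra_simps)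
    also have "(\<Sum>y\<in>Y \<times> {..<q}. if (u, i) = y then ?c u * (w (u, i))\<^sup>2 else 0) = ?c u * (w (u, i))\<^sup>2"
      using that Y by (subst sum.delta'[OF fY]) auto
    also have "(\<Sum>y\<in>Y \<times> {..<q}. if ladj (u, i) y then w (u, i) * w y else 0)
       = (\<Sum>y\<in>{y \<in> Y \<times> {..<q}. ladj (u, i) y}. w (u, i) * w y)"
      by (rule sum.inter_filter[OF fY, symmetric])
    also have "{y \<in> Y \<times> {..<q}. ladj (u, i) y} = (\<lambda>v. (v, (i + s u v) mod q)) ` nbrs adj Y u"
      using that q by (auto simp: lift_adj_def nbrs_def)
    also have "(\<Sum>y\<in>(\<lambda>v. (v, (i + s u v) mod q)) ` nbrs adj Y u. w (u, i) * w y)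
       = (\<Sum>v\<in>nbrs adj Y u. w (u, i) * w (v, (i + s u v) mod q))"
      by (subst sum.reindex) (auto simp: inj_on_def)
    finally show ?thesis .
  qed
  have "bethe_form adj \<rho> Y ?W = (\<Sum>u\<in>Y. ?c u * (?W u)\<^sup>2 - \<rho> * (\<Sum>v\<in>nbrs adj Y u. ?W u * ?W v))"
    unfolding bethe_form_def ..
  also have "\<dots> \<le> (\<Sum>u\<in>Y. ?c u * (?W u)\<^sup>2 - \<rho> * (\<Sum>v\<in>nbrs adj Y u. \<Sum>i<q. w (u, i) * w (v, (i + s u v) mod q)))"
    using r by (intro sum_mono diff_mono order_refl mult_left_mono cs) auto
  also have "\<dots> = (\<Sum>u\<in>Y. \<Sum>i<q. ?c u * (w (u, i))\<^sup>2 - \<rho> * (\<Sum>v\<in>nbrs adj Y u. w (u, i) * w (v, (i + s u v) mod q)))"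
    unfolding W2
    by (intro sum.cong refl, subst sum.swap) (simp add: sum_subtractf sum_distrib_left)
  also have "\<dots> = (\<Sum>u\<in>Y. \<Sum>i<q. \<Sum>y\<in>Y \<times> {..<q}. M (u, i) y * w (u, i) * w y)"
    by (intro sum.cong refl row[symmetric]) auto
  also have "\<dots> = qform (Y \<times> {..<q}) M w"
  proof -
    have "(\<Sum>u\<in>Y. \<Sum>i<q. g (u, i)) = sum g (Y \<times> {..<q})" for g :: "'a \<times> nat \<Rightarrow> real"
      by (simp add: sum.cartesian_product)
    then show ?thesis unfolding qform_def .
  qed
  finally show ?thesis .
qed

end

section \<open>From the inverse back to the kernel\<close>

lemma quadratic_lower_bound:
  fixes a b T :: real
  assumes "a > 0"
  shows "- (b\<^sup>2 / (4 * a)) \<le> a * T\<^sup>2 - b * T"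
proof -
  have "a * T\<^sup>2 - b * T + b\<^sup>2 / (4 * a) = a * (T - b / (2 * a))\<^sup>2"
    using assms by (simp add: power2_eq_square field_simps)
  moreover have "0 \<le> a * (T - b / (2 * a))\<^sup>2" using assms by simp
  ultimately show ?thesis by linarith
qed

text \<open>With \<open>w = M z\<close>, the form of \<open>k\<close> at \<open>w\<close> is
  \<open>a\<close> times that of \<open>M\<close> at \<open>z\<close>, up to an error linear in
  \<open>z\<close>. The main term is quadratic in the scale of \<open>z\<close>, so minimizing over
  that scale leaves a loss of second order in \<open>e\<close>. Symmetry of \<open>k\<close> is not
  involved.\<close>

lemma approx_inverse_lower_bound:
  fixes k M :: "'a \<Rightarrow> 'a \<Rightarrow> real" and w :: "'a \<Rightarrow> real"
  assumes Y: "finite Y" and M: "symm_on Y M" and c: "c > 0" and a: "a > 0"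
    and low: "\<And>w x. x \<in> Y \<Longrightarrow> c * (w x)\<^sup>2 \<le> qform Y M w"
    and kM: "\<And>x v. x \<in> Y \<Longrightarrow> v \<in> Y \<Longrightarrow> \<bar>(\<Sum>y\<in>Y. k x y * M y v) - a * of_bool (x = v)\<bar> \<le> e"
    and e: "e \<ge> 0"
  shows "qform Y k w \<ge> - (e\<^sup>2 * (real (card Y)) ^ 3 / (4 * a * c)) * (\<Sum>x\<in>Y. (w x)\<^sup>2)"
proof (cases "Y = {}")
  case True
  then show ?thesis by (simp add: qform_def)
next
  case False
  have "posdef Y M"
    unfolding posdef_def
  proof (intro allI impI)
    fix w :: "'a \<Rightarrow> real" assume "\<exists>u\<in>Y. w u \<noteq> 0"
    then obtain u where u: "u \<in> Y" "w u \<noteq> 0" by blast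
    have "0 < c * (w u)\<^sup>2" using c u by simp
    also have "\<dots> \<le> qform Y M w" using low u by blast
    finally show "0 < qform Y M w" .
  qed
  then obtain Q where Q: "symm_on Y Q" "inverse_on Y Q M" using posdef_inverse_exists[OF Y M] by blast
  define z where "z x = (\<Sum>t\<in>Y. Q x t * w t)" for x
  have Mz: "(\<Sum>v\<in>Y. M x v * z v) = w x" if "x \<in> Y" for x
    unfolding z_def by (rule inverse_on_apply[OF Y inverse_on_transpose[OF Q(1) M Q(2)] that])
  define P where "P = qform Y M z"
  have wz: "(\<Sum>x\<in>Y. w x * z x) = P"
    unfolding P_def qform_alt using Mz by (intro sum.cong) auto
  obtain y0 where y0: "y0 \<in> Y" using False by blast
  have P0: "P \<ge> 0" using low[OF y0, of z] c unfolding P_def by (smt (verit) mult_nonneg_nonneg zero_le_power2)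
  \<comment> \<open>The scale of \<open>z\<close>: the lower bound on \<open>M\<close> makes
    \<open>T\<close> a bound for all its entries, while the main term is exactly
    \<open>a * c * T\<^sup>2\<close>.\<close>
  define T where "T = sqrt (P / c)"
  have T: "T \<ge> 0" "P = c * T\<^sup>2" using P0 c by (auto simp: T_def)
  have zT: "\<bar>z v\<bar> \<le> T" if "v \<in> Y" for v
  proof -
    have "(z v)\<^sup>2 \<le> P / c" using low[OF that, of z] c unfolding P_def by (simp add: field_simps)
    then show ?thesis unfolding T_def using real_le_rsqrt[of "\<bar>z v\<bar>" "P / c"] by simp
  qed
  define err where "err x v = (\<Sum>y\<in>Y. k x y * M y v) - a * of_bool (x = v)" for x v
  have row: "(\<Sum>y\<in>Y. k x y * w y) = a * z x + (\<Sum>v\<in>Y. err x v * z v)" if x: "x \<in> Y" for x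
  proof -
    have "(\<Sum>y\<in>Y. k x y * w y) = (\<Sum>y\<in>Y. k x y * (\<Sum>v\<in>Y. M y v * z v))"
      using Mz by (intro sum.cong) auto
    also have "\<dots> = (\<Sum>v\<in>Y. (\<Sum>y\<in>Y. k x y * M y v) * z v)"
      unfolding sum_distrib_left sum_distrib_right by (subst sum.swap) (simp add: mult.assoc)
    also have "\<dots> = (\<Sum>v\<in>Y. (a * z v) * of_bool (x = v) + err x v * z v)"
      by (intro sum.cong refl) (simp add: err_def algebra_simps)
    also have "\<dots> = a * z x + (\<Sum>v\<in>Y. err x v * z v)"
      unfolding sum.distrib sum_of_bool_right(2)[OF Y x] ..
    finally show ?thesis .
  qed
  define A where "A = (\<Sum>x\<in>Y. \<bar>w x\<bar>)"
  have A2: "A\<^sup>2 \<le> card Y * (\<Sum>x\<in>Y. (w x)\<^sup>2)"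
    using sum_squared_le_sum_of_squares[of "\<lambda>x. \<bar>w x\<bar>" Y] by (simp add: A_def mult.commute)
  have err_row: "\<bar>\<Sum>v\<in>Y. err x v * z v\<bar> \<le> card Y * (e * T)" if x: "x \<in> Y" for x
  proof -
    have "\<bar>\<Sum>v\<in>Y. err x v * z v\<bar> \<le> (\<Sum>v\<in>Y. \<bar>err x v * z v\<bar>)" by (rule sum_abs)
    also have "\<dots> \<le> (\<Sum>v\<in>Y. e * T)"
      unfolding abs_mult using kM[OF x] zT e by (intro sum_mono mult_mono) (auto simp: err_def)
    finally show ?thesis by simp
  qed
  have "qform Y k w = (\<Sum>x\<in>Y. (\<Sum>y\<in>Y. k x y * w y) * w x)" by (rule qform_alt)
  also have "\<dots> = (\<Sum>x\<in>Y. a * (w x * z x) + (\<Sum>v\<in>Y. err x v * z v) * w x)"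
  proof (intro sum.cong refl)
    fix x assume x: "x \<in> Y"
    show "(\<Sum>y\<in>Y. k x y * w y) * w x = a * (w x * z x) + (\<Sum>v\<in>Y. err x v * z v) * w x"
      unfolding row[OF x] by (simp only: distrib_right distrib_left mult_ac)
  qed
  also have "\<dots> = a * P + (\<Sum>x\<in>Y. (\<Sum>v\<in>Y. err x v * z v) * w x)"
    unfolding sum.distrib sum_distrib_left[symmetric] wz ..
  finally have eq: "qform Y k w = a * P + (\<Sum>x\<in>Y. (\<Sum>v\<in>Y. err x v * z v) * w x)" .
  have lower: "(\<Sum>x\<in>Y. (\<Sum>v\<in>Y. err x v * z v) * w x) \<ge> - (card Y * (e * T) * A)"
  proof -
    have "\<bar>\<Sum>x\<in>Y. (\<Sum>v\<in>Y. err x v * z v) * w x\<bar> \<le> (\<Sum>x\<in>Y. \<bar>(\<Sum>v\<in>Y. err x v * z v) * w x\<bar>)"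
      by (rule sum_abs)
    also have "\<dots> \<le> (\<Sum>x\<in>Y. card Y * (e * T) * \<bar>w x\<bar>)"
      unfolding abs_mult by (intro sum_mono mult_right_mono err_row) auto
    also have "\<dots> = card Y * (e * T) * A" by (simp add: A_def sum_distrib_left)
    finally show ?thesis by linarith
  qed
  have "qform Y k w \<ge> (a * c) * T\<^sup>2 - (card Y * e * A) * T"
    unfolding eq T(2) using lower by (simp add: mult_ac)
  moreover have "(a * c) * T\<^sup>2 - (card Y * e * A) * T \<ge> - ((card Y * e * A)\<^sup>2 / (4 * (a * c)))"
    using a c by (intro quadratic_lower_bound) simp
  moreover have "(card Y * e * A)\<^sup>2 / (4 * (a * c)) \<le> (e\<^sup>2 * (real (card Y)) ^ 3 / (4 * a * c)) * (\<Sum>x\<in>Y. (w x)\<^sup>2)"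
  proof -
    have "(card Y * e * A)\<^sup>2 \<le> (card Y * e)\<^sup>2 * (card Y * (\<Sum>x\<in>Y. (w x)\<^sup>2))"
      unfolding power_mult_distrib[of _ A] using A2 by (intro mult_left_mono) auto
    also have "\<dots> = e\<^sup>2 * (real (card Y)) ^ 3 * (\<Sum>x\<in>Y. (w x)\<^sup>2)"
      by (simp add: power2_eq_square power3_eq_cube)
    finally show ?thesis using a c by (simp add: divide_right_mono field_simps)
  qed
  ultimately show ?thesis by linarith
qed

context acyclic_graph
begin

text \<open>\<open>X\<close> is enlarged by the short walks between its points to a set
  \<open>Y\<close>, inside which the kernel on \<open>X\<close> can be computed. On \<open>Y\<close>
  the lifted Bethe matrix is bounded below and nearly inverts the kernel. The condition
  \<open>4 * h + 6 \<le> u0\<close> makes room for two walks of \<open>2 * h + 3\<close>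
  vertices.\<close>

theorem walk_kernel_local_posdef:
  fixes \<rho> \<zeta> :: real and s :: "'a \<Rightarrow> 'a \<Rightarrow> nat"
  assumes r: "0 < \<rho>" "\<rho> < 1" and q: "q > 0"
    and shift: "\<And>x y. adj x y \<Longrightarrow> (s x y + s y x) mod q = 0"
    and h: "1 \<le> h" "4 * h + 6 \<le> u0"
    and sparse: "\<And>W. finite W \<Longrightarrow> card W \<le> N \<Longrightarrow>
      4 * (2 * h) * (\<Sum>x\<in>W. card (nbrs adj W x)) \<le> (8 * (2 * h) + 2) * card W"
    and small: "2 * \<rho> ^ (2 * h) / (1 - \<rho>\<^sup>2) * N \<le> 1 / 8"
    and X: "finite X" "(card X)\<^sup>2 * (2 * h + 1) \<le> N"
    and \<zeta>: "2 * (\<rho> ^ (2 * h + 1))\<^sup>2 * (real (N * q)) ^ 5 / (1 - \<rho>\<^sup>2)\<^sup>2 < \<zeta>"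
  shows "posdef (X \<times> {..<q}) (\<lambda>x y. walk_kernel (lift_adj q s adj) \<rho> (2 * h) x y + \<zeta> * of_bool (x = y))"
proof -
  let ?L = "2 * h"
  interpret S: shift_graph adj q s by standard (auto simp: q shift)
  interpret U: unique_walks adj ?L
    by standard (use nbwalk_unique h in auto)
  interpret LU: unique_walks S.ladj ?L by (rule S.unique_walks_lift) unfold_locales
  \<comment> \<open>\<open>P e\<close> contains at most one walk, so \<open>Y\<close> has at most
    \<open>2 * h + 1\<close> vertices for each pair of points of \<open>X\<close>.\<close>
  define P where "P e = {xs. nbwalk adj xs \<and> hd xs = fst e \<and> last xs = snd e \<and> length xs \<le> ?L + 1}" for e
  define Y where "Y = (\<Union>e\<in>X \<times> X. \<Union>(set ` P e))"
  have Pcard: "finite (\<Union>(set ` P e)) \<and> card (\<Union>(set ` P e)) \<le> ?L + 1" for e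
  proof (cases "P e = {}")
    case False
    then obtain xs where xs: "xs \<in> P e" by blast
    have "P e = {xs}"
    proof -
      have "ys = xs" if "ys \<in> P e" for ys
        using that xs unfolding P_def by (intro U.uniq) auto
      then show ?thesis using xs by blast
    qed
    then have "\<Union>(set ` P e) = set xs" by simp
    moreover have "length xs \<le> ?L + 1" using xs by (simp add: P_def)
    ultimately show ?thesis using card_length[of xs] by simp
  qed simp
  have fY: "finite Y" unfolding Y_def using X Pcard by auto
  have "card Y \<le> (\<Sum>e\<in>X \<times> X. card (\<Union>(set ` P e)))"
    unfolding Y_def using X by (intro card_UN_le) auto
  also have "\<dots> \<le> (\<Sum>e\<in>X \<times> X. ?L + 1)" using Pcard by (intro sum_mono) blast
  also have "\<dots> = (card X)\<^sup>2 * (2 * h + 1)" by (simp add: card_cartesian_product power2_eq_square)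
  finally have cY: "card Y \<le> N" using X(2) by simp
  have XY: "X \<subseteq> Y"
  proof
    fix x assume "x \<in> X"
    moreover have "[x] \<in> P (x, x)" by (simp add: P_def nbwalk_def)
    ultimately show "x \<in> Y" unfolding Y_def by force
  qed
  let ?Y = "Y \<times> {..<q}" and ?X = "X \<times> {..<q}"
  define aY where "aY = restrict_adj S.ladj ?Y"
  interpret R: unique_walks aY ?L unfolding aY_def by (rule LU.unique_walks_restrict)
  have fYq: "finite ?Y" using fY by simp
  \<comment> \<open>A walk in the cover projects to a walk collected in \<open>Y\<close>;
    restricting to \<open>Y\<close> loses no walk between points of \<open>X\<close>.\<close>
  have ker: "walk_kernel aY \<rho> ?L x y = walk_kernel S.ladj \<rho> ?L x y" if xy: "x \<in> ?X" "y \<in> ?X" for x y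
    unfolding aY_def
  proof (rule walk_kernel_restrict_adj)
    fix xs assume xs: "nbwalk S.ladj xs" "hd xs = x" "last xs = y" "length xs \<le> ?L + 1"
    have ne: "xs \<noteq> []" using xs by (auto simp: nbwalk_def)
    have "map fst xs \<in> P (fst x, fst y)"
      using xs ne S.nbwalk_lift by (auto simp: P_def hd_map last_map)
    moreover have "(fst x, fst y) \<in> X \<times> X" using xy by auto
    ultimately have "set (map fst xs) \<subseteq> Y" unfolding Y_def by blast
    moreover have "snd (xs ! i) < q" if i: "i < length xs" for i
    proof (cases "Suc i < length xs")
      case True
      then show ?thesis using xs(1) by (auto simp: nbwalk_def lift_adj_def)
    next
      case False
      then have "xs ! i = y" using i xs(3) ne by (metis One_nat_def Suc_lessI diff_Suc_1 last_conv_nth)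
      then show ?thesis using xy by auto
    qed
    ultimately show "set xs \<subseteq> ?Y" by (fastforce simp: in_set_conv_nth)
  qed
  \<comment> \<open>The Bethe matrix of the lift of the graph induced on \<open>Y\<close>. Its
    degrees agree with those upstairs because the cover is locally bijective.\<close>
  define M where "M x y = (if x = y then 1 - \<rho>\<^sup>2 + \<rho>\<^sup>2 * card (nbrs adj Y (fst x)) else 0) - \<rho> * of_bool (S.ladj x y)" for x y
  have r2: "\<rho>\<^sup>2 < 1" using r by (simp add: power_less_one_iff)
  have symM: "symm_on ?Y M"
    unfolding symm_on_def
  proof (intro ballI)
    fix x y
    have "S.ladj x y = S.ladj y x" using LU.adj_sym by blast
    then show "M x y = M y x" by (simp add: M_def)
  qed
  have low: "(1 - \<rho>\<^sup>2) / 8 * (w x)\<^sup>2 \<le> qform ?Y M w" if x: "x \<in> ?Y" for w x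
  proof -
    let ?W = "\<lambda>v. L2_set (\<lambda>i. w (v, i)) {..<q}"
    obtain v i where vi: "x = (v, i)" "v \<in> Y" "i < q" using x by auto
    obtain t where t: "t \<ge> 0" "\<forall>v\<in>Y. (1 - \<rho>\<^sup>2) * (?W v)\<^sup>2 \<le> t"
      "(1 / 4 - 2 * \<rho> ^ (2 * h) / (1 - \<rho>\<^sup>2) * card Y) * t \<le> bethe_form adj \<rho> Y ?W"
      using bethe_form_lower_bound[OF r h(1) _ sparse refl fY cY, of ?W] h by auto
    have "2 * \<rho> ^ (2 * h) / (1 - \<rho>\<^sup>2) * card Y \<le> 2 * \<rho> ^ (2 * h) / (1 - \<rho>\<^sup>2) * N"
      using cY r r2 by (intro mult_left_mono) auto
    then have "1 / 8 * t \<le> (1 / 4 - 2 * \<rho> ^ (2 * h) / (1 - \<rho>\<^sup>2) * card Y) * t"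
      using small t(1) by (intro mult_right_mono) auto
    also note t(3)
    also have "bethe_form adj \<rho> Y ?W \<le> qform ?Y M w"
      unfolding M_def by (rule S.qform_lift_ge[OF fY r(1)])
    finally have "t / 8 \<le> qform ?Y M w" by simp
    moreover have "(w x)\<^sup>2 \<le> (?W v)\<^sup>2"
      using vi member_le_sum[of i "{..<q}" "\<lambda>i. (w (v, i))\<^sup>2"] by (simp add: L2_set_def sum_nonneg)
    then have "(1 - \<rho>\<^sup>2) * (w x)\<^sup>2 \<le> (1 - \<rho>\<^sup>2) * (?W v)\<^sup>2" using r2 by (intro mult_left_mono) auto
    ultimately show ?thesis using t(2) vi(2) by fastforce
  qed
  let ?k = "walk_kernel aY \<rho> ?L"
  have kM: "\<bar>(\<Sum>y\<in>?Y. ?k x y * M y v) - (1 - \<rho>\<^sup>2) * of_bool (x = v)\<bar> \<le> \<rho> ^ (?L + 1) * card ?Y"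
    if v: "v \<in> ?Y" for x v
  proof -
    obtain u i where ui: "v = (u, i)" "u \<in> Y" "i < q" using v by auto
    have N: "nbrs aY ?Y v = (\<lambda>w. (w, (i + s u w) mod q)) ` nbrs adj Y u"
      using ui q by (auto simp: nbrs_def aY_def restrict_adj_def lift_adj_def)
    have cN: "card (nbrs aY ?Y v) = card (nbrs adj Y (fst v))"
      unfolding N using ui by (simp add: card_image inj_on_def)
    have "(\<Sum>y\<in>?Y. ?k x y * M y v)
       = (\<Sum>y\<in>?Y. if y = v then (1 - \<rho>\<^sup>2 + \<rho>\<^sup>2 * card (nbrs adj Y (fst v))) * ?k x v else 0)
         - \<rho> * (\<Sum>y\<in>?Y. if aY v y then ?k x y else 0)"
      unfolding sum_distrib_left sum_subtractf[symmetric]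
    proof (intro sum.cong refl)
      fix y assume "y \<in> ?Y"
      then have "S.ladj y v = aY v y" using v LU.adj_sym by (auto simp: aY_def restrict_adj_def)
      then show "?k x y * M y v = (if y = v then (1 - \<rho>\<^sup>2 + \<rho>\<^sup>2 * card (nbrs adj Y (fst v))) * ?k x v else 0)
          - \<rho> * (if aY v y then ?k x y else 0)"
        by (simp add: M_def algebra_simps)
    qed
    also have "(\<Sum>y\<in>?Y. if y = v then (1 - \<rho>\<^sup>2 + \<rho>\<^sup>2 * card (nbrs adj Y (fst v))) * ?k x v else 0)
       = (1 - \<rho>\<^sup>2 + \<rho>\<^sup>2 * card (nbrs aY ?Y v)) * ?k x v"
      unfolding sum.delta[OF fYq] cN using v by simp
    also have "(\<Sum>y\<in>?Y. if aY v y then ?k x y else 0) = (\<Sum>y\<in>nbrs aY ?Y v. ?k x y)"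
      unfolding nbrs_def by (rule sum.inter_filter[OF fYq, symmetric])
    finally have eq: "(\<Sum>y\<in>?Y. ?k x y * M y v) = (1 - \<rho>\<^sup>2 + \<rho>\<^sup>2 * card (nbrs aY ?Y v)) * ?k x v
         - \<rho> * (\<Sum>y\<in>nbrs aY ?Y v. ?k x y)" .
    show ?thesis
      unfolding eq by (rule R.walk_kernel_bethe[OF fYq v _ _ r]) (use h in \<open>auto simp: aY_def restrict_adj_def\<close>)
  qed
  have cYq: "real (card ?Y) \<le> real (N * q)" using cY by (simp add: card_cartesian_product mult_right_mono)
  show ?thesis
    unfolding posdef_def
  proof (intro allI impI)
    fix w :: "'a \<times> nat \<Rightarrow> real" assume "\<exists>u\<in>?X. w u \<noteq> 0"
    then obtain x0 where x0: "x0 \<in> ?X" "w x0 \<noteq> 0" by blast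
    define w' where "w' x = (if x \<in> ?X then w x else 0)" for x
    have sub: "?X \<subseteq> ?Y" using XY by auto
    let ?n = "\<Sum>x\<in>?Y. (w' x)\<^sup>2"
    have npos: "?n > 0"
      using x0 sub fYq by (intro sum_pos2[of _ x0]) (auto simp: w'_def)
    have "qform ?X (\<lambda>x y. walk_kernel S.ladj \<rho> ?L x y + \<zeta> * of_bool (x = y)) w
       = (\<Sum>x\<in>?X. \<Sum>y\<in>?X. ?k x y * w x * w y) + \<zeta> * (\<Sum>x\<in>?X. (w x)\<^sup>2)"
    proof -
      have fXq: "finite ?X" using X by simp
      have "(\<Sum>y\<in>?X. (walk_kernel S.ladj \<rho> ?L x y + \<zeta> * of_bool (x = y)) * w x * w y)
         = (\<Sum>y\<in>?X. ?k x y * w x * w y) + \<zeta> * (w x)\<^sup>2" if x: "x \<in> ?X" for x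
      proof -
        have "(\<Sum>y\<in>?X. (walk_kernel S.ladj \<rho> ?L x y + \<zeta> * of_bool (x = y)) * w x * w y)
           = (\<Sum>y\<in>?X. ?k x y * w x * w y + (\<zeta> * w x * w y) * of_bool (x = y))"
        proof (intro sum.cong refl)
          fix y assume "y \<in> ?X"
          show "(walk_kernel S.ladj \<rho> ?L x y + \<zeta> * of_bool (x = y)) * w x * w y
              = ?k x y * w x * w y + (\<zeta> * w x * w y) * of_bool (x = y)"
            unfolding ker[OF x \<open>y \<in> ?X\<close>] by (simp only: distrib_right distrib_left mult_ac)
        qed
        also have "\<dots> = (\<Sum>y\<in>?X. ?k x y * w x * w y) + \<zeta> * w x * w x"
          unfolding sum.distrib sum_of_bool_right(2)[OF fXq x] ..
        finally show ?thesis by (simp add: power2_eq_square)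
      qed
      then show ?thesis unfolding qform_def by (simp add: sum.distrib sum_distrib_left)
    qed
    also have "(\<Sum>x\<in>?X. \<Sum>y\<in>?X. ?k x y * w x * w y) = qform ?X ?k w'"
      unfolding qform_def by (intro sum.cong refl) (simp add: w'_def)
    also have "qform ?X ?k w' = qform ?Y ?k w'"
    proof -
      have "(\<Sum>x\<in>?Y. \<Sum>y\<in>?Y. ?k x y * w' x * w' y) = (\<Sum>x\<in>?X. \<Sum>y\<in>?Y. ?k x y * w' x * w' y)"
        by (rule sum.mono_neutral_right[OF fYq sub]) (auto simp: w'_def)
      also have "\<dots> = (\<Sum>x\<in>?X. \<Sum>y\<in>?X. ?k x y * w' x * w' y)"
        by (intro sum.cong refl sum.mono_neutral_right[OF fYq sub]) (auto simp: w'_def)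
      finally show ?thesis unfolding qform_def by simp
    qed
    also have "(\<Sum>x\<in>?X. (w x)\<^sup>2) = ?n"
    proof -
      have "?n = (\<Sum>x\<in>?X. (w' x)\<^sup>2)"
        by (rule sum.mono_neutral_right[OF fYq sub]) (auto simp: w'_def)
      then show ?thesis by (simp add: w'_def)
    qed
    also have "qform ?Y ?k w' + \<zeta> * ?n > 0"
    proof -
      \<comment> \<open>The entrywise error carries a factor \<open>card ?Y\<close>. Squared and
        combined with the cube from the approximate inversion, this gives the fifth power; the
        constant 8 in \<open>low\<close> makes the numerical factor 2.\<close>
      let ?b = "2 * (\<rho> ^ (2 * h + 1))\<^sup>2 * (real (N * q)) ^ 5 / (1 - \<rho>\<^sup>2)\<^sup>2"
      have "- ((\<rho> ^ (?L + 1) * card ?Y)\<^sup>2 * (real (card ?Y)) ^ 3 / (4 * (1 - \<rho>\<^sup>2) * ((1 - \<rho>\<^sup>2) / 8))) * ?n \<le> qform ?Y ?k w'"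
        using r r2 by (intro approx_inverse_lower_bound[OF fYq symM _ _ low kM]) auto
      moreover have "(\<rho> ^ (?L + 1) * card ?Y)\<^sup>2 * (real (card ?Y)) ^ 3 / (4 * (1 - \<rho>\<^sup>2) * ((1 - \<rho>\<^sup>2) / 8)) \<le> ?b"
      proof -
        have "(\<rho> ^ (?L + 1) * card ?Y)\<^sup>2 * (real (card ?Y)) ^ 3 = (\<rho> ^ (2 * h + 1))\<^sup>2 * (real (card ?Y)) ^ 5"
          by (simp only: power_mult_distrib mult.assoc power_add[symmetric]) simp
        also have "\<dots> \<le> (\<rho> ^ (2 * h + 1))\<^sup>2 * (real (N * q)) ^ 5"
          using cYq by (intro mult_left_mono power_mono) auto
        finally have "(\<rho> ^ (?L + 1) * card ?Y)\<^sup>2 * (real (card ?Y)) ^ 3 / ((1 - \<rho>\<^sup>2)\<^sup>2 / 2)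
            \<le> (\<rho> ^ (2 * h + 1))\<^sup>2 * (real (N * q)) ^ 5 / ((1 - \<rho>\<^sup>2)\<^sup>2 / 2)"
          by (rule divide_right_mono) simp
        moreover have "4 * (1 - \<rho>\<^sup>2) * ((1 - \<rho>\<^sup>2) / 8) = (1 - \<rho>\<^sup>2)\<^sup>2 / 2"
          by (simp add: power2_eq_square)
        ultimately show ?thesis by (simp add: mult_ac)
      qed
      then have "- ?b * ?n \<le> - ((\<rho> ^ (?L + 1) * card ?Y)\<^sup>2 * (real (card ?Y)) ^ 3 / (4 * (1 - \<rho>\<^sup>2) * ((1 - \<rho>\<^sup>2) / 8))) * ?n"
        using npos by (intro mult_right_mono) auto
      ultimately have "- ?b * ?n \<le> qform ?Y ?k w'" by linarith
      moreover have "?b * ?n < \<zeta> * ?n" using \<zeta> npos by (rule mult_strict_right_mono)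
      ultimately show ?thesis by linarith
    qed
    finally show "0 < qform ?X (\<lambda>x y. walk_kernel S.ladj \<rho> ?L x y + \<zeta> * of_bool (x = y)) w" .
  qed
qed

end

section \<open>Random instances\<close>

lemma power_self_le_fact: "n ^ n \<le> 3 ^ n * fact n"
proof (induction n)
  case (Suc n)
  have "real (Suc n ^ n) \<le> 3 * real (n ^ n)"
  proof (cases "n = 0")
    case False
    have "(1 + 1 / real n) ^ n \<le> exp 1"
      using False by (intro exp_ge_one_plus_x_over_n_power_n) auto
    then have "(1 + 1 / real n) ^ n \<le> 3" using exp_le by linarith
    then have "(1 + 1 / real n) ^ n * real n ^ n \<le> 3 * real n ^ n" by (intro mult_right_mono) auto
    then show ?thesis using False by (simp add: power_mult_distrib[symmetric] distrib_right add.commute)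
  qed simp
  then have "Suc n ^ n \<le> 3 * n ^ n" by (metis of_nat_le_iff of_nat_mult of_nat_numeral)
  then have "Suc n ^ Suc n \<le> Suc n * (3 * (3 ^ n * fact n))"
    using Suc by (simp del: mult_Suc add: mult_le_mono order_trans[OF _ mult_le_mono2])
  then show ?case by (simp only: fact_Suc power_Suc mult_ac of_nat_id)
qed simp

text \<open>The usual bound \<open>(e * n / a) ^ a\<close> for a binomial coefficient with 3 in
  place of Euler's number, free of division so that \<open>a = 0\<close> is included.\<close>

lemma choose_times_power_self_le: "(n choose a) * a ^ a \<le> 3 ^ a * n ^ a"
proof -
  have "(n choose a) * a ^ a \<le> (n choose a) * (3 ^ a * fact a)"
    by (intro mult_le_mono2 power_self_le_fact)
  also have "\<dots> = 3 ^ a * ((n choose a) * fact a)" by simp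
  also have "\<dots> \<le> 3 ^ a * n ^ a" by (intro mult_le_mono2 binomial_fact_pow)
  finally show ?thesis .
qed

text \<open>Counts choices of \<open>a\<close> variables, \<open>b\<close> edges and
  \<open>a + b + x\<close> incidences between them. After division by \<open>N ^ (a + b + x)\<close>
  a factor \<open>3 * (a + b) / N\<close> is left for each incidence in excess of
  \<open>a + b\<close>.\<close>

lemma choose_triple_bound:
  fixes a b x N k M :: nat
  assumes "k \<ge> 1" "M \<ge> 1" "a + b \<ge> 1"
  shows "(k * N choose a) * (M * N choose b) * (a * b choose (a + b + x))
    \<le> (9 * k * M) ^ (a + b) * N ^ (a + b) * (3 * (a + b)) ^ x"
proof (cases "a = 0 \<or> b = 0")
  case True
  then have "a * b choose (a + b + x) = 0" using assms by (intro binomial_eq_0) auto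
  then show ?thesis by (simp only: mult_0_right zero_le)
next
  case False
  let ?u = "a + b" and ?f = "a + b + x"
  let ?C = "(k * N choose a) * (M * N choose b) * (a * b choose ?f)"
  \<comment> \<open>The common denominator of the three binomial bounds, with the last base lowered
    from \<open>?f\<close> to \<open>?u\<close>. Multiplying through keeps the proof in the natural
    numbers.\<close>
  let ?d = "a ^ a * b ^ b * ?u ^ ?f"
  have ab: "(a * b) ^ ?f \<le> a ^ a * b ^ b * (?u ^ ?f * ?u ^ x)"
  proof -
    have "(a * b) ^ ?f = a ^ a * b ^ b * ((a ^ b * b ^ a) * (a ^ x * b ^ x))"
      by (simp add: power_add power_mult_distrib mult_ac)
    also have "\<dots> \<le> a ^ a * b ^ b * ((?u ^ b * ?u ^ a) * (?u ^ x * ?u ^ x))"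
      by (intro mult_le_mono order_refl power_mono) auto
    also have "\<dots> = a ^ a * b ^ b * (?u ^ ?f * ?u ^ x)"
      by (simp add: power_add mult_ac)
    finally show ?thesis .
  qed
  have "?C * ?d \<le> ?C * (a ^ a * b ^ b * ?f ^ ?f)"
    by (intro mult_le_mono order_refl power_mono) auto
  also have "\<dots> = ((k * N choose a) * a ^ a) * ((M * N choose b) * b ^ b) * ((a * b choose ?f) * ?f ^ ?f)"
    by (simp only: mult_ac)
  also have "\<dots> \<le> (3 ^ a * (k * N) ^ a) * (3 ^ b * (M * N) ^ b) * (3 ^ ?f * (a * b) ^ ?f)"
    by (intro mult_le_mono choose_times_power_self_le)
  also have "\<dots> \<le> (3 ^ a * (k * N) ^ a) * (3 ^ b * (M * N) ^ b) * (3 ^ ?f * (a ^ a * b ^ b * (?u ^ ?f * ?u ^ x)))"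
    by (intro mult_le_mono order_refl ab)
  also have "\<dots> = (k ^ a * M ^ b) * (9 ^ ?u * N ^ ?u * (3 * ?u) ^ x) * ?d"
  proof -
    have "(9 :: nat) ^ n = 3 ^ n * 3 ^ n" for n by (simp flip: power_mult_distrib)
    then show ?thesis by (simp only: power_add power_mult_distrib mult_ac)
  qed
  also have "\<dots> \<le> ((k * M) ^ a * (k * M) ^ b) * (9 ^ ?u * N ^ ?u * (3 * ?u) ^ x) * ?d"
    using assms by (intro mult_le_mono order_refl power_mono) auto
  also have "\<dots> = ((9 * k * M) ^ ?u * N ^ ?u * (3 * ?u) ^ x) * ?d"
    by (simp only: power_add power_mult_distrib mult_ac)
  finally have "?C * ?d \<le> ((9 * k * M) ^ ?u * N ^ ?u * (3 * ?u) ^ x) * ?d" .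
  moreover have "?d > 0" using False by simp
  ultimately show ?thesis by (simp only: mult_le_cancel2)
qed

text \<open>Independence in counting form: under the uniform law on functions, each constrained
  coordinate contributes a factor of at most \<open>b / card F\<close>.\<close>

lemma card_PiE_constrained:
  fixes F :: "'b set" and b :: nat
  assumes I: "finite I" "D \<subseteq> I" and F: "finite F" "F \<noteq> {}" and A: "\<And>p. p \<in> D \<Longrightarrow> A p \<subseteq> F \<and> card (A p) \<le> b"
  shows "real (card {\<omega> \<in> I \<rightarrow>\<^sub>E F. \<forall>p\<in>D. \<omega> p \<in> A p}) \<le> card (I \<rightarrow>\<^sub>E F) * (real b / card F) ^ card D"
proof -
  have fD: "finite D" using I finite_subset by blast
  have e: "{\<omega> \<in> I \<rightarrow>\<^sub>E F. \<forall>p\<in>D. \<omega> p \<in> A p} = (\<Pi>\<^sub>E p\<in>I. if p \<in> D then A p else F)"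
  proof (intro equalityI subsetI)
    fix \<omega> assume "\<omega> \<in> (\<Pi>\<^sub>E p\<in>I. if p \<in> D then A p else F)"
    then have \<omega>: "\<omega> \<in> extensional I" "\<And>p. p \<in> I \<Longrightarrow> \<omega> p \<in> (if p \<in> D then A p else F)"
      unfolding PiE_iff by blast+
    have D: "\<omega> p \<in> A p" if "p \<in> D" for p using \<omega>(2)[of p] that I(2) by auto
    have "\<omega> p \<in> F" if "p \<in> I" for p using \<omega>(2)[OF that] D[of p] A[of p] by (cases "p \<in> D") auto
    then show "\<omega> \<in> {\<omega> \<in> I \<rightarrow>\<^sub>E F. \<forall>p\<in>D. \<omega> p \<in> A p}" using \<omega>(1) D unfolding PiE_iff by blast
  next
    fix \<omega> assume "\<omega> \<in> {\<omega> \<in> I \<rightarrow>\<^sub>E F. \<forall>p\<in>D. \<omega> p \<in> A p}"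
    then show "\<omega> \<in> (\<Pi>\<^sub>E p\<in>I. if p \<in> D then A p else F)" unfolding PiE_iff by auto
  qed
  have cF: "card F > 0" using F by (simp add: card_gt_0_iff)
  have split: "(\<Prod>p\<in>I. g p) = (\<Prod>p\<in>D. g p) * (\<Prod>p\<in>I - D. g p)" for g :: "'a \<Rightarrow> real"
    using prod.subset_diff[OF I(2,1), of g] by (simp add: mult.commute)
  have "real (card {\<omega> \<in> I \<rightarrow>\<^sub>E F. \<forall>p\<in>D. \<omega> p \<in> A p}) = (\<Prod>p\<in>I. real (card (if p \<in> D then A p else F)))"
    unfolding e using I by (simp add: card_PiE)
  also have "\<dots> = (\<Prod>p\<in>D. real (card (A p))) * (\<Prod>p\<in>I - D. real (card F))"
    unfolding split by simp
  also have "\<dots> \<le> (\<Prod>p\<in>D. real b) * (\<Prod>p\<in>I - D. real (card F))"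
    using A by (intro mult_right_mono prod_mono prod_nonneg) auto
  also have "\<dots> = (real b / card F) ^ card D * ((\<Prod>p\<in>D. real (card F)) * (\<Prod>p\<in>I - D. real (card F)))"
    using cF by (simp add: power_divide)
  also have "\<dots> = (real b / card F) ^ card D * real (card (I \<rightarrow>\<^sub>E F))"
    unfolding split[symmetric] using I by (simp add: card_PiE)
  finally show ?thesis by (simp add: mult.commute)
qed

section \<open>The random model and its exceptional events\<close>

locale random_incidence =
  fixes q k N M :: nat
  assumes q: "q \<ge> 2" and k: "k \<ge> 1" and N: "N \<ge> 1" and M: "M \<ge> 1"
begin

abbreviation "edges \<equiv> {..<M * N}"
abbreviation "vars \<equiv> {1..k * N}"
abbreviation "c \<equiv> 18 * k * M"

definition configs :: "(nat \<times> nat \<Rightarrow> nat \<times> nat) set" where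
  "configs = edges \<times> {..<k} \<rightarrow>\<^sub>E {..<N} \<times> {..<q}"

text \<open>Slot \<open>j\<close> of an edge draws from its own block of \<open>N\<close>
  consecutive variables. Hence the \<open>k\<close> variables of an edge are distinct, and a
  variable reveals its slot.\<close>

definition var :: "(nat \<times> nat \<Rightarrow> nat \<times> nat) \<Rightarrow> nat \<Rightarrow> nat \<Rightarrow> nat" where
  "var \<omega> e j = Suc (j * N + fst (\<omega> (e, j)))"

definition incidences :: "(nat \<times> nat \<Rightarrow> nat \<times> nat) \<Rightarrow> nat set \<Rightarrow> nat set \<Rightarrow> nat" where
  "incidences \<omega> A B = card {p \<in> B \<times> {..<k}. var \<omega> (fst p) (snd p) \<in> A}"

lemma finite_configs: "finite configs"
  unfolding configs_def by (intro finite_PiE) auto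

lemma card_configs_pos: "card configs > 0"
proof -
  have "configs \<noteq> {}" unfolding configs_def using N q by (auto simp: PiE_eq_empty_iff lessThan_empty_iff)
  then show ?thesis using finite_configs by (simp add: card_gt_0_iff)
qed

lemma config_mem:
  assumes "\<omega> \<in> configs" "e < M * N" "j < k"
  shows "fst (\<omega> (e, j)) < N" "snd (\<omega> (e, j)) < q"
proof -
  have "\<omega> (e, j) \<in> {..<N} \<times> {..<q}"
    using PiE_mem[OF assms(1)[unfolded configs_def], of "(e, j)"] assms(2,3) by simp
  then show "fst (\<omega> (e, j)) < N" "snd (\<omega> (e, j)) < q" by (auto simp: mem_Times_iff)
qed

lemma var_div_mod:
  assumes "\<omega> \<in> configs" "e < M * N" "j < k"
  shows "(var \<omega> e j - 1) div N = j" "(var \<omega> e j - 1) mod N = fst (\<omega> (e, j))"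
  using config_mem[OF assms] N by (auto simp: var_def)

lemma var_mem:
  assumes "\<omega> \<in> configs" "e < M * N" "j < k"
  shows "var \<omega> e j \<in> vars"
proof -
  have "j * N + fst (\<omega> (e, j)) < j * N + N" using config_mem[OF assms] by simp
  also have "\<dots> = Suc j * N" by simp
  also have "\<dots> \<le> k * N" using assms by (intro mult_le_mono1) auto
  finally show ?thesis by (simp add: var_def)
qed

text \<open>In each of the \<open>k * card T\<close> slots the forbidden value is uniform and
  independent of the position, so it misses the value assigned there with probability
  \<open>1 - 1 / q\<close>.\<close>

lemma card_all_satisfied:
  assumes x: "x \<in> vars \<rightarrow> {..<q}" and T: "T \<subseteq> edges"
  shows "real (card {\<omega> \<in> configs. \<forall>e\<in>T. \<forall>j<k. x (var \<omega> e j) \<noteq> snd (\<omega> (e, j))})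
    \<le> card configs * ((1 - 1 / real q) ^ k) ^ card T"
proof -
  define A where "A p = {y \<in> {..<N} \<times> {..<q}. x (Suc (snd p * N + fst y)) \<noteq> snd y}" for p :: "nat \<times> nat"
  have A: "A p \<subseteq> {..<N} \<times> {..<q} \<and> card (A p) \<le> N * (q - 1)" if p: "p \<in> T \<times> {..<k}" for p
  proof -
    have "A p \<subseteq> (SIGMA c:{..<N}. {..<q} - {x (Suc (snd p * N + c))})" by (auto simp: A_def)
    then have "card (A p) \<le> card (SIGMA c:{..<N}. {..<q} - {x (Suc (snd p * N + c))})" by (intro card_mono) auto
    also have "\<dots> = (\<Sum>c<N. card ({..<q} - {x (Suc (snd p * N + c))}))" by simp
    also have "\<dots> = (\<Sum>c<N. q - 1)"
    proof (intro sum.cong refl)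
      fix c assume "c \<in> {..<N}"
      then have "snd p * N + c < snd p * N + N" by simp
      also have "\<dots> = Suc (snd p) * N" by simp
      also have "\<dots> \<le> k * N" using p by (intro mult_le_mono1) auto
      finally have "x (Suc (snd p * N + c)) \<in> {..<q}" using x by (auto simp: Pi_iff)
      then show "card ({..<q} - {x (Suc (snd p * N + c))}) = q - 1" by simp
    qed
    finally show ?thesis by (auto simp: A_def)
  qed
  have e: "{\<omega> \<in> configs. \<forall>e\<in>T. \<forall>j<k. x (var \<omega> e j) \<noteq> snd (\<omega> (e, j))} \<subseteq> {\<omega> \<in> configs. \<forall>p\<in>T \<times> {..<k}. \<omega> p \<in> A p}"
  proof safe
    fix \<omega> e j assume "\<omega> \<in> configs" "\<forall>e\<in>T. \<forall>j<k. x (var \<omega> e j) \<noteq> snd (\<omega> (e, j))" "e \<in> T" "j < k"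
    then show "\<omega> (e, j) \<in> A (e, j)"
      using config_mem[of \<omega> e j] T unfolding A_def var_def by (auto simp: mem_Times_iff)
  qed
  have "real (card {\<omega> \<in> configs. \<forall>e\<in>T. \<forall>j<k. x (var \<omega> e j) \<noteq> snd (\<omega> (e, j))})
     \<le> real (card {\<omega> \<in> configs. \<forall>p\<in>T \<times> {..<k}. \<omega> p \<in> A p})"
    using finite_configs by (intro of_nat_mono card_mono e) auto
  also have "\<dots> \<le> card configs * (real (N * (q - 1)) / card ({..<N} \<times> {..<q})) ^ card (T \<times> {..<k})"
    unfolding configs_def using T A N q by (intro card_PiE_constrained) (auto simp: lessThan_empty_iff)
  also have "real (N * (q - 1)) / card ({..<N} \<times> {..<q}) = 1 - 1 / real q"
    using N q by (simp add: card_cartesian_product of_nat_diff field_simps)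
  also have "card (T \<times> {..<k}) = k * card T" by (simp add: card_cartesian_product)
  finally show ?thesis by (simp add: power_mult)
qed

text \<open>Union bound over sets \<open>F\<close> of \<open>f\<close> pairs of an edge and a
  variable. Each pair fixes the position drawn in one slot, which has probability
  \<open>1 / N\<close>.\<close>

lemma card_incidences_ge:
  assumes A: "A \<subseteq> vars" and B: "B \<subseteq> edges"
  shows "real (card {\<omega> \<in> configs. f \<le> incidences \<omega> A B}) \<le> card configs * (real (card A * card B choose f) / real N ^ f)"
proof -
  have fA: "finite A" "finite B" using finite_subset[OF A] finite_subset[OF B] by simp_all
  define \<F> where "\<F> = {F. F \<subseteq> B \<times> A \<and> card F = f}"
  \<comment> \<open>The only coordinate of \<open>\<omega>\<close> that can produce the incidence
    \<open>p\<close>: the block of the variable determines the slot.\<close>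
  define idx where "idx p = (fst p, (snd p - 1) div N)" for p :: "nat \<times> nat"
  define G where "G F = {\<omega> \<in> configs. \<forall>p\<in>F. \<exists>j<k. var \<omega> (fst p) j = snd p}" for F
  have fBA: "finite (B \<times> A)" using fA by (rule_tac finite_cartesian_product)
  have "\<F> \<subseteq> Pow (B \<times> A)" unfolding \<F>_def by blast
  then have fF: "finite \<F>" by (rule finite_subset) (simp only: finite_Pow_iff fBA)
  have cF: "card \<F> = card A * card B choose f"
    unfolding \<F>_def n_subsets[OF fBA] by (simp only: card_cartesian_product mult.commute)
  have cover: "{\<omega> \<in> configs. f \<le> incidences \<omega> A B} \<subseteq> (\<Union>F\<in>\<F>. G F)"
  proof
    fix \<omega> assume "\<omega> \<in> {\<omega> \<in> configs. f \<le> incidences \<omega> A B}"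
    then have \<omega>: "\<omega> \<in> configs" "f \<le> incidences \<omega> A B" by auto
    let ?I = "{p \<in> B \<times> {..<k}. var \<omega> (fst p) (snd p) \<in> A}"
    let ?g = "\<lambda>p. (fst p, var \<omega> (fst p) (snd p))"
    have "inj_on ?g ?I"
    proof (rule inj_onI)
      fix p p' assume a: "p \<in> ?I" "p' \<in> ?I" "?g p = ?g p'"
      have 1: "fst p < M * N" "snd p < k" "fst p' < M * N" "snd p' < k"
        using a(1,2) B by (auto simp: mem_Times_iff)
      have 2: "fst p = fst p'" "var \<omega> (fst p) (snd p) = var \<omega> (fst p') (snd p')" using a(3) unfolding prod.inject by blast+
      have "snd p = snd p'"
        using var_div_mod(1)[OF \<omega>(1) 1(1,2)] var_div_mod(1)[OF \<omega>(1) 1(3,4)] 2(2) by (simp only:)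
      then show "p = p'" using 2(1) by (simp add: prod_eq_iff)
    qed
    then have "f \<le> card (?g ` ?I)" using \<omega>(2) unfolding incidences_def by (simp only: card_image)
    then obtain F where F: "F \<subseteq> ?g ` ?I" "card F = f" by (meson obtain_subset_with_card_n)
    have "F \<subseteq> B \<times> A" using F(1) by auto
    then have "F \<in> \<F>" using F(2) by (simp add: \<F>_def)
    moreover have "\<omega> \<in> G F"
      unfolding G_def
    proof (intro CollectI conjI ballI \<omega>(1))
      fix p assume "p \<in> F"
      then obtain p' where "p' \<in> ?I" "p = ?g p'" using F(1) by blast
      then show "\<exists>j<k. var \<omega> (fst p) j = snd p" by (intro exI[of _ "snd p'"]) auto
    qed
    ultimately show "\<omega> \<in> (\<Union>F\<in>\<F>. G F)" by blast
  qed
  have lt: "fst p < M * N" if "F \<in> \<F>" "p \<in> F" for F p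
  proof -
    have "p \<in> B \<times> A" using that unfolding \<F>_def by blast
    then show ?thesis using B by (auto simp: mem_Times_iff)
  qed
  have GF: "real (card (G F)) \<le> card configs * (1 / real N) ^ f" if F: "F \<in> \<F>" for F
  proof (cases "inj_on idx F")
    case False
    \<comment> \<open>Two different pairs would require two different variables in the same slot of
      the same edge.\<close>
    have "G F = {}"
    proof (rule ccontr)
      assume "G F \<noteq> {}"
      then obtain \<omega> where \<omega>: "\<omega> \<in> configs" "\<forall>p\<in>F. \<exists>j<k. var \<omega> (fst p) j = snd p" by (auto simp: G_def)
      have "inj_on idx F"
      proof (rule inj_onI)
        fix p p' assume p: "p \<in> F" "p' \<in> F" "idx p = idx p'"
        obtain j where j: "j < k" "var \<omega> (fst p) j = snd p" using \<omega>(2) p by blast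
        obtain j' where j': "j' < k" "var \<omega> (fst p') j' = snd p'" using \<omega>(2) p by blast
        have lt: "fst p < M * N" "fst p' < M * N" using lt[OF F] p(1,2) by blast+
        have "(snd p - 1) div N = j" "(snd p' - 1) div N = j'"
          using var_div_mod(1)[OF \<omega>(1) lt(1) j(1)] var_div_mod(1)[OF \<omega>(1) lt(2) j'(1)] unfolding j(2) j'(2) .
        then have "fst p = fst p'" "j = j'" using p(3) unfolding idx_def by simp_all
        then show "p = p'" using j(2) j'(2) by (simp add: prod_eq_iff)
      qed
      then show False using False by blast
    qed
    then show ?thesis by simp
  next
    case True
    define R where "R r = {y \<in> {..<N} \<times> {..<q}. \<forall>p\<in>F. idx p = r \<longrightarrow> fst y = (snd p - 1) mod N}" for r
    have R: "R r \<subseteq> {..<N} \<times> {..<q} \<and> card (R r) \<le> q" if r: "r \<in> idx ` F" for r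
    proof -
      obtain p where p: "p \<in> F" "r = idx p" using r by blast
      then have "R r \<subseteq> {(snd p - 1) mod N} \<times> {..<q}" by (auto simp: R_def)
      then have "card (R r) \<le> card ({(snd p - 1) mod N} \<times> {..<q})" by (intro card_mono) auto
      then show ?thesis by (auto simp: R_def card_cartesian_product)
    qed
    show ?thesis
    proof (cases "idx ` F \<subseteq> edges \<times> {..<k}")
      case False
      have "G F = {}"
      proof (rule ccontr)
        assume "G F \<noteq> {}"
        then obtain \<omega> where \<omega>: "\<omega> \<in> configs" "\<forall>p\<in>F. \<exists>j<k. var \<omega> (fst p) j = snd p" by (auto simp: G_def)
        have "idx p \<in> edges \<times> {..<k}" if p: "p \<in> F" for p
        proof -
          have e: "fst p < M * N" by (rule lt[OF F p])
          obtain j where j: "j < k" "var \<omega> (fst p) j = snd p" using \<omega>(2) p by blast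
          then show ?thesis using var_div_mod(1)[OF \<omega>(1) e j(1)] e by (simp add: idx_def)
        qed
        then show False using False by blast
      qed
      then show ?thesis by simp
    next
      case sub: True
      have "G F \<subseteq> {\<omega> \<in> configs. \<forall>r\<in>idx ` F. \<omega> r \<in> R r}"
      proof (intro subsetI CollectI conjI ballI)
        fix \<omega> assume \<omega>: "\<omega> \<in> G F"
        then show \<omega>': "\<omega> \<in> configs" by (simp add: G_def)
        fix r assume r: "r \<in> idx ` F"
        then obtain p where p: "p \<in> F" "r = idx p" by blast
        have "\<omega> r \<in> {..<N} \<times> {..<q}"
          using PiE_mem[OF \<omega>'[unfolded configs_def]] r sub by blast
        moreover have "fst (\<omega> r) = (snd p' - 1) mod N" if p': "p' \<in> F" "idx p' = r" for p'
        proof -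
          have "p' = p" using True p p' by (auto dest: inj_onD)
          moreover obtain j where j: "j < k" "var \<omega> (fst p) j = snd p" using \<omega> p(1) by (auto simp: G_def)
          ultimately show ?thesis
            using var_div_mod[OF \<omega>' lt[OF F p(1)] j(1)] j(2) p(2) by (simp add: idx_def)
        qed
        ultimately show "\<omega> r \<in> R r" unfolding R_def by blast
      qed
      then have "real (card (G F)) \<le> real (card {\<omega> \<in> configs. \<forall>r\<in>idx ` F. \<omega> r \<in> R r})"
        using finite_configs by (intro of_nat_mono card_mono) auto
      also have "\<dots> \<le> card configs * (real q / card ({..<N} \<times> {..<q})) ^ card (idx ` F)"
        unfolding configs_def using sub R N q by (intro card_PiE_constrained) (auto simp: lessThan_empty_iff)
      also have "real q / card ({..<N} \<times> {..<q}) = 1 / real N"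
        using N q by (simp add: card_cartesian_product)
      also have "card (idx ` F) = f" using True F by (simp add: card_image \<F>_def)
      finally show ?thesis .
    qed
  qed
  have "real (card {\<omega> \<in> configs. f \<le> incidences \<omega> A B}) \<le> real (card (\<Union>F\<in>\<F>. G F))"
    using fF finite_configs by (intro of_nat_mono card_mono cover finite_UN_I) (auto simp: G_def)
  also have "\<dots> \<le> real (\<Sum>F\<in>\<F>. card (G F))" using fF by (intro of_nat_mono card_UN_le)
  also have "\<dots> = (\<Sum>F\<in>\<F>. real (card (G F)))" by simp
  also have "\<dots> \<le> (\<Sum>F\<in>\<F>. card configs * (1 / real N) ^ f)" by (intro sum_mono GF)
  also have "\<dots> = card configs * (real (card A * card B choose f) / real N ^ f)"
    by (simp add: cF power_divide)
  finally show ?thesis .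
qed

definition pairs :: "nat \<Rightarrow> (nat set \<times> nat set) set" where
  "pairs u = (\<Union>a\<le>u. {A. A \<subseteq> vars \<and> card A = a} \<times> {B. B \<subseteq> edges \<and> card B = u - a})"

lemma pairs_iff: "p \<in> pairs u \<longleftrightarrow> fst p \<subseteq> vars \<and> snd p \<subseteq> edges \<and> card (fst p) + card (snd p) = u"
  unfolding pairs_def by (cases p) auto

lemma finite_pairs: "finite (pairs u)"
  by (rule finite_subset[of _ "Pow vars \<times> Pow edges"]) (auto simp: pairs_def)

text \<open>First-moment bound for pairs of total size \<open>u\<close> having \<open>x\<close>
  incidences more than their size. Each way to split \<open>u\<close> contributes
  \<open>(9 * k * M) ^ u\<close>.\<close>

lemma sum_pairs_incidences:
  assumes u: "u \<ge> 1"
  shows "(\<Sum>p\<in>pairs u. real (card {\<omega> \<in> configs. u + x \<le> incidences \<omega> (fst p) (snd p)}))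
    \<le> card configs * (real c ^ u * (3 * real u / real N) ^ x)"
proof -
  let ?P = "\<lambda>a. {A. A \<subseteq> vars \<and> card A = a} \<times> {B. B \<subseteq> edges \<and> card B = u - a}"
  have fP: "finite (?P a)" for a by (rule finite_subset[of _ "Pow vars \<times> Pow edges"]) auto
  have part: "(\<Sum>p\<in>?P a. real (card {\<omega> \<in> configs. u + x \<le> incidences \<omega> (fst p) (snd p)}))
     \<le> card configs * ((9 * real k * real M) ^ u * (3 * real u / real N) ^ x)" if a: "a \<le> u" for a
  proof -
    have "(\<Sum>p\<in>?P a. real (card {\<omega> \<in> configs. u + x \<le> incidences \<omega> (fst p) (snd p)}))
       \<le> (\<Sum>p\<in>?P a. card configs * (real (a * (u - a) choose (u + x)) / real N ^ (u + x)))"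
    proof (rule sum_mono)
      fix p assume "p \<in> ?P a"
      then have p: "fst p \<subseteq> vars" "snd p \<subseteq> edges" "card (fst p) = a" "card (snd p) = u - a" by auto
      show "real (card {\<omega> \<in> configs. u + x \<le> incidences \<omega> (fst p) (snd p)})
          \<le> card configs * (real (a * (u - a) choose (u + x)) / real N ^ (u + x))"
        using card_incidences_ge[OF p(1,2), of "u + x"] unfolding p(3,4) .
    qed
    also have "\<dots> = card configs * (real ((k * N choose a) * (M * N choose (u - a)) * (a * (u - a) choose (u + x))) / real N ^ (u + x))"
      by (simp add: card_cartesian_product n_subsets mult_ac)
    also have "\<dots> \<le> card configs * (real ((9 * k * M) ^ u * N ^ u * (3 * u) ^ x) / real N ^ (u + x))"
      using choose_triple_bound[OF k M, of a "u - a" N x] a u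
      by (intro mult_left_mono divide_right_mono of_nat_mono) auto
    also have "real ((9 * k * M) ^ u * N ^ u * (3 * u) ^ x) / real N ^ (u + x) = (9 * real k * real M) ^ u * (3 * real u / real N) ^ x"
      using N by (simp add: power_add power_divide)
    finally show ?thesis .
  qed
  have "(\<Sum>p\<in>pairs u. real (card {\<omega> \<in> configs. u + x \<le> incidences \<omega> (fst p) (snd p)}))
     = (\<Sum>a\<le>u. \<Sum>p\<in>?P a. real (card {\<omega> \<in> configs. u + x \<le> incidences \<omega> (fst p) (snd p)}))"
    unfolding pairs_def using fP by (intro sum.UNION_disjoint) auto
  also have "\<dots> \<le> (\<Sum>a\<le>u. card configs * ((9 * real k * real M) ^ u * (3 * real u / real N) ^ x))"
    by (intro sum_mono part) auto
  also have "\<dots> = card configs * (real (Suc u) * (9 * real k * real M) ^ u * (3 * real u / real N) ^ x)"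
    by simp
  also have "\<dots> \<le> card configs * ((2 ^ u * (9 * real k * real M) ^ u) * (3 * real u / real N) ^ x)"
  proof -
    \<comment> \<open>The number of splittings is absorbed by doubling the base, which explains the
      18 in \<open>c\<close>.\<close>
    have "Suc u \<le> 2 ^ u" by (simp add: Suc_leI)
    then have "real (Suc u) \<le> 2 ^ u" by (metis of_nat_le_iff of_nat_numeral of_nat_power)
    then show ?thesis by (intro mult_left_mono mult_right_mono) auto
  qed
  also have "2 ^ u * (9 * real k * real M) ^ u = real c ^ u"
  proof -
    have "2 * (9 * real k * real M) = real c" by simp
    then show ?thesis by (simp only: power_mult_distrib[symmetric])
  qed
  finally show ?thesis .
qed

text \<open>As many incidences as vertices force a cycle. Discarding all edges of such small pairs
  makes every small remaining pair satisfy the count of \<open>acyclic_graph\<close>.\<close>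

definition bad_edges :: "nat \<Rightarrow> (nat \<times> nat \<Rightarrow> nat \<times> nat) \<Rightarrow> nat set" where
  "bad_edges u0 \<omega> = \<Union>{B. \<exists>A. A \<subseteq> vars \<and> B \<subseteq> edges \<and> card A + card B \<le> u0 \<and> card A + card B \<le> incidences \<omega> A B}"

text \<open>Markov's inequality. Weighting each small dense pair by its size \<open>u\<close> bounds
  the expected number of bad edges by \<open>(4 * c) ^ u0\<close>, where the factor 4 absorbs
  \<open>u\<close> and the number of sizes.\<close>

lemma card_many_bad_edges:
  assumes R: "4 * (4 * c) ^ u0 \<le> R"
  shows "4 * card {\<omega> \<in> configs. R \<le> card (bad_edges u0 \<omega>)} \<le> card configs"
proof -
  let ?S = "{\<omega> \<in> configs. R \<le> card (bad_edges u0 \<omega>)}"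
  have c1: "c \<ge> 1" using k M by simp
  have Rpos: "R > 0" using R k M by (metis le_zero_eq mult_eq_0_iff neq0_conv not_one_le_zero power_not_zero zero_neq_numeral)
  have b: "real (card (bad_edges u0 \<omega>)) \<le> (\<Sum>u=1..u0. \<Sum>p\<in>pairs u. real u * of_bool (u + 0 \<le> incidences \<omega> (fst p) (snd p)))" for \<omega>
  proof -
    let ?Q = "\<lambda>u. {p \<in> pairs u. u \<le> incidences \<omega> (fst p) (snd p)}"
    have fQ: "finite (?Q u)" for u using finite_pairs by simp
    have "bad_edges u0 \<omega> \<subseteq> (\<Union>u\<in>{1..u0}. \<Union>p\<in>?Q u. snd p)"
    proof
      fix e assume "e \<in> bad_edges u0 \<omega>"
      then obtain A B where AB: "A \<subseteq> vars" "B \<subseteq> edges" "card A + card B \<le> u0" "card A + card B \<le> incidences \<omega> A B" "e \<in> B"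
        by (auto simp: bad_edges_def)
      have "card B > 0" using AB(2,5) finite_subset[OF AB(2)] by (auto simp: card_gt_0_iff)
      then have "card A + card B \<in> {1..u0}" "(A, B) \<in> ?Q (card A + card B)" using AB by (auto simp: pairs_iff)
      then show "e \<in> (\<Union>u\<in>{1..u0}. \<Union>p\<in>?Q u. snd p)" using AB(5) by force
    qed
    moreover have "finite (\<Union>u\<in>{1..u0}. \<Union>p\<in>?Q u. snd p)"
      using fQ by (auto simp: pairs_iff intro: finite_subset[of _ edges])
    ultimately have "card (bad_edges u0 \<omega>) \<le> card (\<Union>u\<in>{1..u0}. \<Union>p\<in>?Q u. snd p)" by (intro card_mono)
    also have "\<dots> \<le> (\<Sum>u=1..u0. card (\<Union>p\<in>?Q u. snd p))" by (intro card_UN_le) simp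
    also have "\<dots> \<le> (\<Sum>u=1..u0. \<Sum>p\<in>?Q u. card (snd p))" by (intro sum_mono card_UN_le fQ)
    also have "\<dots> \<le> (\<Sum>u=1..u0. \<Sum>p\<in>?Q u. u)" by (intro sum_mono) (auto simp: pairs_iff)
    also have "\<dots> = (\<Sum>u=1..u0. \<Sum>p\<in>pairs u. u * of_bool (u + 0 \<le> incidences \<omega> (fst p) (snd p)))"
    proof (rule sum.cong[OF refl])
      fix u
      show "(\<Sum>p\<in>?Q u. u) = (\<Sum>p\<in>pairs u. u * of_bool (u + 0 \<le> incidences \<omega> (fst p) (snd p)))"
        by (rule sum.mono_neutral_cong_left[OF finite_pairs]) auto
    qed
    finally have "real (card (bad_edges u0 \<omega>)) \<le> real (\<Sum>u=1..u0. \<Sum>p\<in>pairs u. u * of_bool (u + 0 \<le> incidences \<omega> (fst p) (snd p)))"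
      by (rule of_nat_mono)
    then show ?thesis by simp
  qed
  have "real R * card ?S = (\<Sum>\<omega>\<in>?S. real R)" by simp
  also have "\<dots> \<le> (\<Sum>\<omega>\<in>?S. real (card (bad_edges u0 \<omega>)))" by (intro sum_mono) auto
  also have "\<dots> \<le> (\<Sum>\<omega>\<in>configs. real (card (bad_edges u0 \<omega>)))"
    using finite_configs by (intro sum_mono2) auto
  also have "\<dots> \<le> (\<Sum>\<omega>\<in>configs. \<Sum>u=1..u0. \<Sum>p\<in>pairs u. real u * of_bool (u + 0 \<le> incidences \<omega> (fst p) (snd p)))"
    by (intro sum_mono b)
  also have "\<dots> = (\<Sum>u=1..u0. \<Sum>p\<in>pairs u. \<Sum>\<omega>\<in>configs. real u * of_bool (u + 0 \<le> incidences \<omega> (fst p) (snd p)))"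
    by (subst sum.swap, intro sum.cong refl sum.swap)
  also have "\<dots> = (\<Sum>u=1..u0. real u * (\<Sum>p\<in>pairs u. real (card {\<omega> \<in> configs. u + 0 \<le> incidences \<omega> (fst p) (snd p)})))"
  proof -
    have "(\<Sum>\<omega>\<in>configs. real u * of_bool (u + 0 \<le> incidences \<omega> (fst p) (snd p)))
       = real u * real (card {\<omega> \<in> configs. u + 0 \<le> incidences \<omega> (fst p) (snd p)})" for u and p :: "nat set \<times> nat set"
      using finite_configs by (simp add: sum_distrib_left[symmetric] Int_def)
    then show ?thesis by (simp add: sum_distrib_left)
  qed
  also have "\<dots> \<le> (\<Sum>u=1..u0. real u * (card configs * (real c ^ u * (3 * real u / real N) ^ 0)))"
    by (intro sum_mono mult_left_mono sum_pairs_incidences) auto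
  also have "\<dots> \<le> (\<Sum>u=1..u0. 2 ^ u0 * (card configs * real c ^ u0))"
  proof (rule sum_mono)
    fix u assume u: "u \<in> {1..u0}"
    have "u \<le> 2 ^ u" by (simp add: less_imp_le)
    also have "(2::nat) ^ u \<le> 2 ^ u0" using u by (intro power_increasing) auto
    finally have "real u \<le> 2 ^ u0" by (metis of_nat_le_iff of_nat_numeral of_nat_power)
    moreover have "real c ^ u \<le> real c ^ u0" using u c1 by (intro power_increasing) (auto simp del: of_nat_mult)
    ultimately show "real u * (card configs * (real c ^ u * (3 * real u / real N) ^ 0)) \<le> 2 ^ u0 * (card configs * real c ^ u0)"
      by (simp only: power_0 mult_1_right) (intro mult_mono; simp)
  qed
  also have "\<dots> = real u0 * (2 ^ u0 * (card configs * real c ^ u0))" by simp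
  also have "\<dots> \<le> 2 ^ u0 * (2 ^ u0 * (card configs * real c ^ u0))"
    by (intro mult_right_mono) (auto simp: less_imp_le of_nat_less_two_power)
  also have "\<dots> = (4 * real c) ^ u0 * card configs"
  proof -
    have "(4 :: real) ^ n = 2 ^ n * 2 ^ n" for n by (simp flip: power_mult_distrib)
    then show ?thesis unfolding power_mult_distrib[of 4] by (simp only: mult_ac)
  qed
  finally have "real R * card ?S \<le> (4 * real c) ^ u0 * card configs" .
  moreover have "4 * (4 * real c) ^ u0 \<le> real R"
  proof -
    have "real (4 * (4 * c) ^ u0) \<le> real R" using R by (rule of_nat_mono)
    then show ?thesis by simp
  qed
  ultimately have "real R * (4 * real (card ?S)) \<le> real R * card configs"
    using mult_right_mono[of "4 * (4 * real c) ^ u0" "real R" "real (card configs)"] by simp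
  then have "4 * real (card ?S) \<le> card configs" using Rpos by simp
  then show ?thesis by (metis (no_types, lifting) of_nat_le_iff of_nat_mult of_nat_numeral)
qed

text \<open>Union bound over all sizes: the gain \<open>(3 * u / N) ^ x\<close> from the excess
  incidences must beat \<open>c ^ u\<close>. As the excess exceeds \<open>u / (4 * l)\<close>, the
  hypothesis on \<open>N1\<close> suffices and leaves \<open>(1 / 4) ^ u\<close>, which sums to at
  most 1/3.\<close>

lemma card_dense_pairs:
  assumes l: "l \<ge> 1" and N1: "3 * N1 * (4 * c) ^ (4 * l) \<le> N"
  shows "3 * card {\<omega> \<in> configs. \<exists>p\<in>(\<Union>u\<in>{1..N1}. pairs u). (4 * l + 1) * (card (fst p) + card (snd p)) < 4 * l * incidences \<omega> (fst p) (snd p)} \<le> card configs"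
proof -
  \<comment> \<open>The least integer excess that exceeds \<open>u / (4 * l)\<close>.\<close>
  let ?x = "\<lambda>u. Suc (u div (4 * l))"
  let ?G = "\<lambda>u p. {\<omega> \<in> configs. u + ?x u \<le> incidences \<omega> (fst p) (snd p)}"
  let ?S = "{\<omega> \<in> configs. \<exists>p\<in>(\<Union>u\<in>{1..N1}. pairs u). (4 * l + 1) * (card (fst p) + card (snd p)) < 4 * l * incidences \<omega> (fst p) (snd p)}"
  have c1: "real c \<ge> 1" using k M by (metis less_one mult_is_0 not_le of_nat_1 of_nat_le_iff zero_neq_numeral)
  have cover: "?S \<subseteq> (\<Union>u\<in>{1..N1}. \<Union>p\<in>pairs u. ?G u p)"
  proof
    fix \<omega> assume "\<omega> \<in> ?S"
    then obtain u p where p: "\<omega> \<in> configs" "u \<in> {1..N1}" "p \<in> pairs u"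
      "(4 * l + 1) * (card (fst p) + card (snd p)) < 4 * l * incidences \<omega> (fst p) (snd p)" by blast
    have "card (fst p) + card (snd p) = u" using p(3) by (simp add: pairs_iff)
    then have lt: "(4 * l + 1) * u < 4 * l * incidences \<omega> (fst p) (snd p)" using p(4) by simp
    have "4 * l * (u + u div (4 * l)) \<le> (4 * l + 1) * u"
      using times_div_less_eq_dividend[of "4 * l" u] by (simp add: algebra_simps)
    then have "4 * l * (u + u div (4 * l)) < 4 * l * incidences \<omega> (fst p) (snd p)" using lt by linarith
    then have "u + u div (4 * l) < incidences \<omega> (fst p) (snd p)" by simp
    then have "\<omega> \<in> ?G u p" using p(1) by simp
    then show "\<omega> \<in> (\<Union>u\<in>{1..N1}. \<Union>p\<in>pairs u. ?G u p)" using p by blast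
  qed
  have fG: "finite (?G u p)" for u p using finite_configs by simp
  have bnd: "(\<Sum>p\<in>pairs u. real (card (?G u p))) \<le> card configs * (1 / 4) ^ u" if u: "u \<in> {1..N1}" for u
  proof -
    have "3 * u * (4 * c) ^ (4 * l) \<le> 3 * N1 * (4 * c) ^ (4 * l)" using u by (intro mult_le_mono1) auto
    then have "3 * u * (4 * c) ^ (4 * l) \<le> N" by (rule order_trans[OF _ N1])
    then have "real (3 * u * (4 * c) ^ (4 * l)) \<le> real N" by (rule of_nat_mono)
    then have 3: "3 * real u / real N \<le> (1 / (4 * real c)) ^ (4 * l)"
      using N c1 k M by (simp add: field_simps power_divide)
    have "(3 * real u / real N) ^ ?x u \<le> ((1 / (4 * real c)) ^ (4 * l)) ^ ?x u"
      using 3 by (intro power_mono) auto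
    also have "\<dots> = (1 / (4 * real c)) ^ (4 * l * ?x u)" by (simp only: power_mult)
    also have "\<dots> \<le> (1 / (4 * real c)) ^ u"
    proof (intro power_decreasing)
      have "u < 4 * l * ?x u" using l dividend_less_times_div[of "4 * l" u] by simp
      then show "u \<le> 4 * l * ?x u" by simp
      show "1 / (4 * real c) \<le> 1" using c1 by (subst divide_le_eq_1_pos) linarith+
    qed auto
    finally have "real c ^ u * (3 * real u / real N) ^ ?x u \<le> real c ^ u * (1 / (4 * real c)) ^ u"
      by (intro mult_left_mono) auto
    also have "\<dots> = (1 / 4) ^ u"
    proof -
      have "x * (1 / (4 * x)) = 1 / 4" if "x \<ge> 1" for x :: real using that by (simp add: field_simps)
      from this[OF c1] show ?thesis by (simp only: power_mult_distrib[symmetric])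
    qed
    finally have "card configs * (real c ^ u * (3 * real u / real N) ^ ?x u) \<le> card configs * (1 / 4) ^ u"
      by (intro mult_left_mono) auto
    then show ?thesis using sum_pairs_incidences[of u "?x u"] u by simp
  qed
  have "real (card ?S) \<le> real (card (\<Union>u\<in>{1..N1}. \<Union>p\<in>pairs u. ?G u p))"
    using fG finite_pairs by (intro of_nat_mono card_mono cover) auto
  also have "\<dots> \<le> real (\<Sum>u=1..N1. card (\<Union>p\<in>pairs u. ?G u p))" by (intro of_nat_mono card_UN_le) auto
  also have "\<dots> \<le> real (\<Sum>u=1..N1. \<Sum>p\<in>pairs u. card (?G u p))"
    by (intro of_nat_mono sum_mono card_UN_le finite_pairs)
  also have "\<dots> = (\<Sum>u=1..N1. \<Sum>p\<in>pairs u. real (card (?G u p)))" by simp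
  also have "\<dots> \<le> (\<Sum>u=1..N1. card configs * (1 / 4) ^ u)" by (intro sum_mono bnd)
  also have "\<dots> = card configs * (\<Sum>u=1..N1. (1 / 4) ^ u)" by (simp add: sum_distrib_left)
  also have "(\<Sum>u=1..N1. (1 / 4 :: real) ^ u) \<le> 1 / 3"
  proof -
    have "(\<Sum>u=1..n. (1 / 4 :: real) ^ u) = (1 - (1 / 4) ^ n) / 3" for n
      by (induction n) auto
    then show ?thesis by simp
  qed
  finally have "real (card ?S) \<le> card configs * (1 / 3)" by (simp add: mult_left_mono)
  then show ?thesis by linarith
qed

text \<open>Union bound over the \<open>q ^ (k * N)\<close> assignments and at most
  \<open>2 ^ (M * N)\<close> sets of \<open>t\<close> edges that could all be satisfied.\<close>

lemma card_easy_configs: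
  assumes t: "real q ^ (k * N) * 2 ^ (M * N) * ((1 - 1 / real q) ^ k) ^ t \<le> 1 / 4"
  shows "4 * card {\<omega> \<in> configs. \<exists>x\<in>assignments q vars. t \<le> card {e \<in> edges. \<forall>j<k. x (var \<omega> e j) \<noteq> snd (\<omega> (e, j))}} \<le> card configs"
proof -
  let ?sat = "\<lambda>\<omega> x e. \<forall>j<k. x (var \<omega> e j) \<noteq> snd (\<omega> (e, j))"
  let ?S = "{\<omega> \<in> configs. \<exists>x\<in>assignments q vars. t \<le> card {e \<in> edges. ?sat \<omega> x e}}"
  let ?T = "{T. T \<subseteq> edges \<and> card T = t}"
  let ?G = "\<lambda>x T. {\<omega> \<in> configs. \<forall>e\<in>T. ?sat \<omega> x e}"
  have fa: "finite (assignments q vars)" unfolding assignments_def by (intro finite_PiE) auto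
  have fT: "finite ?T" by (rule finite_subset[of _ "Pow edges"]) auto
  have cT: "card ?T \<le> 2 ^ (M * N)" using card_mono[of "Pow edges" ?T] by (auto simp: card_Pow)
  have ca: "card (assignments q vars) = q ^ (k * N)" unfolding assignments_def by (simp add: card_PiE)
  have cover: "?S \<subseteq> (\<Union>x\<in>assignments q vars. \<Union>T\<in>?T. ?G x T)"
  proof
    fix \<omega> assume "\<omega> \<in> ?S"
    then obtain x where x: "\<omega> \<in> configs" "x \<in> assignments q vars" "t \<le> card {e \<in> edges. ?sat \<omega> x e}" by blast
    obtain T where "T \<subseteq> {e \<in> edges. ?sat \<omega> x e}" "card T = t"
      using x(3) by (meson obtain_subset_with_card_n)
    then have "T \<in> ?T" "\<omega> \<in> ?G x T" using x(1) by auto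
    then show "\<omega> \<in> (\<Union>x\<in>assignments q vars. \<Union>T\<in>?T. ?G x T)" using x(2) by blast
  qed
  have "real (card ?S) \<le> real (card (\<Union>x\<in>assignments q vars. \<Union>T\<in>?T. ?G x T))"
    using fa fT finite_configs by (intro of_nat_mono card_mono cover) auto
  also have "\<dots> \<le> real (\<Sum>x\<in>assignments q vars. card (\<Union>T\<in>?T. ?G x T))" using fa by (intro of_nat_mono card_UN_le)
  also have "\<dots> \<le> real (\<Sum>x\<in>assignments q vars. \<Sum>T\<in>?T. card (?G x T))" using fT by (intro of_nat_mono sum_mono card_UN_le)
  also have "\<dots> = (\<Sum>x\<in>assignments q vars. \<Sum>T\<in>?T. real (card (?G x T)))" by simp
  also have "\<dots> \<le> (\<Sum>x\<in>assignments q vars. \<Sum>T\<in>?T. card configs * ((1 - 1 / real q) ^ k) ^ t)"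
  proof (intro sum_mono)
    fix x T assume "x \<in> assignments q vars" "T \<in> ?T"
    then show "real (card (?G x T)) \<le> card configs * ((1 - 1 / real q) ^ k) ^ t"
      using card_all_satisfied[of x T] by (auto simp: assignments_def)
  qed
  also have "\<dots> = (real (card (assignments q vars)) * real (card ?T)) * (card configs * ((1 - 1 / real q) ^ k) ^ t)"
    by (simp only: sum_constant mult.assoc)
  also have "real (card (assignments q vars)) = real q ^ (k * N)" unfolding ca by simp
  also have "(real q ^ (k * N) * real (card ?T)) * (card configs * ((1 - 1 / real q) ^ k) ^ t) \<le> (real q ^ (k * N) * 2 ^ (M * N)) * (card configs * ((1 - 1 / real q) ^ k) ^ t)"
  proof (intro mult_right_mono mult_left_mono)
    show "real (card ?T) \<le> 2 ^ (M * N)" using cT by (metis of_nat_le_iff of_nat_numeral of_nat_power)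
  qed (use q in auto)
  also have "\<dots> = (real q ^ (k * N) * 2 ^ (M * N) * ((1 - 1 / real q) ^ k) ^ t) * card configs" by simp
  also have "\<dots> \<le> 1 / 4 * card configs" using t by (intro mult_right_mono) auto
  finally show ?thesis by linarith
qed

text \<open>The exceptional events have probabilities at most 1/4, 1/3 and 1/4, which add up to less
  than 1.\<close>

lemma good_config_exists:
  assumes l: "l \<ge> 1" and N1: "3 * N1 * (4 * c) ^ (4 * l) \<le> N" and R: "4 * (4 * c) ^ u0 \<le> R"
    and t: "real q ^ (k * N) * 2 ^ (M * N) * ((1 - 1 / real q) ^ k) ^ t \<le> 1 / 4"
  obtains \<omega> where "\<omega> \<in> configs"
    "\<And>x. x \<in> assignments q vars \<Longrightarrow> card {e \<in> edges. \<forall>j<k. x (var \<omega> e j) \<noteq> snd (\<omega> (e, j))} < t"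
    "\<And>A B. A \<subseteq> vars \<Longrightarrow> B \<subseteq> edges \<Longrightarrow> card A + card B \<le> N1 \<Longrightarrow>
       4 * l * incidences \<omega> A B \<le> (4 * l + 1) * (card A + card B)"
    "card (bad_edges u0 \<omega>) < R"
proof -
  let ?S1 = "{\<omega> \<in> configs. \<exists>x\<in>assignments q vars. t \<le> card {e \<in> edges. \<forall>j<k. x (var \<omega> e j) \<noteq> snd (\<omega> (e, j))}}"
  let ?S2 = "{\<omega> \<in> configs. \<exists>p\<in>(\<Union>u\<in>{1..N1}. pairs u). (4 * l + 1) * (card (fst p) + card (snd p)) < 4 * l * incidences \<omega> (fst p) (snd p)}"
  let ?S3 = "{\<omega> \<in> configs. R \<le> card (bad_edges u0 \<omega>)}"
  have "card (?S1 \<union> ?S2 \<union> ?S3) \<le> card ?S1 + card ?S2 + card ?S3"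
    by (meson add_le_mono1 card_Un_le order_trans)
  also have "\<dots> < card configs"
    using card_easy_configs[OF t] card_dense_pairs[OF l N1] card_many_bad_edges[OF R] card_configs_pos by linarith
  finally have "card (?S1 \<union> ?S2 \<union> ?S3) < card configs" .
  then have "\<not> configs \<subseteq> ?S1 \<union> ?S2 \<union> ?S3"
    using finite_configs card_mono[of "?S1 \<union> ?S2 \<union> ?S3" configs] by (auto simp: not_less[symmetric])
  then obtain \<omega> where \<omega>: "\<omega> \<in> configs" "\<omega> \<notin> ?S1" "\<omega> \<notin> ?S2" "\<omega> \<notin> ?S3" by blast
  show thesis
  proof (rule that[OF \<omega>(1)])
    show "card {e \<in> edges. \<forall>j<k. x (var \<omega> e j) \<noteq> snd (\<omega> (e, j))} < t" if "x \<in> assignments q vars" for x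
      using \<omega>(1,2) that by (auto simp: not_le[symmetric])
    show "card (bad_edges u0 \<omega>) < R" using \<omega>(1,4) by (auto simp: not_le[symmetric])
    fix A B assume AB: "A \<subseteq> vars" "B \<subseteq> edges" "card A + card B \<le> N1"
    show "4 * l * incidences \<omega> A B \<le> (4 * l + 1) * (card A + card B)"
    proof (cases "card A + card B = 0")
      case True
      then have "B = {}" using AB(2) finite_subset[of B edges] by auto
      then show ?thesis by (simp add: incidences_def)
    next
      case False
      then have "(A, B) \<in> (\<Union>u\<in>{1..N1}. pairs u)" using AB by (auto simp: pairs_iff)
      then show ?thesis using \<omega>(1,3) by (force simp: not_le[symmetric])
    qed
  qed
qed

end

section \<open>The instance and its local solutions\<close>

lemma posdef_image:
  fixes K :: "'b \<Rightarrow> 'b \<Rightarrow> real"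
  assumes "posdef (f ` X) K" "inj_on f X" "c > 0"
  shows "posdef X (\<lambda>a b. K (f a) (f b) / c)"
  unfolding posdef_def
proof (intro allI impI)
  fix w :: "'a \<Rightarrow> real" assume "\<exists>u\<in>X. w u \<noteq> 0"
  then obtain u where u: "u \<in> X" "w u \<noteq> 0" by blast
  define w' where "w' = w \<circ> the_inv_into X f"
  have w': "w' (f v) = w v" if "v \<in> X" for v
    using the_inv_into_f_f[OF assms(2) that] by (simp add: w'_def)
  have "0 < qform (f ` X) K w'"
    using u w' by (intro posdefD[OF assms(1), of "f u"]) auto
  also have "\<dots> = (\<Sum>a\<in>X. \<Sum>b\<in>X. K (f a) (f b) * w a * w b)"
    unfolding qform_def sum.reindex[OF assms(2)] o_def by (intro sum.cong refl) (simp add: w')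
  also have "\<dots> = c * qform X (\<lambda>a b. K (f a) (f b) / c) w"
    unfolding qform_def sum_distrib_left using assms(3) by (intro sum.cong refl) simp
  finally show "0 < qform X (\<lambda>a b. K (f a) (f b) / c) w"
    using assms(3) by (simp add: zero_less_mult_iff)
qed

lemma length_filter_upt: "length (filter P [0..<n]) = card {e \<in> {..<n}. P e}"
proof -
  have "{i. i < length [0..<n] \<and> P ([0..<n] ! i)} = {e \<in> {..<n}. P e}" by auto
  then show ?thesis unfolding length_filter_conv_card by (simp only:)
qed

context random_incidence
begin

text \<open>Bad edges are isolated in the graph, although their predicates stay in the
  instance.\<close>

definition incident :: "nat \<Rightarrow> (nat \<times> nat \<Rightarrow> nat \<times> nat) \<Rightarrow> nat \<Rightarrow> nat \<Rightarrow> bool" where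
  "incident u0 \<omega> v e \<longleftrightarrow> e \<in> edges - bad_edges u0 \<omega> \<and> (\<exists>j<k. var \<omega> e j = v)"

definition inc_adj :: "nat \<Rightarrow> (nat \<times> nat \<Rightarrow> nat \<times> nat) \<Rightarrow> nat + nat \<Rightarrow> nat + nat \<Rightarrow> bool" where
  "inc_adj u0 \<omega> x y \<longleftrightarrow> (case (x, y) of (Inl v, Inr e) \<Rightarrow> incident u0 \<omega> v e | (Inr e, Inl v) \<Rightarrow> incident u0 \<omega> v e | _ \<Rightarrow> False)"

definition label :: "(nat \<times> nat \<Rightarrow> nat \<times> nat) \<Rightarrow> nat \<Rightarrow> nat \<Rightarrow> nat" where
  "label \<omega> e v = snd (\<omega> (e, (v - 1) div N))"

text \<open>Stepping from a variable to an edge subtracts the forbidden value, stepping back adds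
  it. So \<open>(Inr e, i)\<close> is joined to value \<open>i + label \<omega> e v\<close> of each
  variable \<open>v\<close> in its scope, and equal offsets from the forbidden values are
  matched.\<close>

definition label_shift :: "(nat \<times> nat \<Rightarrow> nat \<times> nat) \<Rightarrow> nat + nat \<Rightarrow> nat + nat \<Rightarrow> nat" where
  "label_shift \<omega> x y = (case (x, y) of (Inl v, Inr e) \<Rightarrow> q - label \<omega> e v | (Inr e, Inl v) \<Rightarrow> label \<omega> e v | _ \<Rightarrow> 0)"

definition scope :: "(nat \<times> nat \<Rightarrow> nat \<times> nat) \<Rightarrow> nat \<Rightarrow> nat set" where
  "scope \<omega> e = var \<omega> e ` {..<k}"

definition ne_instance :: "(nat \<times> nat \<Rightarrow> nat \<times> nat) \<Rightarrow> ne_pred list" where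
  "ne_instance \<omega> = map (\<lambda>e. (scope \<omega> e, restrict (label \<omega> e) (scope \<omega> e))) [0..<M * N]"

lemma label_var:
  assumes "\<omega> \<in> configs" "e < M * N" "j < k"
  shows "label \<omega> e (var \<omega> e j) = snd (\<omega> (e, j))"
  unfolding label_def var_div_mod(1)[OF assms] ..

lemma scope_props:
  assumes "\<omega> \<in> configs" "e < M * N"
  shows "scope \<omega> e \<subseteq> vars" "card (scope \<omega> e) = k" "\<And>v. v \<in> scope \<omega> e \<Longrightarrow> label \<omega> e v < q"
proof -
  show "scope \<omega> e \<subseteq> vars" unfolding scope_def using var_mem[OF assms] by blast
  have "inj_on (var \<omega> e) {..<k}"
  proof (rule inj_onI)
    fix i j assume "i \<in> {..<k}" "j \<in> {..<k}" "var \<omega> e i = var \<omega> e j"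
    then show "i = j" using var_div_mod(1)[OF assms, of i] var_div_mod(1)[OF assms, of j] by simp
  qed
  then show "card (scope \<omega> e) = k" unfolding scope_def by (simp add: card_image)
  show "label \<omega> e v < q" if "v \<in> scope \<omega> e" for v
    using that label_var[OF assms] config_mem(2)[OF assms] unfolding scope_def by auto
qed

lemma ne_csp_ne_instance:
  assumes "\<omega> \<in> configs"
  shows "ne_csp q k (k * N) (ne_instance \<omega>)"
proof -
  have "scope \<omega> e \<subseteq> vars \<and> card (scope \<omega> e) = k \<and> restrict (label \<omega> e) (scope \<omega> e) \<in> assignments q (scope \<omega> e)"
    if "e < M * N" for e
    using scope_props[OF assms that] unfolding assignments_def by auto
  moreover have "M * N > 0" using M N by simp
  ultimately show ?thesis unfolding ne_csp_def ne_instance_def by auto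
qed

lemma ne_opt_ne_instance:
  assumes \<omega>: "\<omega> \<in> configs"
    and sat: "\<And>x. x \<in> assignments q vars \<Longrightarrow> real (card {e \<in> edges. \<forall>j<k. x (var \<omega> e j) \<noteq> snd (\<omega> (e, j))}) \<le> \<epsilon> * real (M * N)"
  shows "ne_opt q (k * N) (ne_instance \<omega>) \<le> \<epsilon>"
  unfolding ne_opt_def
proof (rule Max.boundedI)
  show "finite (frac_sat (ne_instance \<omega>) ` assignments q vars)"
    unfolding assignments_def by (intro finite_imageI finite_PiE) auto
  show "frac_sat (ne_instance \<omega>) ` assignments q vars \<noteq> {}"
    using q by (auto simp: assignments_def PiE_eq_empty_iff lessThan_empty_iff)
  fix y assume "y \<in> frac_sat (ne_instance \<omega>) ` assignments q vars"
  then obtain x where x: "x \<in> assignments q vars" "y = frac_sat (ne_instance \<omega>) x" by blast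
  have "length (filter (\<lambda>P. ne_sat P x) (ne_instance \<omega>))
     = card {e \<in> edges. ne_sat (scope \<omega> e, restrict (label \<omega> e) (scope \<omega> e)) x}"
    unfolding ne_instance_def filter_map length_map o_def by (rule length_filter_upt)
  also have "{e \<in> edges. ne_sat (scope \<omega> e, restrict (label \<omega> e) (scope \<omega> e)) x}
     = {e \<in> edges. \<forall>j<k. x (var \<omega> e j) \<noteq> snd (\<omega> (e, j))}"
    using label_var[OF \<omega>] by (auto simp: ne_sat_def scope_def)
  finally have "real (length (filter (\<lambda>P. ne_sat P x) (ne_instance \<omega>))) \<le> \<epsilon> * real (M * N)"
    using sat[OF x(1)] by simp
  moreover have "length (ne_instance \<omega>) = M * N" by (simp add: ne_instance_def)
  moreover have "real (M * N) > 0" using M N by simp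
  ultimately show "y \<le> \<epsilon>" unfolding x(2) frac_sat_def by (simp only: pos_divide_le_eq)
qed

lemma sgraph_inc_adj: "sgraph (inc_adj u0 \<omega>)"
  by standard (auto simp: inc_adj_def split: sum.splits)

text \<open>Translates degree sums into the counts controlled by the random model: each incidence
  accounts for at most one edge of the graph, and vertices outside the ranges of variables and good
  edges are isolated.\<close>

lemma inc_adj_degree_sum:
  assumes \<omega>: "\<omega> \<in> configs" and W: "finite W"
  obtains A B where "A \<subseteq> vars" "B \<subseteq> edges - bad_edges u0 \<omega>" "card A + card B \<le> card W"
    "(\<Sum>x\<in>W. card (nbrs (inc_adj u0 \<omega>) W x)) \<le> 2 * incidences \<omega> A B"
proof -
  define A where "A = {v \<in> vars. Inl v \<in> W}"
  define B where "B = {e \<in> edges - bad_edges u0 \<omega>. Inr e \<in> W}"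
  let ?I = "{p \<in> B \<times> {..<k}. var \<omega> (fst p) (snd p) \<in> A}"
  let ?f = "\<lambda>p. (Inl (var \<omega> (fst p) (snd p)), Inr (fst p)) :: (nat + nat) \<times> (nat + nat)"
  have fB: "finite B" unfolding B_def by simp
  have fA: "finite A" unfolding A_def by simp
  have fI: "finite ?I" using fB by simp
  have "(SIGMA x:W. nbrs (inc_adj u0 \<omega>) W x) \<subseteq> ?f ` ?I \<union> (prod.swap \<circ> ?f) ` ?I"
  proof
    fix d assume "d \<in> (SIGMA x:W. nbrs (inc_adj u0 \<omega>) W x)"
    then obtain x y where xy: "d = (x, y)" "x \<in> W" "y \<in> W" "inc_adj u0 \<omega> x y" by (auto simp: nbrs_def)
    then obtain v e where ve: "x = Inl v \<and> y = Inr e \<or> x = Inr e \<and> y = Inl v" "incident u0 \<omega> v e"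
      by (auto simp: inc_adj_def split: sum.splits)
    then obtain j where j: "e \<in> edges - bad_edges u0 \<omega>" "j < k" "var \<omega> e j = v" by (auto simp: incident_def)
    have "v \<in> vars" using var_mem[OF \<omega> _ j(2), of e] j by auto
    then have "(e, j) \<in> ?I" using xy ve j by (auto simp: A_def B_def)
    moreover have "d = ?f (e, j) \<or> d = (prod.swap \<circ> ?f) (e, j)" using xy ve j by auto
    ultimately show "d \<in> ?f ` ?I \<union> (prod.swap \<circ> ?f) ` ?I" by blast
  qed
  then have "card (SIGMA x:W. nbrs (inc_adj u0 \<omega>) W x) \<le> card (?f ` ?I \<union> (prod.swap \<circ> ?f) ` ?I)"
    using fI by (intro card_mono) auto
  also have "\<dots> \<le> card (?f ` ?I) + card ((prod.swap \<circ> ?f) ` ?I)" by (rule card_Un_le)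
  also have "\<dots> \<le> card ?I + card ?I" using fI by (intro add_mono card_image_le)
  also have "\<dots> = 2 * incidences \<omega> A B" by (simp add: incidences_def)
  also have "card (SIGMA x:W. nbrs (inc_adj u0 \<omega>) W x) = (\<Sum>x\<in>W. card (nbrs (inc_adj u0 \<omega>) W x))"
    using W by (intro card_SigmaI) (auto simp: nbrs_def)
  finally have s: "(\<Sum>x\<in>W. card (nbrs (inc_adj u0 \<omega>) W x)) \<le> 2 * incidences \<omega> A B" .
  have "card A + card B = card (Inl ` A \<union> Inr ` B)"
    using fA fB by (subst card_Un_disjoint) (auto simp: card_image)
  also have "\<dots> \<le> card W" using W by (intro card_mono) (auto simp: A_def B_def)
  finally have "card A + card B \<le> card W" .
  then show ?thesis using s by (intro that[of A B]) (auto simp: A_def B_def)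
qed

text \<open>If the count failed on a small set, its good edges would by definition be bad. Then the
  set contains no good edge at all and its degree sum is 0.\<close>

lemma acyclic_inc_adj:
  assumes \<omega>: "\<omega> \<in> configs"
  shows "acyclic_graph (inc_adj u0 \<omega>) u0"
proof -
  interpret sgraph "inc_adj u0 \<omega>" by (rule sgraph_inc_adj)
  show ?thesis
  proof
    fix W :: "(nat + nat) set" assume W: "finite W" "W \<noteq> {}" "card W \<le> u0"
    obtain A B where AB: "A \<subseteq> vars" "B \<subseteq> edges - bad_edges u0 \<omega>" "card A + card B \<le> card W"
      "(\<Sum>x\<in>W. card (nbrs (inc_adj u0 \<omega>) W x)) \<le> 2 * incidences \<omega> A B"
      by (rule inc_adj_degree_sum[OF \<omega> W(1)])
    have cW: "card W > 0" using W by (simp add: card_gt_0_iff)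
    show "(\<Sum>x\<in>W. card (nbrs (inc_adj u0 \<omega>) W x)) < 2 * card W"
    proof (cases "card A + card B \<le> incidences \<omega> A B")
      case True
      have "B \<subseteq> bad_edges u0 \<omega>"
        unfolding bad_edges_def using AB True W(3) by (intro Union_upper CollectI exI[of _ A]) auto
      then have "B = {}" using AB(2) by blast
      then have "incidences \<omega> A B = 0" by (simp add: incidences_def)
      then show ?thesis using AB(4) cW by linarith
    next
      case False
      then show ?thesis using AB by linarith
    qed
  qed
qed

lemma inc_adj_sparse:
  assumes \<omega>: "\<omega> \<in> configs"
    and sparse: "\<And>A B. A \<subseteq> vars \<Longrightarrow> B \<subseteq> edges \<Longrightarrow> card A + card B \<le> N1 \<Longrightarrow>
       4 * l * incidences \<omega> A B \<le> (4 * l + 1) * (card A + card B)"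
    and W: "finite W" "card W \<le> N1"
  shows "4 * l * (\<Sum>x\<in>W. card (nbrs (inc_adj u0 \<omega>) W x)) \<le> (8 * l + 2) * card W"
proof -
  obtain A B where AB: "A \<subseteq> vars" "B \<subseteq> edges - bad_edges u0 \<omega>" "card A + card B \<le> card W"
    "(\<Sum>x\<in>W. card (nbrs (inc_adj u0 \<omega>) W x)) \<le> 2 * incidences \<omega> A B"
    by (rule inc_adj_degree_sum[OF \<omega> W(1)])
  have "4 * l * (\<Sum>x\<in>W. card (nbrs (inc_adj u0 \<omega>) W x)) \<le> 4 * l * (2 * incidences \<omega> A B)"
    by (intro mult_le_mono2 AB)
  also have "\<dots> = 2 * (4 * l * incidences \<omega> A B)" by simp
  also have "\<dots> \<le> 2 * ((4 * l + 1) * (card A + card B))"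
    using AB W by (intro mult_le_mono2 sparse) auto
  also have "\<dots> \<le> 2 * ((4 * l + 1) * card W)" by (intro mult_le_mono2 AB)
  finally show ?thesis by (simp add: algebra_simps)
qed

lemma label_shift_inverse:
  assumes \<omega>: "\<omega> \<in> configs" and a: "inc_adj u0 \<omega> x y"
  shows "(label_shift \<omega> x y + label_shift \<omega> y x) mod q = 0"
proof -
  obtain v e where ve: "x = Inl v \<and> y = Inr e \<or> x = Inr e \<and> y = Inl v" "incident u0 \<omega> v e"
    using a by (auto simp: inc_adj_def split: sum.splits)
  then have "v \<in> scope \<omega> e" "e < M * N" by (auto simp: incident_def scope_def)
  then have "label \<omega> e v < q" using scope_props(3)[OF \<omega>] by blast
  then show ?thesis using ve(1) by (auto simp: label_shift_def)
qed

text \<open>Collects all numerical requirements, so that only the choice of parameters remains. Half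
  of \<open>\<epsilon>\<close> pays for disagreement inside good edges, the other half for the bad
  edges.\<close>

lemma sa_gap_instance:
  fixes \<rho> \<zeta> \<epsilon> s :: real
  assumes r: "0 < \<rho>" "\<rho> < 1" and \<zeta>: "\<zeta> > 0" and h: "h \<ge> 1" and \<epsilon>: "\<epsilon> > 0"
    and N1: "3 * N1 * (4 * c) ^ (8 * h) \<le> N"
    and R: "4 * (4 * c) ^ (4 * h + 6) \<le> R" "real R \<le> \<epsilon> / 2 * real (M * N)"
    and t: "real q ^ (k * N) * 2 ^ (M * N) * ((1 - 1 / real q) ^ k) ^ t \<le> 1 / 4" "real t - 1 \<le> \<epsilon> * real (M * N)"
    and small: "2 * \<rho> ^ (2 * h) / (1 - \<rho>\<^sup>2) * real N1 \<le> 1 / 8"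
    and small': "2 * (\<rho> ^ (2 * h + 1))\<^sup>2 * (real (N1 * q)) ^ 5 / (1 - \<rho>\<^sup>2)\<^sup>2 < \<zeta>"
    and rd: "rd\<^sup>2 * (2 * h + 1) \<le> N1" "k \<le> rd"
    and s: "s > 0" "real k * ((real q)\<^sup>2 * (s + 16 * (1 - \<rho>\<^sup>2 / (1 + \<zeta>)) / s\<^sup>2)) \<le> \<epsilon> / 2"
  shows "\<exists>I D. ne_csp q k (k * N) I \<and> ne_opt q (k * N) I \<le> \<epsilon> \<and> sa_solution q (k * N) rd D \<and>
    sa_value I D \<ge> 1 - 1 / real q - \<epsilon>"
proof -
  let ?u0 = "4 * h + 6" and ?L = "2 * h"
  have q0: "q > 0" using q by simp
  have N1': "3 * N1 * (4 * c) ^ (4 * (2 * h)) \<le> N" using N1 by simp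
  obtain \<omega> where \<omega>: "\<omega> \<in> configs"
    and sat: "\<And>x. x \<in> assignments q vars \<Longrightarrow> card {e \<in> edges. \<forall>j<k. x (var \<omega> e j) \<noteq> snd (\<omega> (e, j))} < t"
    and sparse: "\<And>A B. A \<subseteq> vars \<Longrightarrow> B \<subseteq> edges \<Longrightarrow> card A + card B \<le> N1 \<Longrightarrow>
       4 * (2 * h) * incidences \<omega> A B \<le> (4 * (2 * h) + 1) * (card A + card B)"
    and bad: "card (bad_edges ?u0 \<omega>) < R"
    by (rule good_config_exists[OF _ N1' R(1) t(1)]) (use h in auto)
  define adj where "adj = inc_adj ?u0 \<omega>"
  define sh where "sh = label_shift \<omega>"
  interpret G: acyclic_graph adj ?u0 unfolding adj_def by (rule acyclic_inc_adj[OF \<omega>])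
  interpret S: shift_graph adj q sh
    by standard (use q0 label_shift_inverse[OF \<omega>] in \<open>auto simp: adj_def sh_def\<close>)
  interpret U: unique_walks adj ?L
    by standard (use G.nbwalk_unique in auto)
  interpret LU: unique_walks S.ladj ?L by (rule S.unique_walks_lift) unfold_locales
  let ?k = "walk_kernel S.ladj \<rho> ?L"
  define f :: "nat \<times> nat \<Rightarrow> (nat + nat) \<times> nat" where "f x = (Inl (fst x), snd x)" for x
  \<comment> \<open>Dividing by \<open>1 + \<zeta>\<close> restores unit variances after the
    diagonal has been raised.\<close>
  define K where "K x y = (?k (f x) (f y) + \<zeta> * of_bool (f x = f y)) / (1 + \<zeta>)" for x y :: "nat \<times> nat"
  have finj: "f x = f y \<longleftrightarrow> x = y" for x y by (auto simp: f_def prod_eq_iff)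
  have Ksym: "K x y = K y x" for x y
    unfolding K_def using LU.walk_kernel_sym[of \<rho> "f x" "f y"] by (simp add: eq_commute)
  have pd: "posdef (T \<times> {..<q}) K" if T: "T \<subseteq> vars" "card T \<le> rd" for T
  proof -
    have fT: "finite T" using T finite_subset[OF T(1)] by simp
    have "(card T)\<^sup>2 * (2 * h + 1) \<le> rd\<^sup>2 * (2 * h + 1)" using T by (intro mult_le_mono1 power_mono) auto
    then have cT: "(card (Inl ` T :: (nat + nat) set))\<^sup>2 * (2 * h + 1) \<le> N1" using rd by (simp add: card_image)
    have "posdef (Inl ` T \<times> {..<q}) (\<lambda>x y. ?k x y + \<zeta> * of_bool (x = y))"
    proof (rule G.walk_kernel_local_posdef[OF r q0 S.shift h _ _ small _ cT small'])
      show "4 * (2 * h) * (\<Sum>x\<in>W. card (nbrs adj W x)) \<le> (8 * (2 * h) + 2) * card W"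
        if "finite W" "card W \<le> N1" for W
        unfolding adj_def by (rule inc_adj_sparse[OF \<omega> sparse that])
    qed (use fT in auto)
    moreover have "Inl ` T \<times> {..<q} = f ` (T \<times> {..<q})" by (force simp: f_def)
    ultimately have "posdef (f ` (T \<times> {..<q})) (\<lambda>x y. ?k x y + \<zeta> * of_bool (x = y))" by simp
    from posdef_image[OF this, of "1 + \<zeta>"] show ?thesis
      using \<zeta> finj unfolding K_def by (simp add: inj_on_def)
  qed
  \<comment> \<open>A short walk between two different values of one variable would project to a
    closed walk. By uniqueness that is the trivial walk, which does not change the value.\<close>
  have diag: "K (v, i) (v, j) = of_bool (i = j)" if ij: "i < q" "j < q" for v i j
  proof (cases "i = j")
    case True
    then show ?thesis using \<zeta> LU.walk_kernel_refl by (simp add: K_def)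
  next
    case False
    have "?k (f (v, i)) (f (v, j)) = 0"
    proof (rule LU.walk_kernel_0)
      fix d assume d: "d \<le> ?L"
      show "\<not> nbdist S.ladj d (f (v, i)) (f (v, j))"
      proof
        assume "nbdist S.ladj d (f (v, i)) (f (v, j))"
        then obtain xs where xs: "nbwalk S.ladj xs" "hd xs = f (v, i)" "last xs = f (v, j)" "length xs = Suc d"
          by (auto simp: nbdist_def)
        have ne: "xs \<noteq> []" using xs by auto
        have "map fst xs = [Inl v]"
          using xs ne d S.nbwalk_lift[OF xs(1)]
          by (intro U.uniq) (auto simp: hd_map last_map f_def nbwalk_def)
        then have "length xs = 1" by (metis length_map One_nat_def length_Cons list.size(3))
        then have "hd xs = last xs" by (cases xs) auto
        then show False using xs False by (simp add: f_def)
      qed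
    qed
    then show ?thesis using False by (simp add: K_def f_def)
  qed
  define \<kappa> where "\<kappa> = \<rho>\<^sup>2 / (1 + \<zeta>)"
  have \<kappa>: "0 \<le> \<kappa>" "\<kappa> < 1"
  proof -
    have "\<rho>\<^sup>2 < 1" using r by (simp add: power_less_one_iff)
    then show "0 \<le> \<kappa>" "\<kappa> < 1" using \<zeta> by (auto simp: \<kappa>_def field_simps)
  qed
  then have \<kappa>2: "\<kappa>\<^sup>2 < 1" by (simp add: power_less_one_iff)
  let ?D = "rounded_pmf q K"
  have good: "measure_pmf.prob (?D (scope \<omega> e)) {\<alpha>. ne_sat (scope \<omega> e, restrict (label \<omega> e) (scope \<omega> e)) \<alpha>}
      \<ge> 1 - 1 / real q - \<epsilon> / 2" if e: "e \<in> edges - bad_edges ?u0 \<omega>" for e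
  proof -
    have eM: "e < M * N" using e by auto
    let ?S = "scope \<omega> e" and ?a = "restrict (label \<omega> e) (scope \<omega> e)"
    note sp = scope_props[OF \<omega> eM]
    have kk: "K (u, (i + ?a u) mod q) (v, (i + ?a v) mod q) = \<kappa>"
      if uv: "u \<in> ?S" "v \<in> ?S" "u \<noteq> v" and i: "i < q" for u v i
    proof -
      have inc: "incident ?u0 \<omega> w e" if "w \<in> ?S" for w
        using that e unfolding incident_def scope_def by blast
      have cancel: "((i + label \<omega> e w) mod q + (q - label \<omega> e w)) mod q = i" if "w \<in> ?S" for w
      proof -
        have "((i + label \<omega> e w) mod q + (q - label \<omega> e w)) mod q = (i + label \<omega> e w + (q - label \<omega> e w)) mod q"
          by (rule mod_add_left_eq)
        also have "i + label \<omega> e w + (q - label \<omega> e w) = i + q" using sp(3)[OF that] by simp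
        finally show ?thesis using i by simp
      qed
      \<comment> \<open>The walk of length 2 through the edge joins matched values, and so the
        correlation is \<open>\<rho>\<^sup>2 / (1 + \<zeta>)\<close>.\<close>
      let ?xs = "[f (u, (i + label \<omega> e u) mod q), (Inr e, i), f (v, (i + label \<omega> e v) mod q)]"
      have "S.ladj (f (u, (i + label \<omega> e u) mod q)) (Inr e, i)"
        using inc[OF uv(1)] cancel[OF uv(1)] q0 i
        by (simp add: lift_adj_def f_def adj_def inc_adj_def sh_def label_shift_def)
      moreover have "S.ladj (Inr e, i) (f (v, (i + label \<omega> e v) mod q))"
        using inc[OF uv(2)] q0 i
        by (simp add: lift_adj_def f_def adj_def inc_adj_def sh_def label_shift_def)
      moreover have "f (u, (i + label \<omega> e u) mod q) \<noteq> f (v, (i + label \<omega> e v) mod q)"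
        using uv by (simp add: f_def)
      ultimately have "nbwalk S.ladj ?xs" by (auto simp: nbwalk_def less_Suc_eq nth_Cons')
      then have "nbdist S.ladj 2 (f (u, (i + label \<omega> e u) mod q)) (f (v, (i + label \<omega> e v) mod q))"
        unfolding nbdist_def by (intro exI[of _ ?xs]) simp
      from LU.walk_kernel_eq[OF this, of \<rho>] show ?thesis
        using h uv by (simp add: K_def finj \<kappa>_def)
    qed
    have "1 - 1 / real q - real (card ?S) * ((real q)\<^sup>2 * (s + 16 * (1 - \<kappa>) / s\<^sup>2))
        \<le> measure_pmf.prob (?D ?S) {\<alpha>. ne_sat (?S, ?a) \<alpha>}"
    proof (rule rounded_pmf_ne_sat[OF q0 Ksym])
      show "finite ?S" "?S \<noteq> {}" using k by (auto simp: scope_def lessThan_empty_iff)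
      show "posdef (?S \<times> {..<q}) K" using sp rd by (intro pd) auto
      show "?a \<in> ?S \<rightarrow> {..<q}" using sp(3) by auto
      show "\<kappa>\<^sup>2 < 1" by (rule \<kappa>2)
      show "s > 0" by (rule s)
    qed (use diag kk in auto)
    then show ?thesis using s(2) unfolding sp(2) \<kappa>_def by linarith
  qed
  have "sa_solution q (k * N) rd ?D"
    using pd by (intro rounded_pmf_sa_solution[OF q0 Ksym])
  moreover have "sa_value (ne_instance \<omega>) ?D \<ge> 1 - 1 / real q - \<epsilon>"
  proof -
    let ?p = "\<lambda>e. measure_pmf.prob (?D (scope \<omega> e)) {\<alpha>. ne_sat (scope \<omega> e, restrict (label \<omega> e) (scope \<omega> e)) \<alpha>}"
    have m: "real (M * N) > 0" using M N by simp
    have bsub: "bad_edges ?u0 \<omega> \<subseteq> edges" by (auto simp: bad_edges_def)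
    \<comment> \<open>A bad edge is charged a full unit, since nothing is known about its
      probability beyond being nonnegative.\<close>
    have "(\<Sum>e\<in>edges. (1 - 1 / real q - \<epsilon> / 2) - of_bool (e \<in> bad_edges ?u0 \<omega>)) \<le> (\<Sum>e\<in>edges. ?p e)"
    proof (rule sum_mono)
      fix e assume e: "e \<in> edges"
      show "(1 - 1 / real q - \<epsilon> / 2) - of_bool (e \<in> bad_edges ?u0 \<omega>) \<le> ?p e"
      proof (cases "e \<in> bad_edges ?u0 \<omega>")
        case True
        have "0 \<le> 1 / real q" by simp
        then have "(1 - 1 / real q - \<epsilon> / 2) - 1 \<le> 0" using \<epsilon> by linarith
        also have "0 \<le> ?p e" by simp
        finally show ?thesis using True by simp
      qed (use good e in auto)
    qed
    moreover have "(\<Sum>e\<in>edges. (1 - 1 / real q - \<epsilon> / 2) - of_bool (e \<in> bad_edges ?u0 \<omega>))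
       = real (M * N) * (1 - 1 / real q - \<epsilon> / 2) - card (bad_edges ?u0 \<omega>)"
    proof -
      have "(\<Sum>e\<in>edges. of_bool (e \<in> bad_edges ?u0 \<omega>) :: real) = card (bad_edges ?u0 \<omega>)"
        using bsub by (simp add: Int_absorb1)
      then show ?thesis
        by (subst sum_subtractf) (simp only: sum_constant card_lessThan)
    qed
    moreover have "real (card (bad_edges ?u0 \<omega>)) \<le> \<epsilon> / 2 * real (M * N)"
    proof -
      have "real (card (bad_edges ?u0 \<omega>)) \<le> real R" using bad by simp
      then show ?thesis using R(2) by (rule order_trans)
    qed
    ultimately have "real (M * N) * (1 - 1 / real q - \<epsilon>) \<le> (\<Sum>e\<in>edges. ?p e)"
      by (simp add: algebra_simps)
    moreover have "sa_value (ne_instance \<omega>) ?D = (\<Sum>e\<in>edges. ?p e) / real (M * N)"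
      unfolding sa_value_def ne_instance_def
      by (simp add: o_def interv_sum_list_conv_sum_set_nat atLeast0LessThan)
    ultimately show ?thesis using m by (simp only: pos_le_divide_eq mult.commute)
  qed
  moreover have "ne_opt q (k * N) (ne_instance \<omega>) \<le> \<epsilon>"
  proof (rule ne_opt_ne_instance[OF \<omega>])
    fix x assume "x \<in> assignments q vars"
    from sat[OF this] show "real (card {e \<in> edges. \<forall>j<k. x (var \<omega> e j) \<noteq> snd (\<omega> (e, j))}) \<le> \<epsilon> * real (M * N)"
      using t(2) by linarith
  qed
  ultimately show ?thesis using ne_csp_ne_instance[OF \<omega>] by blast
qed

end

section \<open>Asymptotics and the choice of parameters\<close>

lemma linear_times_power_tendsto_0:
  fixes x :: real
  assumes "0 \<le> x" "x < 1"
  shows "(\<lambda>h. (2 * real h + 1) * x ^ h) \<longlonglongrightarrow> 0"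
proof -
  have "(\<lambda>h. real h * x ^ h) \<longlonglongrightarrow> 0" using assms by (intro powser_times_n_limit_0) simp
  moreover have "(\<lambda>h. x ^ h) \<longlonglongrightarrow> 0" using assms by (intro LIMSEQ_realpow_zero)
  ultimately have "(\<lambda>h. 2 * (real h * x ^ h) + x ^ h) \<longlonglongrightarrow> 2 * 0 + 0"
    by (intro tendsto_add tendsto_mult tendsto_const)
  then show ?thesis by (simp add: algebra_simps)
qed

text \<open>The exponent is designed so that the squared number of rounds is a constant times
  \<open>(1 / x) ^ h\<close> when the number of variables is
  \<open>a * B ^ (16 * h)\<close>.\<close>

lemma powr_const_times_power:
  fixes B x :: real
  assumes B: "B > 1" and x: "0 < x" and a: "a > 0"
  shows "((a * B ^ (16 * h)) powr (ln (1 / x) / (32 * ln B)))\<^sup>2 = (a powr (ln (1 / x) / (32 * ln B)))\<^sup>2 * (1 / x) ^ h"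
proof -
  let ?\<kappa> = "ln (1 / x) / (32 * ln B)"
  have l: "ln B > 0" using B by simp
  have "((B ^ (16 * h)) powr ?\<kappa>)\<^sup>2 = exp (2 * (?\<kappa> * (real (16 * h) * ln B)))"
    using B by (simp add: powr_def ln_realpow power2_eq_square exp_add[symmetric])
  also have "2 * (?\<kappa> * (real (16 * h) * ln B)) = real h * ln (1 / x)"
    using l by (simp add: field_simps)
  also have "exp (real h * ln (1 / x)) = (1 / x) ^ h"
    using x by (simp add: exp_of_nat_mult)
  finally show ?thesis using a B by (simp add: powr_mult power_mult_distrib)
qed

text \<open>All constants are fixed from \<open>\<epsilon>\<close> and \<open>q\<close>; only then
  does \<open>h\<close> tend to infinity. Each remaining requirement asks that a constant multiple
  of \<open>(2 * h + 1) * x ^ h\<close> be small, so all of them hold for large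
  \<open>h\<close>.\<close>

theorem theorem6:
  fixes \<epsilon> :: real and q :: nat
  assumes "\<epsilon> > 0" and "q \<ge> 2"
  shows "\<exists>(\<kappa>::real) (k::nat). \<kappa> > 0 \<and> k \<ge> 1 \<and>
    infinite {n::nat. \<exists>I. ne_csp q k n I \<and>
      ne_opt q n I \<le> \<epsilon> \<and>
      k \<le> nat \<lfloor>real n powr \<kappa>\<rfloor> \<and>
      (\<exists>D. sa_solution q n (nat \<lfloor>real n powr \<kappa>\<rfloor>) D \<and>
           sa_value I D \<ge> 1 - 1 / real q - \<epsilon>)}"
proof -
  let ?p = "1 - 1 / real q"
  have p: "0 \<le> ?p" "?p < 1" using assms(2) by auto
  obtain K :: nat where K: "1 / \<epsilon> \<le> real K" using real_arch_simple by blast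
  have K1: "K \<ge> 1"
  proof (rule ccontr)
    assume "\<not> K \<ge> 1"
    then have "K = 0" by simp
    then have "1 / \<epsilon> \<le> 0" using K by simp
    moreover have "1 / \<epsilon> > 0" using assms(1) by simp
    ultimately show False by linarith
  qed
  \<comment> \<open>With \<open>K \<ge> 1 / \<epsilon>\<close>, satisfying
    \<open>\<epsilon> * M * N\<close> edges has probability at most
    \<open>(1 / 4) ^ (M * N)\<close>, which beats the \<open>2 ^ (M * N)\<close> choices of these
    edges.\<close>
  obtain k :: nat where k: "?p ^ k < (1 / 4) ^ K"
    using real_arch_pow_inv[of "(1 / 4 :: real) ^ K" ?p] p by auto
  have k1: "k \<ge> 1"
  proof (rule ccontr)
    assume "\<not> k \<ge> 1"
    then have "k = 0" by simp
    then have "1 < (1 / 4 :: real) ^ K" using k by simp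
    moreover have "(1 / 4 :: real) ^ K \<le> 1" by (intro power_le_one) auto
    ultimately show False by simp
  qed
  \<comment> \<open>The surviving factor \<open>(1 / 2) ^ (M * N)\<close> must beat the
    \<open>q ^ (k * N)\<close> assignments, with \<open>(1 / 4) ^ N\<close> to spare.\<close>
  obtain M :: nat where M: "4 * real q ^ k < 2 ^ M" using real_arch_pow[of 2 "4 * real q ^ k"] by auto
  have qk: "real q ^ k \<ge> 1" using assms(2) by (intro one_le_power) auto
  have M1: "M \<ge> 1"
  proof (rule ccontr)
    assume "\<not> M \<ge> 1"
    then have "M = 0" by simp
    then show False using M qk by simp
  qed
  define B where "B = 4 * (18 * k * M)"
  have B2: "B \<ge> 2" using k1 M1 by (simp add: B_def)
  then have B2r: "real B \<ge> 2" by simp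
  \<comment> \<open>Chosen so that \<open>k * q\<^sup>2 * (s + s) = \<epsilon> / 2\<close>; the
    second \<open>s\<close> is room for the deviation term.\<close>
  define s where "s = \<epsilon> / (4 * real k * (real q)\<^sup>2)"
  have q0: "real q > 0" using assms(2) by simp
  have s0: "s > 0" unfolding s_def using assms(1) k1 q0 by simp
  \<comment> \<open>The loss of correlation is at most
    \<open>3 * (1 - \<rho>) \<le> 12 * (1 - x)\<close>, and 192 turns this into
    \<open>s ^ 3 / 16\<close>. The bound \<open>x \<ge> 1 / 2\<close> lets powers of
    \<open>1 / x\<close> be compared with powers of \<open>B\<close>.\<close>
  define x where "x = 1 - min (1 / 2) (s ^ 3 / 192)"
  have x: "1 / 2 \<le> x" "x < 1" "1 - x \<le> s ^ 3 / 192" using s0 by (auto simp: x_def)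
  \<comment> \<open>The fourth power gives \<open>\<rho> ^ (4 * h) = x ^ (16 * h)\<close>, ample
    against the fifth power of a set size of order \<open>(2 * h + 1) / x ^ h\<close>.\<close>
  define \<rho> where "\<rho> = x ^ 4"
  have r: "0 < \<rho>" "\<rho> < 1" unfolding \<rho>_def using x by (auto simp: power_less_one_iff)
  have r1: "1 - \<rho> \<le> 4 * (1 - x)"
    using Bernoulli_inequality[of "x - 1" 4] x by (simp add: \<rho>_def)
  define \<zeta> where "\<zeta> = 1 - \<rho>"
  have z: "\<zeta> > 0" using r by (simp add: \<zeta>_def)
  have corr: "real k * ((real q)\<^sup>2 * (s + 16 * (1 - \<rho>\<^sup>2 / (1 + \<zeta>)) / s\<^sup>2)) \<le> \<epsilon> / 2"
  proof -
    have "1 - \<rho>\<^sup>2 / (1 + \<zeta>) \<le> 3 * (1 - \<rho>)"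
    proof -
      have "3 * (1 - \<rho>) * (2 - \<rho>) - (2 - \<rho> - \<rho>\<^sup>2) = 4 * (1 - \<rho>)\<^sup>2" by (simp add: power2_eq_square algebra_simps)
      then have "2 - \<rho> - \<rho>\<^sup>2 \<le> 3 * (1 - \<rho>) * (2 - \<rho>)" by (smt (verit) zero_le_power2)
      then have "(2 - \<rho> - \<rho>\<^sup>2) / (2 - \<rho>) \<le> 3 * (1 - \<rho>)" using r by (simp add: pos_divide_le_eq)
      moreover have "1 - \<rho>\<^sup>2 / (1 + \<zeta>) = (2 - \<rho> - \<rho>\<^sup>2) / (2 - \<rho>)"
        using r by (simp add: \<zeta>_def field_simps)
      ultimately show ?thesis by simp
    qed
    also have "\<dots> \<le> s ^ 3 / 16" using r1 x(3) by simp
    finally have le: "1 - \<rho>\<^sup>2 / (1 + \<zeta>) \<le> s ^ 3 / 16" .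
    have "16 * y \<le> s ^ 3" if "y \<le> s ^ 3 / 16" for y using that by simp
    from this[OF le] have "16 * (1 - \<rho>\<^sup>2 / (1 + \<zeta>)) \<le> s ^ 3" .
    then have "16 * (1 - \<rho>\<^sup>2 / (1 + \<zeta>)) / s\<^sup>2 \<le> s ^ 3 / s\<^sup>2" by (rule divide_right_mono) simp
    also have "s ^ 3 / s\<^sup>2 = s" using s0 by (simp add: power3_eq_cube power2_eq_square)
    finally have "real k * ((real q)\<^sup>2 * (s + 16 * (1 - \<rho>\<^sup>2 / (1 + \<zeta>)) / s\<^sup>2)) \<le> real k * ((real q)\<^sup>2 * (s + s))"
      by (intro mult_left_mono add_left_mono) auto
    also have "\<dots> = \<epsilon> / 2" using k1 q0 by (simp add: s_def)
    finally show ?thesis .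
  qed
  define \<kappa> where "\<kappa> = ln (1 / x) / (32 * ln (real B))"
  have lnB: "ln (real B) > 0" using B2r by simp
  have \<kappa>: "0 < \<kappa>" "\<kappa> \<le> 1"
  proof -
    have "ln (1 / x) > 0" using x by simp
    then show "0 < \<kappa>" unfolding \<kappa>_def using lnB by simp
    have "1 / x \<le> 2" using x by (simp add: field_simps)
    then have "ln (1 / x) \<le> ln 2" using x by (subst ln_le_cancel_iff) auto
    also have "\<dots> \<le> ln (real B)" using B2r by simp
    also have "\<dots> \<le> 32 * ln (real B)" using lnB by simp
    finally show "\<kappa> \<le> 1" unfolding \<kappa>_def using lnB by (simp add: divide_le_eq)
  qed
  \<comment> \<open>Of the exponent, \<open>8 * h\<close> pays for the density condition and the
    rest for the factor \<open>3 * N1\<close>; the bad edges need only about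
    \<open>4 * h\<close>.\<close>
  define N where "N h = B ^ (16 * h)" for h
  define n where "n h = k * N h" for h
  define rd where "rd h = nat \<lfloor>real (n h) powr \<kappa>\<rfloor>" for h
  define F where "F h = (2 * real h + 1) * x ^ h" for h
  have F0: "F h \<ge> 0" for h using x by (simp add: F_def)
  have xF: "x ^ h \<le> F h" for h
    unfolding F_def using mult_right_mono[of 1 "2 * real h + 1" "x ^ h"] x by simp
  define P where "P m \<longleftrightarrow> (\<exists>I. ne_csp q k m I \<and> ne_opt q m I \<le> \<epsilon> \<and> k \<le> nat \<lfloor>real m powr \<kappa>\<rfloor> \<and>
      (\<exists>D. sa_solution q m (nat \<lfloor>real m powr \<kappa>\<rfloor>) D \<and> sa_value I D \<ge> 1 - 1 / real q - \<epsilon>))" for m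
  define k2 where "k2 = (real k)\<^sup>2"
  have k2: "k2 \<ge> 1" using k1 by (simp add: k2_def one_le_power)
  have r2: "\<rho>\<^sup>2 < 1" using r by (simp add: power_less_one_iff)
  have main: "P (n h)" if h: "h \<ge> 1"
    and c1: "k2 * F h \<le> 1 / 3" and c2: "2 * (k2 * F h) / (1 - \<rho>\<^sup>2) \<le> 1 / 8"
    and c3: "k2 * real q * F h \<le> 1" and c4: "2 * (k2 * real q * F h) / (1 - \<rho>\<^sup>2)\<^sup>2 < \<zeta>"
    and c5: "8 * real B ^ 6 / \<epsilon> * F h \<le> 1" for h
  proof -
    have N1: "N h \<ge> 1" using B2 by (simp add: N_def)
    interpret RI: random_incidence q k "N h" M
      by standard (use assms(2) k1 N1 M1 in auto)
    have xh: "x ^ h > 0" using x by simp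
    have sq: "(real (n h) powr \<kappa>)\<^sup>2 = (real k powr \<kappa>)\<^sup>2 * (1 / x) ^ h"
      using powr_const_times_power[of "real B" x "real k" h] B2r x k1
      unfolding \<kappa>_def[symmetric] by (simp add: n_def N_def)
    have kp: "1 \<le> real k powr \<kappa>" "real k powr \<kappa> \<le> real k"
      using k1 \<kappa> powr_mono[of \<kappa> 1 "real k"] by (auto simp: ge_one_powr_ge_zero)
    have rd_le: "real (rd h) \<le> real (n h) powr \<kappa>" unfolding rd_def by simp
    have rd2: "(real (rd h))\<^sup>2 \<le> k2 / x ^ h"
    proof -
      have "(real (rd h))\<^sup>2 \<le> (real (n h) powr \<kappa>)\<^sup>2" using rd_le by (intro power_mono) auto
      also have "\<dots> \<le> k2 * (1 / x) ^ h"
        unfolding sq k2_def using kp x by (intro mult_right_mono power_mono) auto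
      finally show ?thesis by (simp add: power_divide)
    qed
    \<comment> \<open>The local distributions must cover the scopes of the predicates.\<close>
    have krd: "k \<le> rd h"
    proof -
      have "k2 * x ^ h \<le> k2 * F h" using xF k2 by (intro mult_left_mono) auto
      also have "\<dots> \<le> 1" using c1 by simp
      finally have "(real k)\<^sup>2 \<le> 1 / x ^ h" using xh by (simp add: k2_def field_simps)
      also have "\<dots> \<le> (real (n h) powr \<kappa>)\<^sup>2"
      proof -
        have "1 * (1 / x) ^ h \<le> (real k powr \<kappa>)\<^sup>2 * (1 / x) ^ h"
          using kp x by (intro mult_right_mono) (auto simp: one_le_power)
        then show ?thesis unfolding sq by (simp add: power_divide)
      qed
      finally have "real k \<le> real (n h) powr \<kappa>" by (rule power2_le_imp_le) simp
      then show ?thesis unfolding rd_def by (simp add: le_nat_floor)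
    qed
    define N1 where "N1 = (rd h)\<^sup>2 * (2 * h + 1)"
    have N1_le: "real N1 \<le> k2 * (2 * real h + 1) / x ^ h"
    proof -
      have "real N1 = (real (rd h))\<^sup>2 * (2 * real h + 1)" by (simp add: N1_def algebra_simps)
      also have "\<dots> \<le> k2 / x ^ h * (2 * real h + 1)" by (intro mult_right_mono rd2) auto
      finally show ?thesis by simp
    qed
    \<comment> \<open>Two factors \<open>x ^ h\<close> are spent: one cancels the growth of the
      squared number of rounds, the other beats the linear factor.\<close>
    have N1F: "real N1 * (x ^ h * x ^ h) \<le> k2 * F h"
    proof -
      have "real N1 * (x ^ h * x ^ h) \<le> k2 * (2 * real h + 1) / x ^ h * (x ^ h * x ^ h)"
        using xh by (intro mult_right_mono N1_le) auto
      moreover have "a / y * (y * y) = a * y" if "y > 0" for a y :: real using that by simp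
      note this[OF xh, of "k2 * (2 * real h + 1)"]
      ultimately show ?thesis by (simp only: F_def mult.assoc)
    qed
    have xpow: "x ^ (a * h) \<le> x ^ h * x ^ h" if "2 \<le> a" for a
    proof -
      have "x ^ (a * h) \<le> x ^ (2 * h)" using x that by (intro power_decreasing mult_le_mono1) auto
      then show ?thesis by (simp add: mult_2 power_add)
    qed
    have \<rho>2h: "\<rho> ^ (2 * h) = x ^ (8 * h)" by (simp add: \<rho>_def flip: power_mult)
    have small: "2 * \<rho> ^ (2 * h) / (1 - \<rho>\<^sup>2) * real N1 \<le> 1 / 8"
    proof -
      have "real N1 * x ^ (8 * h) \<le> k2 * F h"
        using mult_left_mono[OF xpow[of 8], of "real N1"] N1F by simp
      then have "2 * (real N1 * x ^ (8 * h)) / (1 - \<rho>\<^sup>2) \<le> 2 * (k2 * F h) / (1 - \<rho>\<^sup>2)"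
        using r2 by (intro divide_right_mono) auto
      then have "2 * (real N1 * x ^ (8 * h)) / (1 - \<rho>\<^sup>2) \<le> 1 / 8" using c2 by (rule order_trans)
      moreover have "2 * \<rho> ^ (2 * h) / (1 - \<rho>\<^sup>2) * real N1 = 2 * (real N1 * x ^ (8 * h)) / (1 - \<rho>\<^sup>2)"
        unfolding \<rho>2h by (simp only: times_divide_eq_left times_divide_eq_right mult_ac)
      ultimately show ?thesis by (simp only:)
    qed
    have small': "2 * (\<rho> ^ (2 * h + 1))\<^sup>2 * (real (N1 * q)) ^ 5 / (1 - \<rho>\<^sup>2)\<^sup>2 < \<zeta>"
    proof -
      let ?w = "k2 * real q * F h"
      have w0: "?w \<ge> 0" using k2 F0 by simp
      have "(\<rho> ^ (2 * h + 1))\<^sup>2 \<le> (\<rho> ^ (2 * h))\<^sup>2"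
        using r by (intro power_mono power_decreasing) auto
      also have "\<dots> = x ^ (16 * h)" unfolding \<rho>2h by (simp flip: power_mult)
      also have "\<dots> \<le> x ^ (5 * (3 * h))" using x by (intro power_decreasing) auto
      also have "\<dots> = (x ^ (3 * h)) ^ 5" by (simp add: mult.commute flip: power_mult)
      finally have "(\<rho> ^ (2 * h + 1))\<^sup>2 * (real (N1 * q)) ^ 5 \<le> (x ^ (3 * h)) ^ 5 * (real (N1 * q)) ^ 5"
        by (intro mult_right_mono) auto
      also have "\<dots> = (real N1 * x ^ (3 * h) * real q) ^ 5" by (simp add: power_mult_distrib mult_ac)
      also have "\<dots> \<le> ?w ^ 5"
      proof (intro power_mono)
        have "real N1 * x ^ (3 * h) \<le> k2 * F h"
          using mult_left_mono[OF xpow[of 3], of "real N1"] N1F by simp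
        then have "real N1 * x ^ (3 * h) * real q \<le> k2 * F h * real q" by (intro mult_right_mono) auto
        then show "real N1 * x ^ (3 * h) * real q \<le> ?w" by (simp add: mult_ac)
      qed (use x in auto)
      \<comment> \<open>Once \<open>?w\<close> is at most 1 its fifth power may be replaced by
        \<open>?w\<close>, and smallness of \<open>?w\<close> alone suffices.\<close>
      also have "\<dots> \<le> ?w ^ 1" using w0 c3 by (intro power_decreasing) auto
      finally have "2 * ((\<rho> ^ (2 * h + 1))\<^sup>2 * (real (N1 * q)) ^ 5) / (1 - \<rho>\<^sup>2)\<^sup>2 \<le> 2 * ?w / (1 - \<rho>\<^sup>2)\<^sup>2"
        by (intro divide_right_mono) auto
      from le_less_trans[OF this c4] show ?thesis by (simp only: mult.assoc)
    qed
    have x2: "1 / x \<le> 2" using x by (simp add: field_simps)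
    have N1B: "3 * N1 * (4 * (18 * k * M)) ^ (8 * h) \<le> N h"
    proof -
      have "3 * real N1 * (x ^ h * x ^ h) \<le> 1" using N1F c1 by simp
      then have "3 * real N1 \<le> 1 / (x ^ h * x ^ h)" using xh by (subst pos_le_divide_eq) auto
      also have "\<dots> = (1 / x) ^ (2 * h)" by (simp add: power_divide mult_2 power_add)
      also have "\<dots> \<le> real B ^ (2 * h)" using x2 x B2r by (intro power_mono) auto
      also have "\<dots> \<le> real B ^ (8 * h)" using B2r by (intro power_increasing) auto
      finally have "real (3 * N1) \<le> real (B ^ (8 * h))" by simp
      then have "3 * N1 \<le> B ^ (8 * h)" by (simp only: of_nat_le_iff)
      then have "3 * N1 * B ^ (8 * h) \<le> B ^ (8 * h) * B ^ (8 * h)" by (rule mult_le_mono1)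
      also have "\<dots> = N h" by (simp add: N_def flip: power_add)
      finally show ?thesis unfolding B_def .
    qed
    define R where "R = nat \<lfloor>\<epsilon> / 2 * real (M * N h)\<rfloor>"
    have e0: "\<epsilon> / 2 * real (M * N h) \<ge> 0" using assms(1) by simp
    have R_le: "real R \<le> \<epsilon> / 2 * real (M * N h)" unfolding R_def by (rule of_nat_floor[OF e0])
    have R_ge: "4 * (4 * (18 * k * M)) ^ (4 * h + 6) \<le> R"
    proof -
      have "8 * real B ^ 6 / \<epsilon> * x ^ h \<le> 8 * real B ^ 6 / \<epsilon> * F h"
        using xF assms(1) by (intro mult_left_mono) auto
      also have "\<dots> \<le> 1" by (rule c5)
      finally have "8 * real B ^ 6 / \<epsilon> \<le> (1 / x) ^ h" using xh by (simp add: power_divide field_simps)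
      also have "\<dots> \<le> real B ^ h" using x2 x B2r by (intro power_mono) auto
      also have "\<dots> \<le> real B ^ (12 * h)" using B2r by (intro power_increasing) auto
      finally have "8 * real B ^ 6 \<le> \<epsilon> * real B ^ (12 * h)" using assms(1) by (simp add: field_simps)
      then have "4 * real B ^ 6 * real B ^ (4 * h) \<le> \<epsilon> / 2 * real B ^ (12 * h) * real B ^ (4 * h)"
        using B2r by (intro mult_right_mono) auto
      also have "\<dots> = \<epsilon> / 2 * real (N h)" by (simp add: N_def flip: power_add)
      also have "\<dots> \<le> \<epsilon> / 2 * real (M * N h)"
        using M1 assms(1) by (intro mult_left_mono of_nat_mono) auto
      finally have "real (4 * B ^ (4 * h + 6)) \<le> \<epsilon> / 2 * real (M * N h)"
        by (simp add: power_add mult_ac)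
      then have "4 * B ^ (4 * h + 6) \<le> R" unfolding R_def by (rule le_nat_floor)
      then show ?thesis unfolding B_def .
    qed
    define t where "t = nat \<lceil>\<epsilon> * real (M * N h)\<rceil>"
    have t_ge: "real t \<ge> \<epsilon> * real (M * N h)" unfolding t_def by (rule real_nat_ceiling_ge)
    have t_le: "real t - 1 \<le> \<epsilon> * real (M * N h)"
    proof -
      have "\<epsilon> * real (M * N h) \<ge> 0" using assms(1) by simp
      then have "0 \<le> \<lceil>\<epsilon> * real (M * N h)\<rceil>" unfolding zero_le_ceiling by linarith
      then have "real t = of_int \<lceil>\<epsilon> * real (M * N h)\<rceil>" unfolding t_def by (rule of_nat_nat)
      then show ?thesis using ceiling_correct[of "\<epsilon> * real (M * N h)"] by linarith
    qed
    have opt: "real q ^ (k * N h) * 2 ^ (M * N h) * (?p ^ k) ^ t \<le> 1 / 4"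
    proof -
      have "real (M * N h) = 1 / \<epsilon> * (\<epsilon> * real (M * N h))" using assms(1) by simp
      also have "\<dots> \<le> real K * real t" using K t_ge assms(1) by (intro mult_mono) auto
      finally have Kt: "M * N h \<le> K * t" by (metis of_nat_le_iff of_nat_mult)
      have "(?p ^ k) ^ t \<le> ((1 / 4) ^ K) ^ t" using k p by (intro power_mono) auto
      also have "\<dots> = (1 / 4) ^ (K * t)" by (simp only: power_mult)
      also have "\<dots> \<le> (1 / 4) ^ (M * N h)" using Kt by (intro power_decreasing) auto
      finally have "real q ^ (k * N h) * 2 ^ (M * N h) * (?p ^ k) ^ t
          \<le> real q ^ (k * N h) * 2 ^ (M * N h) * (1 / 4) ^ (M * N h)"
        by (intro mult_left_mono) auto
      also have "\<dots> = (real q ^ k * (2 * (1 / 4)) ^ M) ^ N h"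
        by (simp only: power_mult power_mult_distrib mult.assoc)
      also have "\<dots> \<le> (1 / 4) ^ N h"
      proof (intro power_mono)
        have "real q ^ k * (2 * (1 / 4)) ^ M = real q ^ k / 2 ^ M" by (simp add: power_divide)
        also have "\<dots> \<le> 1 / 4" using M by (simp add: field_simps)
        finally show "real q ^ k * (2 * (1 / 4)) ^ M \<le> 1 / 4" .
      qed auto
      also have "\<dots> \<le> (1 / 4) ^ 1" using N1 by (intro power_decreasing) auto
      finally show ?thesis by simp
    qed
    have "\<exists>I D. ne_csp q k (k * N h) I \<and> ne_opt q (k * N h) I \<le> \<epsilon> \<and> sa_solution q (k * N h) (rd h) D \<and>
        sa_value I D \<ge> 1 - 1 / real q - \<epsilon>"
      by (rule RI.sa_gap_instance[OF r z h assms(1) N1B R_ge R_le opt t_le small small' _ krd s0 corr])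
        (simp add: N1_def)
    then show ?thesis using krd unfolding P_def n_def[symmetric] rd_def by blast
  qed
  have ev: "eventually (\<lambda>h. C * F h < d) sequentially" if "d > 0" for C d :: real
  proof -
    have "(\<lambda>h. C * F h) \<longlonglongrightarrow> C * 0"
      unfolding F_def using x by (intro tendsto_mult tendsto_const linear_times_power_tendsto_0) auto
    then show ?thesis using that by (intro order_tendstoD(2)[where y = "C * 0"]) auto
  qed
  have e1: "eventually (\<lambda>h. k2 * F h < 1 / 3) sequentially" by (rule ev) simp
  have e2: "eventually (\<lambda>h. 2 * (k2 * F h) / (1 - \<rho>\<^sup>2) < 1 / 8) sequentially"
    using ev[of "1 / 8" "2 * k2 / (1 - \<rho>\<^sup>2)"] by (simp only: times_divide_eq_left mult.assoc)
  have e3: "eventually (\<lambda>h. k2 * real q * F h < 1) sequentially" by (rule ev) simp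
  have e4: "eventually (\<lambda>h. 2 * (k2 * real q * F h) / (1 - \<rho>\<^sup>2)\<^sup>2 < \<zeta>) sequentially"
    using ev[OF z, of "2 * (k2 * real q) / (1 - \<rho>\<^sup>2)\<^sup>2"] by (simp only: times_divide_eq_left mult.assoc)
  have e5: "eventually (\<lambda>h. 8 * real B ^ 6 / \<epsilon> * F h < 1) sequentially" by (rule ev) simp
  have "eventually (\<lambda>h. P (n h)) sequentially"
    using eventually_ge_at_top[of 1] e1 e2 e3 e4 e5
  proof eventually_elim
    case (elim h)
    show ?case
      by (rule main[OF elim(1) less_imp_le[OF elim(2)] less_imp_le[OF elim(3)] less_imp_le[OF elim(4)] elim(5) less_imp_le[OF elim(6)]])
  qed
  then obtain h0 where h0: "\<And>h. h \<ge> h0 \<Longrightarrow> P (n h)" by (auto simp: eventually_sequentially)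
  have "infinite {m. P m}"
    unfolding infinite_nat_iff_unbounded
  proof
    fix m
    define h where "h = max m h0"
    have "m \<le> h" by (simp add: h_def)
    also have "h < 2 ^ h" by (rule less_exp)
    also have "(2::nat) ^ h \<le> B ^ h" using B2 by (intro power_mono) auto
    also have "\<dots> \<le> B ^ (16 * h)" using B2 by (intro power_increasing) auto
    also have "\<dots> \<le> n h" using k1 by (simp add: n_def N_def)
    finally show "\<exists>a>m. a \<in> {m. P m}" using h0[of h] by (intro exI[of _ "n h"]) (simp add: h_def)
  qed
  then show ?thesis using \<kappa>(1) k1 unfolding P_def by blast
qed

end
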